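(* Let $G=(V,E)$ be an unoriented, connected, infinite graph without self-loops with $\Delta(G)=\sup_{x\in V}\deg(x)<\infty$, and let $j$ be an integer with $1\le j\le \delta(G)=\inf_{x\in V}\deg(x)$ which is $\omega$-good. For $p,q\in[0,1]$ let $(\eta^{\mu_p}(t))_{t\ge 0}$ be the Fredrickson-Andersen $j$-spin facilitated model on $G$ with equilibrium parameter $q$ and initial distribution $\mu_p=\mathrm{Ber}(p)^{\otimes V}$. Then there exist $\varepsilon,c>0$ such that for all $p,q\in[1-\varepsilon,1]$, every local function $f\colon\{0,1\}^V\to\mathbb{R}$ and every $t\in[0,\infty)$, $$\left|\mathbb{E}\left[f(\eta^{\mu_p}(t))\right]-\mu_q(f)\right|\le c^{-1}\,|\mathrm{supp} f|\,\|f\|_\infty\, e^{-ct},$$ where $\mu_q(f)$ denotes the integral of $f$ with respect to the measure $\mu_q=\mathrm{Ber}(q)^{\otimes V}$.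
   Context: Write $x\sim y$ if $\{x,y\}\in E$, $N(x)=\{y\in V: y\sim x\}$, $\deg(x)=|N(x)|$. Configurations are elements of $\Omega=\{0,1\}^V$, and $c_x(\eta)=\sum_{y\sim x}\eta_y$. $\mathrm{Ber}(p)$ is the law giving mass $p$ to $1$ and $1-p$ to $0$. A function $f\colon\Omega\to\mathbb{R}$ is local if there are a finite set $\mathrm{supp}(f)\subset V$ and a function $\tilde f\colon\{0,1\}^{\mathrm{supp}(f)}\to\mathbb{R}$ with $f(\eta)=\tilde f(\eta|_{\mathrm{supp}(f)})$ for all $\eta\in\Omega$. Fredrickson-Andersen $j$-spin facilitated model with equilibrium parameter $q\in[0,1]$: let $(P_x)_{x\in V}$ be independent Poisson point processes of intensity $1$ on $[0,\infty)$ and, independently, let $(U_x(t))_{x\in V,\,t\in P_x}$ be independent uniform random variables on $[0,1]$. The model is the continuous-time Markov process $\eta$ on $\Omega$ with càdlàg paths, whose initial configuration $\eta(0)$ is sampled from a prescribed law (here $\mu_p$) independently of the $P_x$ and $U_x(t)$, and such that for all $x\in V$, $t>0$: $\eta_x(t)=\mathbb{1}_{\{U_x(t)\le q\}}$ if $t\in P_x$ and $c_x(\eta(t^-))\ge j$, and $\eta_x(t)=\eta_x(t^-)$ otherwise. (Such a process exists and is almost surely unique.) $\omega$-good: let $\Phi_E=\inf\{|\partial_E K|/|K| : \emptyset\ne K\subset V,\ K \text{ finite}\}$, where $\partial_E K$ is the set of edges with exactly one endpoint in $K$. For $x\in V$, $k\in\mathbb{N}=\{0,1,2,\dots\}$ let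 $S_k(x)$ be the set of vertices at graph distance exactly $k$ from $x$, and let $$\bar j=\max\{i\in\mathbb{N} : \exists\, r\in V,\ \forall k\in\mathbb{N},\ \forall x\in S_k(r),\ i\le |S_{k+1}(r)\cap N(x)|\}.$$ An integer $j$ with $1\le j\le\delta(G)$ is $\omega$-good if at least one of the following holds: (a) $j<\Phi_E+1$; (b) $j\le\bar j$. *)

theory Defs
  imports "HOL-Probability.Probability"
begin

section \<open>Graphs\<close>

text \<open>
  The vertex set is the whole type \<open>'v\<close>; a graph is given by its set of edges, each edge
  being a two-element set of vertices.
\<close>

definition simple_graph :: "'v set set \<Rightarrow> bool" where
  "simple_graph E \<longleftrightarrow> (\<forall>e\<in>E. \<exists>x y. x \<noteq> y \<and> e = {x, y})"

definition nbrs :: "'v set set \<Rightarrow> 'v \<Rightarrow> 'v set" where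
  "nbrs E x = {y. {x, y} \<in> E}"

definition deg :: "'v set set \<Rightarrow> 'v \<Rightarrow> nat" where
  "deg E x = card (nbrs E x)"

text \<open>Finiteness of the neighbourhoods is explicit, because \<open>card\<close> is \<open>0\<close> on infinite sets.\<close>

definition bounded_degree :: "'v set set \<Rightarrow> bool" where
  "bounded_degree E \<longleftrightarrow> (\<forall>x. finite (nbrs E x)) \<and> bdd_above (range (deg E))"

definition min_degree :: "'v set set \<Rightarrow> nat" where
  "min_degree E = (INF x. deg E x)"

definition adj_rel :: "'v set set \<Rightarrow> ('v \<times> 'v) set" where
  "adj_rel E = {(x, y). {x, y} \<in> E}"

definition connected_graph :: "'v set set \<Rightarrow> bool" where
  "connected_graph E \<longleftrightarrow> (\<forall>x y. (x, y) \<in> (adj_rel E)\<^sup>*)"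

definition graph_dist :: "'v set set \<Rightarrow> 'v \<Rightarrow> 'v \<Rightarrow> nat" where
  "graph_dist E x y = (LEAST n. (x, y) \<in> adj_rel E ^^ n)"

definition graph_sphere :: "'v set set \<Rightarrow> nat \<Rightarrow> 'v \<Rightarrow> 'v set" where
  "graph_sphere E k x = {y. graph_dist E x y = k}"

definition edge_boundary :: "'v set set \<Rightarrow> 'v set \<Rightarrow> 'v set set" where
  "edge_boundary E K = {e \<in> E. card (e \<inter> K) = 1}"

definition edge_isoperimetric :: "'v set set \<Rightarrow> real" where
  "edge_isoperimetric E =
     (INF K\<in>{K. K \<noteq> {} \<and> finite K}. real (card (edge_boundary E K)) / real (card K))"

definition j_bar :: "'v set set \<Rightarrow> nat" where
  "j_bar E = Max {i. \<exists>r. \<forall>k. \<forall>x\<in>graph_sphere E k r.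
     i \<le> card (graph_sphere E (Suc k) r \<inter> nbrs E x)}"

definition omega_good :: "'v set set \<Rightarrow> nat \<Rightarrow> bool" where
  "omega_good E j \<longleftrightarrow> 1 \<le> j \<and> j \<le> min_degree E \<and>
     (real j < edge_isoperimetric E + 1 \<or> j \<le> j_bar E)"


section \<open>Configurations and local functions\<close>

text \<open>Spin values are booleans: \<open>True\<close> stands for \<open>1\<close>, \<open>False\<close> for \<open>0\<close>.\<close>

type_synonym 'v config = "'v \<Rightarrow> bool"

definition config_space :: "'v config measure" where
  "config_space = PiM UNIV (\<lambda>_. count_space UNIV)"

definition bernoulli_product :: "real \<Rightarrow> 'v config measure" where
  "bernoulli_product p = PiM UNIV (\<lambda>_. measure_pmf (bernoulli_pmf p))"

definition num_ones :: "'v set set \<Rightarrow> 'v config \<Rightarrow> 'v \<Rightarrow> nat" where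
  "num_ones E \<eta> x = (\<Sum>y\<in>nbrs E x. of_bool (\<eta> y))"

definition local_on :: "'v set \<Rightarrow> ('v config \<Rightarrow> real) \<Rightarrow> bool" where
  "local_on S f \<longleftrightarrow> finite S \<and> (\<exists>f'. \<forall>\<eta>. f \<eta> = f' (restrict \<eta> S))"

definition sup_norm :: "('v config \<Rightarrow> real) \<Rightarrow> real" where
  "sup_norm f = (SUP \<eta>. \<bar>f \<eta>\<bar>)"


section \<open>Poisson clocks with uniform marks\<close>

definition point_configs :: "real set measure" where
  "point_configs =
     (let \<Gamma> = {S. S \<subseteq> {0..} \<and> (\<forall>b. finite (S \<inter> {..b}))} in
      sigma \<Gamma> {{S \<in> \<Gamma>. card (S \<inter> A) = n} | A n. A \<in> sets borel \<and> bounded A})"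

text \<open>
  The law of the counts is written out, since \<open>poisson_pmf\<close> is only specified for strictly
  positive parameters and null sets must be covered as well.
\<close>

definition unit_poisson_process :: "'w measure \<Rightarrow> ('w \<Rightarrow> real set) \<Rightarrow> bool" where
  "unit_poisson_process M X \<longleftrightarrow>
     X \<in> M \<rightarrow>\<^sub>M point_configs \<and>
     (\<forall>A n. A \<in> sets borel \<and> bounded A \<and> A \<subseteq> {0..} \<longrightarrow>
        measure M {\<omega> \<in> space M. card (X \<omega> \<inter> A) = n} =
          measure lborel A ^ n / fact n * exp (- measure lborel A)) \<and>
     (\<forall>(A :: nat \<Rightarrow> real set) I.
        finite I \<and> disjoint_family_on A I \<and>
        (\<forall>i\<in>I. A i \<in> sets borel \<and> bounded (A i) \<and> A i \<subseteq> {0..}) \<longrightarrow>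
        prob_space.indep_vars M (\<lambda>_. count_space UNIV) (\<lambda>i \<omega>. card (X \<omega> \<inter> A i)) I)"

text \<open>The \<open>n\<close>-th smallest element of \<open>S\<close>, counting from \<open>0\<close>.\<close>

definition nth_point :: "real set \<Rightarrow> nat \<Rightarrow> real" where
  "nth_point S n = (THE t. t \<in> S \<and> card {s \<in> S. s < t} = n)"

text \<open>
  The library's \<open>indep_var\<close> forces both variables to have the same codomain type; this is
  the same notion for two codomains.
\<close>

definition indep_rvs ::
    "'w measure \<Rightarrow> 'a measure \<Rightarrow> ('w \<Rightarrow> 'a) \<Rightarrow> 'b measure \<Rightarrow> ('w \<Rightarrow> 'b) \<Rightarrow> bool" where
  "indep_rvs M S X T Y \<longleftrightarrow>
     X \<in> M \<rightarrow>\<^sub>M S \<and> Y \<in> M \<rightarrow>\<^sub>M T \<and>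
     prob_space.indep_set M {X -` A \<inter> space M | A. A \<in> sets S}
                            {Y -` B \<inter> space M | B. B \<in> sets T}"

text \<open>
  The marks \<open>U x t\<close> are indexed by the random times \<open>t \<in> P x\<close>. That they are i.i.d. uniform
  and independent of the clocks is expressed by listing the points of each clock in
  increasing order: \<open>mark x n\<close> is the mark of the \<open>n\<close>-th ring at \<open>x\<close>.
\<close>

locale marked_clocks = prob_space M
  for M :: "'w measure" +
  fixes P :: "'v \<Rightarrow> 'w \<Rightarrow> real set" and U :: "'v \<Rightarrow> real \<Rightarrow> 'w \<Rightarrow> real"
  fixes clocks :: "'w \<Rightarrow> 'v \<Rightarrow> real set" and marks :: "'w \<Rightarrow> 'v \<times> nat \<Rightarrow> real"
  defines "clocks \<equiv> \<lambda>\<omega> x. P x \<omega>"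
  defines "marks \<equiv> \<lambda>\<omega> (x, n). U x (nth_point (P x \<omega>) n) \<omega>"
  assumes clocks_poisson: "\<And>x. unit_poisson_process M (P x)"
    and clocks_indep: "indep_vars (\<lambda>_. point_configs) P UNIV"
    and marks_uniform:
      "\<And>i. distr M borel (\<lambda>\<omega>. marks \<omega> i) = uniform_measure lborel {0..1}"
    and marks_indep: "indep_vars (\<lambda>_. borel) (\<lambda>i \<omega>. marks \<omega> i) UNIV"
    and clocks_marks_indep:
      "indep_rvs M (PiM UNIV (\<lambda>_. point_configs)) clocks (PiM UNIV (\<lambda>_. borel)) marks"


section \<open>The Fredrickson--Andersen \<open>j\<close>-spin facilitated model\<close>

text \<open>Right-continuity and left limits refer to the product topology on configurations.\<close>

definition cadlag :: "(real \<Rightarrow> 'a::topological_space) \<Rightarrow> bool" where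
  "cadlag h \<longleftrightarrow>
     (\<forall>t\<ge>0. (h \<longlongrightarrow> h t) (at_right t)) \<and> (\<forall>t>0. \<exists>l. (h \<longlongrightarrow> l) (at_left t))"

text \<open>
  In the product topology limits are coordinatewise. (The library's \<open>Lim\<close> is not available
  on \<open>'v config\<close> directly, for want of a \<open>t2_space\<close> instance for arbitrary \<open>'v\<close>.)
\<close>

definition left_limit :: "(real \<Rightarrow> 'v config) \<Rightarrow> real \<Rightarrow> 'v config" where
  "left_limit h t = (\<lambda>x. Lim (at_left t) (\<lambda>s. h s x))"

locale FA_model = marked_clocks M P U
  for M :: "'w measure" and P :: "'v \<Rightarrow> 'w \<Rightarrow> real set" and U :: "'v \<Rightarrow> real \<Rightarrow> 'w \<Rightarrow> real" +
  fixes E :: "'v set set" and j :: nat and q :: real and \<mu>\<^sub>0 :: "'v config measure"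
    and \<eta> :: "real \<Rightarrow> 'w \<Rightarrow> 'v config"
  assumes state_measurable: "\<And>t. 0 \<le> t \<Longrightarrow> \<eta> t \<in> M \<rightarrow>\<^sub>M config_space"
    and initial_law: "distr M config_space (\<eta> 0) = \<mu>\<^sub>0"
    and initial_indep:
      "indep_rvs M config_space (\<eta> 0)
         (PiM UNIV (\<lambda>_. point_configs) \<Otimes>\<^sub>M PiM UNIV (\<lambda>_. borel)) (\<lambda>\<omega>. (clocks \<omega>, marks \<omega>))"
    and paths_cadlag: "AE \<omega> in M. cadlag (\<lambda>t. \<eta> t \<omega>)"
    and dynamics: "AE \<omega> in M. \<forall>x. \<forall>t>0.
      \<eta> t \<omega> x =
        (if t \<in> P x \<omega> \<and> j \<le> num_ones E (left_limit (\<lambda>s. \<eta> s \<omega>) t) x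
         then U x t \<omega> \<le> q
         else left_limit (\<lambda>s. \<eta> s \<omega>) t x)"

end

theory Submission
  imports Defs "HOL-Library.Transitive_Closure_Table"
begin

text \<open>
  Run two copies of the model with the same clocks and marks, one started from \<open>Ber(p)\<close> and
  one from \<open>Ber(q)\<close>. The second copy is stationary, because an update of \<open>x\<close> that is allowed
  replaces the spin by an independent \<open>Ber(q)\<close> variable and whether it is allowed does not
  depend on the spin at \<open>x\<close> itself. The two sides of the estimate are therefore expectations of
  \<open>f\<close> along the two copies, and it suffices to bound the probability that the copies disagree
  at a site \<open>x\<close> at time \<open>t\<close> by an exponential in \<open>t\<close>.

  A disagreement is a place where one of the copies has a zero, and a disagreement can only be
  inherited from an earlier disagreement at the same site or at a neighbour. So a disagreement at
  time \<open>t\<close> is joined to time \<open>0\<close> by a path of zeros in space-time. Cut time into \<open>K\<close>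
  blocks of a long fixed duration. A site behaves badly during a block if its clock does not ring
  or if some ring proposes a zero; for \<open>p\<close> and \<open>q\<close> close to \<open>1\<close> this is rare. A
  site-block which is zero although it and its predecessor behave well must have had a ring
  that was suppressed, so in the preceding block fewer than \<open>j\<close> of its neighbours stayed at one
  throughout (\<open>zero_rule_single\<close>). Call the other zero site-blocks defects. This
  reduction turns the problem into a deterministic one: show that a path of zeros of
  duration \<open>K\<close> forces a space-time walk on which defects have positive density and number
  at least a multiple of \<open>K\<close>. This is where \<open>j\<close> has to be \<open>\<omega>\<close>-good.

  \<^item> If \<open>j < \<Phi> + 1\<close>, where \<open>\<Phi>\<close> is the edge-isoperimetric constant, consider the connected
    cluster of zeros. In each time slice of the cluster the average number of edges leaving the
    slice is at least \<open>\<Phi> > j - 1\<close> per site, while sites that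
    survive to the next slice without being a defect have at most \<open>j - 1\<close> such edges. So a
    fixed fraction of the cluster consists of defects
    (\<open>defects_of_cluster_isoperimetric\<close>), and a walk through the whole cluster does the job.
  \<^item> If \<open>j \<le> j_bar E\<close>, every vertex has \<open>j\<close> neighbours one level further from a
    root, so a zero that is not a defect has a zero neighbour one level up at the
    preceding time. Following these neighbours upwards until a defect is met, as in Toom's contour
    argument, connects the path of zeros to a chain of defects; the cost of each link of the
    chain telescopes in level and time (\<open>layered_walk\<close>).

  Given the walk, a union bound over walks and over the positions of the bad site-blocks yields
  exponential decay (\<open>prob_disagreement_le\<close>), since distinct site-blocks are independent.

  On the infinite graph in continuous time, updates cannot be listed in order. Therefore
  the estimate is proved for a finite system in discrete time, with bounds that depend
  neither on the volume nor on the mesh, and the process is compared with such systems. Within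
  a short time interval influence travels only along walks of ringing vertices, which are
  rarely long, and in a fine mesh rings in a finite volume are separated
  (\<open>discretisation\<close>). The comparison fails with arbitrarily small probability, so
  the estimate passes to the process (\<open>convergence_in_blocks\<close>).
\<close>

section \<open>Walks\<close>

definition walk :: "('a \<Rightarrow> 'a set) \<Rightarrow> 'a list \<Rightarrow> bool" where
  "walk N w \<longleftrightarrow> w \<noteq> [] \<and> successively (\<lambda>x y. y \<in> N x) w"

lemma walk_Cons: "walk N (x # w) \<longleftrightarrow> w = [] \<or> (hd w \<in> N x \<and> walk N w)"
  by (auto simp: walk_def successively_Cons)

lemma walk_append:
  "walk N u \<Longrightarrow> walk N v \<Longrightarrow> hd v \<in> N (last u) \<Longrightarrow> walk N (u @ v)"
  by (auto simp: walk_def successively_append_iff)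

lemma walk_join:
  assumes "walk N u" "walk N v" "last u = hd v"
  shows "walk N (u @ tl v)"
proof (cases "tl v = []")
  case True then show ?thesis using assms by simp
next
  case False
  then obtain a b v' where v: "v = a # b # v'" by (cases v; cases "tl v") auto
  show ?thesis using assms by (auto simp: v walk_def successively_append_iff successively_Cons)
qed

lemma walk_rev:
  assumes "walk N w" and sym: "\<And>x y. y \<in> N x \<Longrightarrow> x \<in> N y"
  shows "walk N (rev w)"
  using assms(1) unfolding walk_def by (auto intro: successively_mono[OF _ sym])

lemma walk_pad:
  assumes "walk N w" "\<And>x. x \<in> N x" "length w \<le> n"
  shows "\<exists>w'. walk N w' \<and> hd w' = hd w \<and> set w \<subseteq> set w' \<and> length w' = n"
proof -
  have "walk N (w @ replicate m (last w))" for m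
  proof (induction m)
    case 0 then show ?case using assms by simp
  next
    case (Suc m)
    have "last (w @ replicate m (last w)) = last w" by (cases m) auto
    then have "walk N ((w @ replicate m (last w)) @ [last w])"
      using Suc assms(2) by (intro walk_append[OF Suc]) (simp_all add: walk_def)
    then show ?case by (simp add: replicate_append_same)
  qed
  then show ?thesis using assms
    by (intro exI[of _ "w @ replicate (n - length w) (last w)"]) (auto simp: walk_def)
qed

lemma card_walks:
  assumes "\<And>x. finite (N x)" "\<And>x. card (N x) \<le> D"
  shows "finite {w. walk N w \<and> hd w = x \<and> length w = Suc n} \<and>
         card {w. walk N w \<and> hd w = x \<and> length w = Suc n} \<le> D ^ n"
proof (induction n arbitrary: x)
  case 0
  have "{w. walk N w \<and> hd w = x \<and> length w = Suc 0} = {[x]}"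
    by (auto simp: length_Suc_conv walk_def)
  then show ?case by simp
next
  case (Suc n)
  let ?W = "\<lambda>x n. {w. walk N w \<and> hd w = x \<and> length w = Suc n}"
  have eq: "?W x (Suc n) = (\<Union>y\<in>N x. (#) x ` ?W y n)"
  proof (intro equalityI subsetI)
    fix w assume w: "w \<in> ?W x (Suc n)"
    then obtain y v where wv: "w = x # y # v"
      by (cases w; cases "tl w") auto
    with w have "y \<in> N x" "y # v \<in> ?W y n"
      by (auto simp: walk_def)
    then show "w \<in> (\<Union>y\<in>N x. (#) x ` ?W y n)"
      unfolding wv by blast
  next
    fix w assume "w \<in> (\<Union>y\<in>N x. (#) x ` ?W y n)"
    then show "w \<in> ?W x (Suc n)" by (auto simp: walk_Cons)
  qed
  have "card (?W x (Suc n)) \<le> (\<Sum>y\<in>N x. card ((#) x ` ?W y n))"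
    unfolding eq by (rule card_UN_le) (rule assms)
  also have "\<dots> \<le> (\<Sum>y\<in>N x. D ^ n)"
    by (intro sum_mono) (use Suc in \<open>auto intro: order_trans[OF card_image_le]\<close>)
  also have "\<dots> \<le> D * D ^ n"
    using assms(2)[of x] by simp
  finally have "card (?W x (Suc n)) \<le> D ^ Suc n" by simp
  moreover have "finite (?W x (Suc n))"
    unfolding eq using assms(1) Suc by blast
  ultimately show ?case by blast
qed

text \<open>
  The walk grows by one vertex at a time: a new vertex \<open>u\<close> adjacent to a visited \<open>v\<close> is
  reached by a detour \<open>v, u, v\<close>, which adds two steps.
\<close>

lemma spanning_walk:
  assumes fin: "finite A" and a: "a \<in> A"
    and sym: "\<And>x y. y \<in> N x \<Longrightarrow> x \<in> N y"
    and conn: "\<And>x. x \<in> A \<Longrightarrow> (\<lambda>x y. y \<in> N x \<and> y \<in> A)\<^sup>*\<^sup>* a x"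
  shows "\<exists>w. walk N w \<and> hd w = a \<and> set w = A \<and> length w \<le> 2 * card A"
proof -
  have "\<exists>w. walk N w \<and> hd w = a \<and> set w \<subseteq> A \<and> length w < 2 * card (set w) \<and> n \<le> card (set w)"
    if "n \<le> card A" for n
    using that
  proof (induction n)
    case 0
    show ?case by (rule exI[of _ "[a]"]) (auto simp: walk_def a)
  next
    case (Suc n)
    then obtain w where w: "walk N w" "hd w = a" "set w \<subseteq> A" "length w < 2 * card (set w)"
      "n \<le> card (set w)" by auto
    show ?case
    proof (cases "set w = A")
      case True
      then show ?thesis using w Suc.prems by auto
    next
      case False
      then obtain b where b: "b \<in> A" "b \<notin> set w" using w by auto
      have "\<exists>v u. v \<in> set w \<and> u \<in> N v \<and> u \<in> A \<and> u \<notin> set w"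
      proof (rule ccontr)
        assume *: "\<not> ?thesis"
        have "c \<in> set w" if "(\<lambda>x y. y \<in> N x \<and> y \<in> A)\<^sup>*\<^sup>* a c" for c
          using that
          by (induction rule: rtranclp_induct) (use w * in \<open>auto simp: walk_def\<close>)
        with conn[OF b(1)] b(2) show False by blast
      qed
      then obtain v u where vu: "v \<in> set w" "u \<in> N v" "u \<in> A" "u \<notin> set w" by blast
      then obtain xs ys where xy: "w = xs @ v # ys" by (meson split_list)
      let ?w = "xs @ v # u # v # ys"
      have "walk N ?w" using w(1) vu(2) sym[OF vu(2)]
        by (auto simp: walk_def xy successively_append_iff successively_Cons)
      moreover have "hd ?w = a" using w(2) by (cases xs) (auto simp: xy)
      moreover have s: "set ?w = insert u (set w)" by (auto simp: xy)
      moreover have "card (set ?w) = Suc (card (set w))" using vu s by simp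
      moreover have "length ?w = length w + 2" by (simp add: xy)
      ultimately show ?thesis using w vu by (intro exI[of _ ?w]) auto
    qed
  qed
  from this[OF order_refl] obtain w where "walk N w" "hd w = a" "set w \<subseteq> A"
    "length w < 2 * card (set w)" "card A \<le> card (set w)" by blast
  moreover then have "set w = A" using fin by (simp add: card_seteq)
  ultimately show ?thesis by (intro exI[of _ w]) auto
qed

section \<open>Space-time and the zeros of a facilitated process\<close>

definition spacetime_nbrs :: "'v set set \<Rightarrow> 'v \<times> nat \<Rightarrow> ('v \<times> nat) set" where
  "spacetime_nbrs E p = {(y, l). (y = fst p \<and> (l = snd p \<or> l = Suc (snd p) \<or> snd p = Suc l))
                               \<or> (y \<in> nbrs E (fst p) \<and> l = snd p)}"

lemma nbrs_sym: "y \<in> nbrs E x \<longleftrightarrow> x \<in> nbrs E y"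
  by (simp add: nbrs_def insert_commute)

lemma spacetime_nbrs_sym: "q \<in> spacetime_nbrs E p \<Longrightarrow> p \<in> spacetime_nbrs E q"
  by (auto simp: spacetime_nbrs_def nbrs_sym)

lemma spacetime_nbrs_refl: "p \<in> spacetime_nbrs E p"
  by (auto simp: spacetime_nbrs_def)

lemma card_spacetime_nbrs:
  assumes "\<And>x. finite (nbrs E x)" "\<And>x. card (nbrs E x) \<le> D"
  shows "finite (spacetime_nbrs E p)" "card (spacetime_nbrs E p) \<le> D + 3"
proof -
  obtain x k where p: "p = (x, k)" by force
  have sub: "spacetime_nbrs E p \<subseteq> (\<lambda>y. (y, k)) ` nbrs E x \<union> {(x, k), (x, Suc k), (x, k - 1)}"
    by (auto simp: spacetime_nbrs_def p)
  have f: "finite ((\<lambda>y. (y, k)) ` nbrs E x \<union> {(x, k), (x, Suc k), (x, k - 1)})"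
    using assms by simp
  show "finite (spacetime_nbrs E p)" by (rule finite_subset[OF sub f])
  have "card (spacetime_nbrs E p) \<le> card ((\<lambda>y. (y, k)) ` nbrs E x \<union> {(x, k), (x, Suc k), (x, k - 1)})"
    by (rule card_mono[OF f sub])
  also have "\<dots> \<le> card ((\<lambda>y. (y, k)) ` nbrs E x) + card {(x, k), (x, Suc k), (x, k - 1)}"
    by (rule card_Un_le)
  also have "\<dots> \<le> D + 3"
    using card_image_le[OF assms(1), of "\<lambda>y. (y, k)" x] assms(2)[of x]
    by (intro add_mono order_trans[OF card_insert_le_m1]) (auto simp: card_insert_if)
  finally show "card (spacetime_nbrs E p) \<le> D + 3" .
qed

text \<open>
  Points of space-time are pairs of a vertex and a time block; \<open>Z\<close> stands for the zeros of a
  process and \<open>D\<close> for its defects. A zero without defect was already a zero in the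
  preceding block and was facilitated by fewer than \<open>j\<close> ones. In particular all zeros at
  time \<open>0\<close> are defects.
\<close>

definition facilitated_zeros ::
  "'v set set \<Rightarrow> nat \<Rightarrow> ('v \<times> nat) set \<Rightarrow> ('v \<times> nat) set \<Rightarrow> bool" where
  "facilitated_zeros E j Z D \<longleftrightarrow> finite Z \<and>
     (\<forall>x k. (x, k) \<in> Z \<longrightarrow> (x, k) \<in> D \<or>
        (\<exists>m. k = Suc m \<and> (x, m) \<in> Z \<and> card {y \<in> nbrs E x. (y, m) \<notin> Z} < j))"

definition zero_step :: "'v set set \<Rightarrow> ('v \<times> nat) set \<Rightarrow> 'v \<times> nat \<Rightarrow> 'v \<times> nat \<Rightarrow> bool" where
  "zero_step E Z p q \<longleftrightarrow> p \<in> Z \<and> q \<in> Z \<and> q \<in> spacetime_nbrs E p"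

text \<open>
  The only property of the graph that enters the probabilistic estimates: a chain of zeros
  leading back to time \<open>0\<close> forces a walk on which the defects have density at least \<open>1 / R\<close>,
  and which meets at least \<open>K / R\<close> of them. The second bound makes the probability decay in
  time; the first makes the number of walks affordable in a union bound.
\<close>

definition dense_defect_walks :: "'v set set \<Rightarrow> nat \<Rightarrow> nat \<Rightarrow> bool" where
  "dense_defect_walks E j R \<longleftrightarrow> (\<forall>Z B x K y. facilitated_zeros E j Z B \<longrightarrow> (x, K) \<in> Z \<longrightarrow>
     (zero_step E Z)\<^sup>*\<^sup>* (x, K) (y, 0) \<longrightarrow>
     (\<exists>w. walk (spacetime_nbrs E) w \<and> hd w = (x, K) \<and> length w \<le> R * card (B \<inter> set w) \<and>
        K \<le> R * card (B \<inter> set w)))"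

lemma dense_defect_walks_mono:
  assumes "dense_defect_walks E j R" "R \<le> R'"
  shows "dense_defect_walks E j R'"
  unfolding dense_defect_walks_def
proof (intro allI impI)
  fix Z B x K y
  assume "facilitated_zeros E j Z B" "(x, K) \<in> Z" "(zero_step E Z)\<^sup>*\<^sup>* (x, K) (y, 0)"
  with assms(1) obtain w where w: "walk (spacetime_nbrs E) w" "hd w = (x, K)"
    "length w \<le> R * card (B \<inter> set w)" "K \<le> R * card (B \<inter> set w)"
    unfolding dense_defect_walks_def by blast
  have "R * card (B \<inter> set w) \<le> R' * card (B \<inter> set w)" using assms(2) by (rule mult_right_mono) simp
  with w show "\<exists>w. walk (spacetime_nbrs E) w \<and> hd w = (x, K) \<and> length w \<le> R' * card (B \<inter> set w) \<and>
      K \<le> R' * card (B \<inter> set w)"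
    by (meson order_trans)
qed

text \<open>An edge leaving \<open>K\<close> is counted at its endpoint in \<open>K\<close>.\<close>

lemma card_edge_boundary_le:
  assumes "simple_graph E" "finite K" "\<And>x. finite (nbrs E x)"
  shows "card (edge_boundary E K) \<le> (\<Sum>x\<in>K. card {y \<in> nbrs E x. y \<notin> K})"
proof -
  let ?P = "Sigma K (\<lambda>x. {y \<in> nbrs E x. y \<notin> K})"
  have fin: "finite ?P" using assms by auto
  have sub: "edge_boundary E K \<subseteq> (\<lambda>(x, y). {x, y}) ` ?P"
  proof
    fix e assume e: "e \<in> edge_boundary E K"
    then obtain x y where xy: "x \<noteq> y" "e = {x, y}" "{x, y} \<in> E"
      using assms(1) by (auto simp: simple_graph_def edge_boundary_def)
    have c: "card (e \<inter> K) = 1" using e by (simp add: edge_boundary_def)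
    have "(x \<in> K \<and> y \<notin> K) \<or> (y \<in> K \<and> x \<notin> K)"
    proof (rule ccontr)
      assume "\<not> ?thesis"
      then have "e \<inter> K = {} \<or> e \<inter> K = {x, y}" using xy by auto
      then show False using c xy by auto
    qed
    then show "e \<in> (\<lambda>(x, y). {x, y}) ` ?P"
    proof
      assume "x \<in> K \<and> y \<notin> K"
      then have "(x, y) \<in> ?P" using xy by (simp add: nbrs_def)
      then show ?thesis using xy by force
    next
      assume "y \<in> K \<and> x \<notin> K"
      then have "(y, x) \<in> ?P" using xy by (simp add: nbrs_def insert_commute)
      then show ?thesis using xy by force
    qed
  qed
  have "card (edge_boundary E K) \<le> card ?P"
    using card_mono[OF _ sub] card_image_le[OF fin, of "\<lambda>(x, y). {x, y}"] fin by fastforce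
  also have "\<dots> = (\<Sum>x\<in>K. card {y \<in> nbrs E x. y \<notin> K})"
    using assms by (subst card_SigmaI) auto
  finally show ?thesis .
qed

lemma isoperimetric_le:
  assumes "finite K" "simple_graph E" "\<And>x. finite (nbrs E x)"
  shows "edge_isoperimetric E * card K \<le> (\<Sum>x\<in>K. card {y \<in> nbrs E x. y \<notin> K})"
proof (cases "K = {}")
  case False
  have "edge_isoperimetric E \<le> real (card (edge_boundary E K)) / real (card K)"
    unfolding edge_isoperimetric_def
    by (rule cINF_lower) (use False assms in \<open>auto intro!: bdd_belowI2[of _ 0]\<close>)
  then have "edge_isoperimetric E * card K \<le> card (edge_boundary E K)"
    using False assms by (simp add: field_simps card_gt_0_iff)
  also have "\<dots> \<le> (\<Sum>x\<in>K. card {y \<in> nbrs E x. y \<notin> K})"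
    using card_edge_boundary_le[OF assms(2,1,3)] by (simp del: of_nat_sum)
  finally show ?thesis by simp
qed simp

lemma zero_step_sym: "zero_step E Z p q \<Longrightarrow> zero_step E Z q p"
  by (auto simp: zero_step_def spacetime_nbrs_sym)

section \<open>Density of defects under the isoperimetric condition\<close>

text \<open>
  Count the edges leaving \<open>A\<close> by their endpoint in \<open>A\<close>: at most \<open>j - 1\<close> at a point of \<open>S\<close> and
  at most \<open>D\<close> elsewhere, against at least \<open>Phi * card A\<close> in total.
\<close>

lemma survivors_le:
  fixes Phi :: real
  assumes "simple_graph E" "\<And>x. finite (nbrs E x)" "\<And>x. card (nbrs E x) \<le> D" "finite A"
    and S: "S \<subseteq> A" "\<And>x. x \<in> S \<Longrightarrow> card {y \<in> nbrs E x. y \<notin> A} < j"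
    and j: "1 \<le> j" "j \<le> D" and Phi: "Phi = edge_isoperimetric E"
  shows "real (card S) \<le> (1 - (Phi - j + 1) / (real D - j + 1)) * card A"
proof -
  have fS: "finite S" using assms finite_subset by blast
  have "Phi * card A \<le> (\<Sum>x\<in>A. card {y \<in> nbrs E x. y \<notin> A})"
    unfolding Phi by (rule isoperimetric_le) (use assms in auto)
  also have "(\<Sum>x\<in>A. card {y \<in> nbrs E x. y \<notin> A}) \<le>
      (\<Sum>x\<in>A. if x \<in> S then j - 1 else D)"
  proof (rule sum_mono)
    fix x assume "x \<in> A"
    have "card {y \<in> nbrs E x. y \<notin> A} \<le> card (nbrs E x)"
      by (rule card_mono) (use assms in auto)
    then have "card {y \<in> nbrs E x. y \<notin> A} \<le> D" using assms(3)[of x] by simp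
    then show "card {y \<in> nbrs E x. y \<notin> A} \<le> (if x \<in> S then j - 1 else D)"
      using S(2)[of x] by auto
  qed
  also have "(\<Sum>x\<in>A. if x \<in> S then j - 1 else D) = (j - 1) * card S + D * card (A - S)"
    using S assms(4) by (simp add: sum.If_cases Int_absorb1 Diff_eq mult.commute)
  finally have "Phi * card A \<le> (real j - 1) * card S + D * (real (card A) - card S)"
    using S assms(4) fS j card_mono[OF assms(4) S(1)]
    by (simp add: card_Diff_subset of_nat_diff)
  then have *: "(real D - j + 1) * card S \<le> (real D - Phi) * card A"
    by (simp add: algebra_simps)
  have pos: "real D - j + 1 > 0" using j by simp
  have "1 - (Phi - j + 1) / (real D - j + 1) = (real D - Phi) / (real D - j + 1)"
    using pos by (simp add: field_simps)
  then show ?thesis using * pos by (simp add: field_simps)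
qed

text \<open>
  The points of \<open>A\<close> at time \<open>m + 1\<close> that are not defects survive from the slice at time \<open>m\<close>, so
  they are fewer than that slice by a fixed factor. Summing over time compares \<open>A - B\<close> with \<open>A\<close>.
\<close>

lemma defects_of_cluster_isoperimetric:
  fixes Phi :: real
  assumes E: "simple_graph E" "\<And>x. finite (nbrs E x)" "\<And>x. card (nbrs E x) \<le> D"
    and j: "1 \<le> j" "j \<le> D" and Phi: "Phi = edge_isoperimetric E"
    and A: "finite A"
    and rule: "\<And>x k. (x, k) \<in> A \<Longrightarrow> (x, k) \<in> B \<or>
        (\<exists>m. k = Suc m \<and> (x, m) \<in> A \<and> card {y \<in> nbrs E x. (y, m) \<notin> A} < j)"
  shows "(Phi - j + 1) / (real D - j + 1) * card A \<le> card (A \<inter> B)"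
proof -
  let ?k = "(Phi - j + 1) / (real D - j + 1)"
  define sl where "sl m = {x. (x, m) \<in> A}" for m
  define sv where "sv m = {x. (x, Suc m) \<in> A - B}" for m
  obtain T where T: "\<And>x k. (x, k) \<in> A \<Longrightarrow> k < T"
  proof
    fix x k assume "(x, k) \<in> A"
    then show "k < Suc (Max (snd ` A))" using A by (force intro: le_imp_less_Suc Max_ge)
  qed
  have fsl: "finite (sl m)" for m
    unfolding sl_def by (rule finite_subset[of _ "fst ` A"]) (use A in \<open>force+\<close>)
  have fsv: "finite (sv m)" for m
    unfolding sv_def by (rule finite_subset[of _ "fst ` A"]) (use A in \<open>force+\<close>)
  have "real (card (sv m)) \<le> (1 - ?k) * card (sl m)" for m
  proof (rule survivors_le[OF E fsl _ _ j Phi])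
    show "sv m \<subseteq> sl m" using rule by (fastforce simp: sv_def sl_def)
    show "card {y \<in> nbrs E x. y \<notin> sl m} < j" if "x \<in> sv m" for x
      using rule[of x "Suc m"] that by (auto simp: sv_def sl_def)
  qed
  then have "(\<Sum>m<T. real (card (sv m))) \<le> (\<Sum>m<T. (1 - ?k) * card (sl m))"
    by (intro sum_mono)
  moreover have "A = (\<lambda>(m, x). (x, m)) ` Sigma {..<T} sl"
    using T by (force simp: sl_def)
  then have "card A = (\<Sum>m<T. card (sl m))"
    using fsl by (simp add: card_image inj_on_def card_SigmaI)
  moreover have "A - B = (\<lambda>(m, x). (x, Suc m)) ` Sigma {..<T} sv"
  proof (intro equalityI subsetI)
    fix p assume p: "p \<in> A - B"
    obtain x k where xk: "p = (x, k)" by force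
    then obtain m where "k = Suc m" using rule[of x k] p by auto
    then show "p \<in> (\<lambda>(m, x). (x, Suc m)) ` Sigma {..<T} sv"
      using p xk T[of x k] by (force simp: sv_def)
  qed (auto simp: sv_def)
  then have "card (A - B) = (\<Sum>m<T. card (sv m))"
    using fsv by (simp add: card_image inj_on_def card_SigmaI)
  ultimately have "real (card (A - B)) \<le> (1 - ?k) * card A"
    by (simp add: sum_distrib_left)
  moreover have "card A = card (A \<inter> B) + card (A - B)"
    using A by (metis card_Int_Diff)
  ultimately show ?thesis by (simp add: algebra_simps)
qed

text \<open>
  The density bound is applied to the connected component \<open>A\<close> of \<open>(x, K)\<close> among the zeros. This
  set inherits the rule for zeros, since a zero next to a point of \<open>A\<close> lies in \<open>A\<close>. It meets every
  time from \<open>0\<close> to \<open>K\<close>, which bounds \<open>K\<close> by its size.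
\<close>

lemma cluster_walk_isoperimetric:
  assumes E: "simple_graph E" "\<And>x. finite (nbrs E x)" "\<And>x. card (nbrs E x) \<le> D"
    and j: "1 \<le> j" "j \<le> D" "real j < edge_isoperimetric E + 1"
  shows "\<exists>R. dense_defect_walks E j R"
proof -
  define kap where "kap = (edge_isoperimetric E - j + 1) / (real D - j + 1)"
  have kap: "kap > 0" unfolding kap_def using j by (intro divide_pos_pos) auto
  define R where "R = nat \<lceil>2 / kap\<rceil>"
  have R: "2 / kap \<le> real R" unfolding R_def by linarith
  show ?thesis
    unfolding dense_defect_walks_def
  proof (intro exI[of _ R] allI impI)
    fix Z B x K y
    assume fz: "facilitated_zeros E j Z B" and p: "(x, K) \<in> Z" and c: "(zero_step E Z)\<^sup>*\<^sup>* (x, K) (y, 0)"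
    define A where "A = {q. (zero_step E Z)\<^sup>*\<^sup>* (x, K) q}"
    have AZ: "A \<subseteq> Z"
    proof
      fix q assume "q \<in> A"
      then have "(zero_step E Z)\<^sup>*\<^sup>* (x, K) q" by (simp add: A_def)
      then show "q \<in> Z" by (induction rule: rtranclp_induct) (use p in \<open>auto simp: zero_step_def\<close>)
    qed
    have fA: "finite A" using AZ fz finite_subset by (auto simp: facilitated_zeros_def)
    have ext: "q \<in> A" if "r \<in> A" "q \<in> Z" "q \<in> spacetime_nbrs E r" for q r
      using that AZ unfolding A_def
      by (auto intro!: rtranclp.rtrancl_into_rtrancl[of _ _ r q] simp: zero_step_def)
    have "kap * card A \<le> card (A \<inter> B)"
      unfolding kap_def
    proof (rule defects_of_cluster_isoperimetric[OF E j(1,2) refl fA])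
      fix x k assume xk: "(x, k) \<in> A"
      show "(x, k) \<in> B \<or> (\<exists>m. k = Suc m \<and> (x, m) \<in> A \<and> card {y \<in> nbrs E x. (y, m) \<notin> A} < j)"
      proof (cases "(x, k) \<in> B")
        case False
        with xk AZ fz obtain m where m: "k = Suc m" "(x, m) \<in> Z" "card {y \<in> nbrs E x. (y, m) \<notin> Z} < j"
          unfolding facilitated_zeros_def by blast
        have xm: "(x, m) \<in> A" by (rule ext[OF xk m(2)]) (simp add: m spacetime_nbrs_def)
        have "card {y \<in> nbrs E x. (y, m) \<notin> A} \<le> card {y \<in> nbrs E x. (y, m) \<notin> Z}"
          by (rule card_mono) (use E ext[OF xm] in \<open>auto simp: spacetime_nbrs_def\<close>)
        then show ?thesis using m xm by auto
      qed simp
    qed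
    then have "2 * real (card A) \<le> 2 / kap * card (A \<inter> B)"
      using kap by (simp add: field_simps)
    also have "\<dots> \<le> real R * card (A \<inter> B)" by (intro mult_right_mono R) simp
    finally have cA: "2 * card A \<le> R * card (A \<inter> B)"
      by (metis of_nat_le_iff of_nat_mult of_nat_numeral)
    have "(\<lambda>x y. y \<in> spacetime_nbrs E x \<and> y \<in> A)\<^sup>*\<^sup>* (x, K) q" if "q \<in> A" for q
    proof -
      have "(zero_step E Z)\<^sup>*\<^sup>* (x, K) q" using that by (simp add: A_def)
      then show ?thesis
      proof (induction rule: rtranclp_induct)
        case (step r q)
        then have "q \<in> A" unfolding A_def by auto
        then show ?case using step
          by (auto intro!: rtranclp.rtrancl_into_rtrancl[of _ _ r q] simp: zero_step_def)
      qed simp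
    qed
    note conn = this
    have xKA: "(x, K) \<in> A" by (simp add: A_def)
    have "\<exists>w. walk (spacetime_nbrs E) w \<and> hd w = (x, K) \<and> set w = A \<and> length w \<le> 2 * card A"
      by (rule spanning_walk[OF fA xKA spacetime_nbrs_sym conn])
    then obtain w where w: "walk (spacetime_nbrs E) w" "hd w = (x, K)" "set w = A"
      "length w \<le> 2 * card A" by blast
    have "l \<le> K \<longrightarrow> {l..K} \<subseteq> snd ` A" if "(zero_step E Z)\<^sup>*\<^sup>* (x, K) (z, l)" for z l
      using that
    proof (induction "(z, l)" arbitrary: z l rule: rtranclp_induct)
      case base
      have "K \<in> snd ` A" using xKA by force
      then show ?case by simp
    next
      case (step r)
      obtain u i where r: "r = (u, i)" by force
      have "(z, l) \<in> A" unfolding A_def using step by auto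
      then have l: "l \<in> snd ` A" by force
      have "i = l \<or> i = Suc l \<or> l = Suc i"
        using step(2) by (auto simp: r zero_step_def spacetime_nbrs_def)
      moreover have "i \<le> K \<longrightarrow> {i..K} \<subseteq> snd ` A" using step(3)[OF r] .
      ultimately have "v \<in> snd ` A" if "l \<le> v" "v \<le> K" for v
        using l that by (cases "v = l") (auto simp: subset_iff)
      then show ?case by auto
    qed
    from this[OF c] have "card {0..K} \<le> card (snd ` A)"
      by (intro card_mono) (use fA in auto)
    also have "\<dots> \<le> card A" by (rule card_image_le[OF fA])
    finally have "K \<le> card A" by simp
    then show "\<exists>w. walk (spacetime_nbrs E) w \<and> hd w = (x, K) \<and> length w \<le> R * card (B \<inter> set w) \<and>
         K \<le> R * card (B \<inter> set w)"
      using w cA by (intro exI[of _ w]) (auto simp: Int_commute)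
  qed
qed

section \<open>Chains of defects in a layered graph\<close>

definition within_steps :: "'v set set \<Rightarrow> nat \<Rightarrow> 'v \<Rightarrow> 'v \<Rightarrow> bool" where
  "within_steps E n x y \<longleftrightarrow> (\<exists>i\<le>n. (x, y) \<in> adj_rel E ^^ i)"

lemma within_steps_refl: "within_steps E n x x"
  unfolding within_steps_def by (intro exI[of _ 0]) auto

lemma within_steps_Suc:
  assumes "within_steps E n x y" "z \<in> nbrs E y"
  shows "within_steps E (Suc n) x z"
proof -
  from assms(1) obtain i where i: "i \<le> n" "(x, y) \<in> adj_rel E ^^ i"
    by (auto simp: within_steps_def)
  have "(y, z) \<in> adj_rel E" using assms(2) by (simp add: adj_rel_def nbrs_def)
  with i have "(x, z) \<in> adj_rel E ^^ Suc i" by auto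
  with i show ?thesis unfolding within_steps_def by (intro exI[of _ "Suc i"]) auto
qed

lemma within_steps_mono: "within_steps E n x y \<Longrightarrow> n \<le> m \<Longrightarrow> within_steps E m x y"
  unfolding within_steps_def by (meson order_trans)

text \<open>Lengths are counted in steps, so that they add up when walks are concatenated.\<close>

definition walk_through ::
  "'v set set \<Rightarrow> ('v \<times> nat) set \<Rightarrow> 'v \<times> nat \<Rightarrow> 'v \<times> nat \<Rightarrow> nat \<Rightarrow> bool" where
  "walk_through E S p q n \<longleftrightarrow>
     (\<exists>w. walk (spacetime_nbrs E) w \<and> hd w = p \<and> last w = q \<and> S \<subseteq> set w \<and> length w \<le> Suc n)"

lemma walk_through_trans:
  assumes "walk_through E S p q n" "walk_through E T q r m"
  shows "walk_through E (S \<union> T) p r (n + m)"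
proof -
  from assms obtain u v where
    u: "walk (spacetime_nbrs E) u" "hd u = p" "last u = q" "S \<subseteq> set u" "length u \<le> Suc n" and
    v: "walk (spacetime_nbrs E) v" "hd v = q" "last v = r" "T \<subseteq> set v" "length v \<le> Suc m"
    unfolding walk_through_def by blast
  have ne: "u \<noteq> []" "v \<noteq> []" using u v by (auto simp: walk_def)
  have "set v \<subseteq> insert q (set (tl v))" using ne v(2) by (cases v) auto
  moreover have "q \<in> set u" using u(3) ne by auto
  ultimately have "S \<union> T \<subseteq> set (u @ tl v)" using u v by auto
  moreover have "walk (spacetime_nbrs E) (u @ tl v)"
    by (rule walk_join) (use u v in auto)
  moreover have "last (u @ tl v) = r"
    using u v ne by (cases v) (auto simp: last_append)
  ultimately show ?thesis unfolding walk_through_def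
    using u v ne by (intro exI[of _ "u @ tl v"]) (auto simp: hd_append)
qed

lemma walk_through_step: "q \<in> spacetime_nbrs E p \<Longrightarrow> walk_through E {p, q} p q 1"
  unfolding walk_through_def by (intro exI[of _ "[p, q]"]) (auto simp: walk_def)

lemma walk_through_refl: "walk_through E {p} p p 0"
  unfolding walk_through_def by (intro exI[of _ "[p]"]) (auto simp: walk_def)

lemma walk_through_mono:
  "walk_through E S p q n \<Longrightarrow> T \<subseteq> S \<Longrightarrow> n \<le> m \<Longrightarrow> walk_through E T p q m"
  unfolding walk_through_def by (metis (no_types, lifting) Suc_le_mono order_trans)

lemma walk_through_rev: "walk_through E S p q n \<Longrightarrow> walk_through E S q p n"
  unfolding walk_through_def
proof (elim exE conjE, intro exI conjI)
  fix w assume w: "walk (spacetime_nbrs E) w" "hd w = p" "last w = q" "S \<subseteq> set w" "length w \<le> Suc n"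
  show "walk (spacetime_nbrs E) (rev w)" by (rule walk_rev[OF w(1) spacetime_nbrs_sym])
  show "hd (rev w) = q" "last (rev w) = p"
    using w by (auto simp: hd_rev last_rev)
qed auto

lemma walk_through_space:
  assumes "(x, y) \<in> adj_rel E ^^ i"
  shows "walk_through E {(x, s), (y, s)} (x, s) (y, s) i"
  using assms
proof (induction i arbitrary: y)
  case 0
  then show ?case using walk_through_refl by fastforce
next
  case (Suc i)
  then obtain z where z: "(x, z) \<in> adj_rel E ^^ i" "(z, y) \<in> adj_rel E" by auto
  have "(y, s) \<in> spacetime_nbrs E (z, s)"
    using z(2) by (simp add: spacetime_nbrs_def nbrs_def adj_rel_def)
  from walk_through_trans[OF Suc.IH[OF z(1)] walk_through_step[OF this]]
  show ?case by (rule walk_through_mono) auto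
qed

lemma walk_through_time_up: "walk_through E {(x, s), (x, s + d)} (x, s) (x, s + d) d"
proof (induction d)
  case 0
  then show ?case using walk_through_refl by fastforce
next
  case (Suc d)
  have "(x, s + Suc d) \<in> spacetime_nbrs E (x, s + d)" by (simp add: spacetime_nbrs_def)
  from walk_through_trans[OF Suc walk_through_step[OF this]]
  show ?case by (rule walk_through_mono) auto
qed

lemma walk_through_time:
  assumes "\<bar>int s - int t\<bar> \<le> int d"
  shows "walk_through E {(x, s), (x, t)} (x, s) (x, t) d"
proof (cases "s \<le> t")
  case True
  then have "walk_through E {(x, s), (x, t)} (x, s) (x, t) (t - s)"
    using walk_through_time_up[of E x s "t - s"] by simp
  then show ?thesis
    by (rule walk_through_mono) (use True assms in auto)
next
  case False
  have "walk_through E {(x, t), (x, s)} (x, t) (x, s) (s - t)"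
    using walk_through_time_up[of E x t "s - t"] False by simp
  from walk_through_rev[OF this] show ?thesis
    by (rule walk_through_mono) (use False assms in auto)
qed

lemma walk_through_space_time:
  assumes "within_steps E n x y" "\<bar>int s - int t\<bar> \<le> int d"
  shows "walk_through E {(x, s), (y, t)} (x, s) (y, t) (n + d)"
proof -
  from assms(1) obtain i where i: "i \<le> n" "(x, y) \<in> adj_rel E ^^ i"
    by (auto simp: within_steps_def)
  from walk_through_trans[OF walk_through_space[OF i(2)] walk_through_time[OF assms(2)]]
  show ?thesis by (rule walk_through_mono) (use i in auto)
qed

text \<open>The level is the distance to the root provided by \<open>j_bar\<close>.\<close>

locale layered_zeros =
  fixes E :: "'v set set" and j :: nat and lev :: "'v \<Rightarrow> nat" and Z B :: "('v \<times> nat) set"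
  assumes nbrs_finite: "\<And>x. finite (nbrs E x)"
    and lev_Suc: "\<And>x y. y \<in> nbrs E x \<Longrightarrow> lev y \<le> Suc (lev x)"
    and children: "\<And>x. j \<le> card {y \<in> nbrs E x. lev y = Suc (lev x)}"
    and zeros: "facilitated_zeros E j Z B"
begin

text \<open>
  At least \<open>j\<close> neighbours lie one level higher and fewer than \<open>j\<close> neighbours are ones, so one of
  the former is a zero.
\<close>

lemma zero_child:
  assumes "(x, k) \<in> Z" "(x, k) \<notin> B"
  obtains m y where "k = Suc m" "(x, m) \<in> Z" "y \<in> nbrs E x" "lev y = Suc (lev x)" "(y, m) \<in> Z"
proof -
  from assms zeros obtain m where m: "k = Suc m" "(x, m) \<in> Z" "card {y \<in> nbrs E x. (y, m) \<notin> Z} < j"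
    unfolding facilitated_zeros_def by blast
  have "\<not> {y \<in> nbrs E x. lev y = Suc (lev x)} \<subseteq> {y \<in> nbrs E x. (y, m) \<notin> Z}"
  proof
    assume "{y \<in> nbrs E x. lev y = Suc (lev x)} \<subseteq> {y \<in> nbrs E x. (y, m) \<notin> Z}"
    from card_mono[OF _ this] nbrs_finite children[of x] m(3) show False by simp
  qed
  then show ?thesis using that m by blast
qed

text \<open>
  Going back in time from a zero, the site remains a zero until a defect is met.
\<close>

definition run_bottom :: "'v \<times> nat \<Rightarrow> nat \<Rightarrow> bool" where
  "run_bottom p s \<longleftrightarrow> s \<le> snd p \<and> (fst p, s) \<in> Z \<inter> B \<and>
     (\<forall>u. s < u \<longrightarrow> u \<le> snd p \<longrightarrow> (fst p, u) \<in> Z - B)"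

lemma run_bottom_exists: "(x, k) \<in> Z \<Longrightarrow> \<exists>s. run_bottom (x, k) s"
proof (induction k)
  case 0
  then have "(x, 0) \<in> B" using zero_child[of x 0] by blast
  then show ?case using 0 by (intro exI[of _ 0]) (auto simp: run_bottom_def)
next
  case (Suc k)
  show ?case
  proof (cases "(x, Suc k) \<in> B")
    case True
    then show ?thesis using Suc by (intro exI[of _ "Suc k"]) (auto simp: run_bottom_def)
  next
    case False
    then have "(x, k) \<in> Z" using zero_child[OF Suc.prems False] by auto
    then obtain s where "run_bottom (x, k) s" using Suc.IH by blast
    then show ?thesis using Suc.prems False
      by (intro exI[of _ s]) (auto simp: run_bottom_def le_Suc_eq)
  qed
qed

text \<open>
  The links of the chain of defects. With \<open>k = lev p + 1 - lev q \<ge> 0\<close>, the link from \<open>p\<close> to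
  \<open>q\<close> spans a distance of at most \<open>k + 1\<close> and goes forward in time by at most \<open>k\<close>. The level can
  rise by only one, while descents in level pay for distance and for time: this is what makes the
  total length of a chain telescope.
\<close>

definition jump :: "'v \<times> nat \<Rightarrow> 'v \<times> nat \<Rightarrow> bool" where
  "jump p q \<longleftrightarrow> p \<in> Z \<inter> B \<and> q \<in> Z \<inter> B \<and> lev (fst q) \<le> Suc (lev (fst p)) \<and>
     within_steps E (Suc (Suc (lev (fst p)) - lev (fst q))) (fst p) (fst q) \<and>
     snd q \<le> snd p + (Suc (lev (fst p)) - lev (fst q))"

text \<open>
  With \<open>k = lev p - lev q \<ge> 0\<close>, the point \<open>q\<close> is within distance \<open>k\<close> of \<open>p\<close> and at most \<open>k\<close> later.
  This is a cone below \<open>p\<close>: it is stable under moving one level down and one block later at the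
  same time, and it is smaller than the range of a jump, so that a jump leads from \<open>p\<close> to the
  defects below the neighbours of \<open>q\<close>.
\<close>

definition covers :: "'v \<times> nat \<Rightarrow> 'v \<times> nat \<Rightarrow> bool" where
  "covers p q \<longleftrightarrow> lev (fst q) \<le> lev (fst p) \<and>
     within_steps E (lev (fst p) - lev (fst q)) (fst p) (fst q) \<and>
     snd q \<le> snd p + (lev (fst p) - lev (fst q))"

lemma covers_jump:
  assumes "covers p (y, u)" "p \<in> Z \<inter> B" "(y', s) \<in> Z \<inter> B"
    and "s \<le> u \<and> y' \<in> nbrs E y \<or> s \<le> Suc u \<and> y' = y"
  shows "jump p (y', s)"
  using assms(4)
proof
  assume *: "s \<le> u \<and> y' \<in> nbrs E y"
  then have l: "lev y' \<le> Suc (lev y)" using lev_Suc by blast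
  have "within_steps E (Suc (lev (fst p) - lev y)) (fst p) y'"
    by (rule within_steps_Suc) (use * assms(1) in \<open>auto simp: covers_def\<close>)
  then have "within_steps E (Suc (Suc (lev (fst p)) - lev y')) (fst p) y'"
    by (rule within_steps_mono) (use l in auto)
  then show ?thesis using assms l * unfolding jump_def covers_def by auto
next
  assume *: "s \<le> Suc u \<and> y' = y"
  have "within_steps E (Suc (Suc (lev (fst p)) - lev y')) (fst p) y'"
    by (rule within_steps_mono[of _ "lev (fst p) - lev y"]) (use * assms in \<open>auto simp: covers_def\<close>)
  then show ?thesis using assms * unfolding jump_def covers_def by auto
qed

text \<open>
  Climb the run from its bottom. If \<open>(y, u)\<close> is covered by a reachable \<open>p\<close>, the zero
  \<open>(y, u + 1)\<close> has a zero child \<open>(w, u)\<close> one level up; the bottom of the run below \<open>(w, u)\<close> is one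
  jump from \<open>p\<close>. By induction on the level, which is bounded on the finite set \<open>Z\<close>, a reachable
  defect covers \<open>(w, u)\<close>, and then it covers \<open>(y, u + 1)\<close> too.
\<close>

lemma run_covered:
  assumes "p0 \<in> Z \<inter> B" "run_bottom (y, k) s" "jump\<^sup>*\<^sup>* p0 (y, s)" "s \<le> u" "u \<le> k"
  shows "\<exists>p. jump\<^sup>*\<^sup>* p0 p \<and> covers p (y, u)"
proof -
  have inB: "p \<in> Z \<inter> B" if "jump\<^sup>*\<^sup>* p0 p" for p
    using that by (induction rule: rtranclp_induct) (use assms(1) in \<open>auto simp: jump_def\<close>)
  obtain T where T: "\<And>x k. (x, k) \<in> Z \<Longrightarrow> lev x < T"
  proof
    fix x k assume "(x, k) \<in> Z"
    then show "lev x < Suc (Max ((lev \<circ> fst) ` Z))" using zeros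
      by (force intro: le_imp_less_Suc Max_ge simp: facilitated_zeros_def)
  qed
  show ?thesis using assms(2-)
  proof (induction "T - lev y" arbitrary: y k s u rule: less_induct)
    case less
    have yZ: "(y, s) \<in> Z" using less.prems(1) by (simp add: run_bottom_def)
    from less.prems(3,4) show ?case
    proof (induction u rule: dec_induct)
      case base
      show ?case using less.prems(2)
        by (intro exI[of _ "(y, s)"]) (auto simp: covers_def within_steps_refl)
    next
      case (step u)
      then obtain p where p: "jump\<^sup>*\<^sup>* p0 p" "covers p (y, u)" by auto
      have "(y, Suc u) \<in> Z - B" using step less.prems(1) by (auto simp: run_bottom_def)
      then obtain w where w: "w \<in> nbrs E y" "lev w = Suc (lev y)" "(w, u) \<in> Z"
        using zero_child[of y "Suc u"] by (metis DiffD1 DiffD2 nat.inject)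
      from run_bottom_exists[OF w(3)] obtain s' where s': "run_bottom (w, u) s'" ..
      then have *: "s' \<le> u" "(w, s') \<in> Z \<inter> B" by (auto simp: run_bottom_def)
      have "jump p (w, s')"
        by (rule covers_jump[OF p(2) inB[OF p(1)] *(2)]) (use * w in auto)
      with p have r: "jump\<^sup>*\<^sup>* p0 (w, s')" by simp
      have "T - lev w < T - lev y" using w T[OF yZ] by simp
      from less.hyps[OF this s' r *(1) order_refl] obtain q where
        q: "jump\<^sup>*\<^sup>* p0 q" "covers q (w, u)" by blast
      have "within_steps E (Suc (lev (fst q) - lev w)) (fst q) y"
        by (rule within_steps_Suc) (use q w in \<open>auto simp: covers_def nbrs_sym\<close>)
      then have "covers q (y, Suc u)"
        using q(2) w(2) Suc_diff_Suc[of "lev y" "lev (fst q)"]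
        by (auto simp: covers_def)
      with q show ?case by blast
    qed
  qed
qed

text \<open>
  Each step of the path moves from a covered zero to a neighbouring zero, and the bottom of the run
  below the latter is one jump away from the covering defect.
\<close>

lemma zero_path_covered:
  assumes "run_bottom (x, k) s" "(x, k) \<in> Z" "(zero_step E Z)\<^sup>*\<^sup>* (x, k) q"
  shows "\<exists>p. jump\<^sup>*\<^sup>* (x, s) p \<and> covers p q"
proof -
  have p0: "(x, s) \<in> Z \<inter> B" using assms(1) by (simp add: run_bottom_def)
  have inB: "p \<in> Z \<inter> B" if "jump\<^sup>*\<^sup>* (x, s) p" for p
    using that by (induction rule: rtranclp_induct) (use p0 in \<open>auto simp: jump_def\<close>)
  show ?thesis using assms(3)
  proof (induction rule: rtranclp_induct)
    case base
    show ?case by (rule run_covered[OF p0 assms(1)]) (use assms(1) in \<open>auto simp: run_bottom_def\<close>)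
  next
    case (step q r)
    obtain y u y' u' where qr: "q = (y, u)" "r = (y', u')" by force
    from step obtain p where p: "jump\<^sup>*\<^sup>* (x, s) p" "covers p (y, u)" by (auto simp: qr)
    have rZ: "(y', u') \<in> Z" using step(2) by (simp add: zero_step_def qr)
    from run_bottom_exists[OF this] obtain s' where s': "run_bottom (y', u') s'" ..
    then have *: "s' \<le> u'" "(y', s') \<in> Z \<inter> B" by (auto simp: run_bottom_def)
    have "jump p (y', s')"
      by (rule covers_jump[OF p(2) inB[OF p(1)] *(2)])
        (use * step(2) in \<open>auto simp: zero_step_def spacetime_nbrs_def qr\<close>)
    with p have "jump\<^sup>*\<^sup>* (x, s) (y', s')" by simp
    from run_covered[OF p0 s' this *(1) order_refl] show ?case by (simp add: qr)
  qed
qed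

text \<open>
  With \<open>k\<close> as in the definition of a jump, the time difference is at most \<open>2 * k\<close> plus the loss of time, which gives the
  length \<open>(k + 1) + 2 * k\<close> plus the loss of time. All terms other than the constant telescope.
\<close>

lemma jump_walk:
  assumes "jump p q"
  shows "\<exists>n. walk_through E {p, q} p q n \<and>
    int n \<le> 3 * (int (lev (fst p)) - int (lev (fst q))) + 4 + (int (snd p) - int (snd q))"
proof -
  define k where "k = Suc (lev (fst p)) - lev (fst q)"
  have k: "int k = 1 + int (lev (fst p)) - int (lev (fst q))"
    using assms by (auto simp: k_def jump_def)
  define d where "d = nat \<bar>int (snd p) - int (snd q)\<bar>"
  have "within_steps E (Suc k) (fst p) (fst q)" using assms by (simp add: jump_def k_def)
  from walk_through_space_time[OF this, of "snd p" "snd q" d]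
  have "walk_through E {p, q} p q (Suc k + d)" by (simp add: d_def)
  moreover have "snd q \<le> snd p + k" using assms unfolding jump_def k_def by blast
  then have "int (Suc k + d) \<le> 3 * int k + 1 + (int (snd p) - int (snd q))"
    by (simp add: d_def)
  ultimately show ?thesis using k by (intro exI[of _ "Suc k + d"]) auto
qed

lemma jump_chain:
  assumes "rtrancl_path jump p xs q" "p \<in> Z \<inter> B"
  shows "\<exists>n. walk_through E (insert p (set xs)) p q n \<and>
      int n \<le> 3 * (int (lev (fst p)) - int (lev (fst q))) + 4 * int (length xs)
               + (int (snd p) - int (snd q))"
    and "lev (fst q) \<le> lev (fst p) + length xs"
    and "int (snd q) \<le> int (snd p) + int (length xs) + int (lev (fst p)) - int (lev (fst q))"
    and "insert p (set xs) \<subseteq> Z \<inter> B"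
  using assms
proof (induction rule: rtrancl_path.induct)
  case (base x)
  { case 1 show ?case using walk_through_refl[of E x] by (intro exI[of _ 0]) auto }
  { case 2 show ?case by simp }
  { case 3 show ?case by simp }
  { case 4 then show ?case by simp }
next
  case (step x y ys z)
  have y: "y \<in> Z \<inter> B" using step.hyps by (simp add: jump_def)
  { case 1
    from jump_walk[OF step.hyps(1)] obtain n where n: "walk_through E {x, y} x y n"
      "int n \<le> 3 * (int (lev (fst x)) - int (lev (fst y))) + 4 + (int (snd x) - int (snd y))" by blast
    from step.IH(1)[OF y] obtain m where m: "walk_through E (insert y (set ys)) y z m"
      "int m \<le> 3 * (int (lev (fst y)) - int (lev (fst z))) + 4 * int (length ys)
               + (int (snd y) - int (snd z))" by blast
    have "walk_through E (insert x (set (y # ys))) x z (n + m)"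
      using walk_through_trans[OF n(1) m(1)] by (rule walk_through_mono) auto
    then show ?case using n m by (intro exI[of _ "n + m"]) auto }
  { case 2 show ?case using step.IH(2)[OF y] step.hyps(1) by (auto simp: jump_def) }
  { case 3 show ?case using step.IH(3)[OF y] step.hyps(1) by (auto simp: jump_def) }
  { case 4 then show ?case using step.IH(4)[OF y] by auto }
qed

text \<open>Shortening a chain to one without repetitions makes the number of its links count distinct defects.\<close>

lemma jump_walk_distinct:
  assumes "jump\<^sup>*\<^sup>* p q" "p \<in> Z \<inter> B"
  obtains n m S where "walk_through E S p q n" "S \<subseteq> Z \<inter> B" "finite S" "card S = Suc m"
    "int n \<le> 3 * (int (lev (fst p)) - int (lev (fst q))) + 4 * int m + (int (snd p) - int (snd q))"
    "lev (fst q) \<le> lev (fst p) + m"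
    "int (snd q) \<le> int (snd p) + int m + int (lev (fst p)) - int (lev (fst q))"
proof -
  from assms(1) obtain xs where "rtrancl_path jump p xs q"
    by (auto simp: rtranclp_eq_rtrancl_path)
  then obtain ys where ys: "rtrancl_path jump p ys q" "distinct (p # ys)"
    using rtrancl_path_distinct by metis
  have "card (insert p (set ys)) = Suc (length ys)"
    using ys(2) by (simp add: distinct_card)
  with jump_chain[OF ys(1) assms(2)] that[of "insert p (set ys)" _ "length ys"]
  show ?thesis by auto
qed

text \<open>
  A chain of \<open>m\<close> links has to be long compared with \<open>K\<close>. If the path of zeros rises by at least
  \<open>K / 2\<close> levels, take a chain from below \<open>(x, K)\<close> to a defect covering the end of the path: a link
  rises by at most one level, so \<open>m \<ge> K / 2\<close>. Otherwise take a chain in the other direction,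
  from \<open>(y, 0)\<close> to a defect covering \<open>(x, K)\<close>: a link goes forward in time by at most one
  block more than the number of levels it descends. The descent from \<open>y\<close> to \<open>x\<close> provides less than
  \<open>K / 2\<close> of the time, so again \<open>m \<ge> K / 2\<close>.
\<close>

lemma layered_walk:
  assumes p: "(x, K) \<in> Z" and path: "(zero_step E Z)\<^sup>*\<^sup>* (x, K) (y, 0)"
  shows "\<exists>w. walk (spacetime_nbrs E) w \<and> hd w = (x, K) \<and> length w \<le> 8 * card (B \<inter> set w) \<and>
         K \<le> 8 * card (B \<inter> set w)"
proof -
  have concl: ?thesis if "walk_through E S (x, K) q n" "S \<subseteq> Z \<inter> B" "finite S" "card S = Suc m"
    "n \<le> 8 * m" "K \<le> 8 * m" for S q n m
  proof -
    from that(1) obtain w where w: "walk (spacetime_nbrs E) w" "hd w = (x, K)" "S \<subseteq> set w"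
      "length w \<le> Suc n" by (auto simp: walk_through_def)
    have "Suc m \<le> card (B \<inter> set w)"
      unfolding that(4)[symmetric] by (rule card_mono) (use that w in auto)
    then show ?thesis using w that by (intro exI[of _ w]) auto
  qed
  have y0: "(y, 0) \<in> Z"
    using path p by (cases rule: rtranclp.cases) (auto simp: zero_step_def)
  show ?thesis
  proof (cases "int K \<le> 2 * (int (lev y) - int (lev x))")
    case True
    from run_bottom_exists[OF p] obtain s where s: "run_bottom (x, K) s" ..
    then have s': "s \<le> K" "(x, s) \<in> Z \<inter> B" by (auto simp: run_bottom_def)
    from zero_path_covered[OF s p path] obtain q where
      q: "jump\<^sup>*\<^sup>* (x, s) q" "covers q (y, 0)" by blast
    from jump_walk_distinct[OF q(1) s'(2)] obtain n m S where
      S: "walk_through E S (x, s) q n" "S \<subseteq> Z \<inter> B" "finite S" "card S = Suc m"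
      "int n \<le> 3 * (int (lev x) - int (lev (fst q))) + 4 * int m + (int s - int (snd q))"
      "lev (fst q) \<le> lev x + m" by (metis fst_conv snd_conv)
    have l: "lev y \<le> lev (fst q)" using q(2) by (simp add: covers_def)
    have "walk_through E {(x, K), (x, s)} (x, K) (x, s) (K - s)"
      by (rule walk_through_time) (use s' in auto)
    from walk_through_trans[OF this S(1)]
    have "walk_through E S (x, K) q (K - s + n)" by (rule walk_through_mono) auto
    moreover have "K - s + n \<le> 8 * m \<and> K \<le> 8 * m"
    proof -
      have "int (lev y) \<le> int (lev x) + int m" using l S(6) by linarith
      then have "2 * (int (lev y) - int (lev x)) \<le> 2 * int m" by simp
      with True have "int K \<le> 2 * int m" by (rule order_trans)
      moreover have "0 \<le> int (lev y) - int (lev x)" using True by simp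
      then have "3 * (int (lev x) - int (lev (fst q))) \<le> 0" using l by simp
      then have "int n \<le> 4 * int m + int s" using S(5) by linarith
      ultimately show ?thesis using s'(1) by linarith
    qed
    ultimately show ?thesis using concl[OF _ S(2-4)] by blast
  next
    case False
    have yB: "(y, 0) \<in> Z \<inter> B" using zero_child[OF y0] y0 by blast
    have rb: "run_bottom (y, 0) 0" using yB by (auto simp: run_bottom_def)
    have "(zero_step E Z)\<inverse>\<inverse> = zero_step E Z"
      by (intro ext) (auto simp: conversep_iff intro: zero_step_sym)
    then have "(zero_step E Z)\<^sup>*\<^sup>* (y, 0) (x, K)"
      using rtranclp_converseI[OF path] by simp
    from zero_path_covered[OF rb y0 this] obtain q where
      q: "jump\<^sup>*\<^sup>* (y, 0) q" "covers q (x, K)" by blast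
    from jump_walk_distinct[OF q(1) yB] obtain n m S where
      S: "walk_through E S (y, 0) q n" "S \<subseteq> Z \<inter> B" "finite S" "card S = Suc m"
      "int n \<le> 3 * (int (lev y) - int (lev (fst q))) + 4 * int m + (int 0 - int (snd q))"
      "int (snd q) \<le> int 0 + int m + int (lev y) - int (lev (fst q))" by (metis fst_conv snd_conv)
    define k where "k = lev (fst q) - lev x"
    define d where "d = nat \<bar>int (snd q) - int K\<bar>"
    have k: "int k = int (lev (fst q)) - int (lev x)" "within_steps E k (fst q) x" "K \<le> snd q + k"
      using q(2) by (auto simp: covers_def k_def)
    have "walk_through E {q, (x, K)} q (x, K) (k + d)"
      using walk_through_space_time[OF k(2), of "snd q" K d] by (simp add: d_def)
    from walk_through_rev[OF walk_through_trans[OF S(1) this]]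
    have W: "walk_through E S (x, K) (y, 0) (n + (k + d))" by (rule walk_through_mono) auto
    have d: "int d \<le> 2 * int k + int (snd q) - int K" using k(3) by (simp add: d_def)
    define a where "a = int (lev y) - int (lev x)"
    have "int n \<le> 3 * a - 3 * int k + 4 * int m - int (snd q)" using S(5) k(1) by (simp add: a_def)
    moreover have "int (snd q) \<le> int m + a - int k" using S(6) k(1) by (simp add: a_def)
    moreover have "int K \<le> int (snd q) + int k" using k(3) by linarith
    moreover have "2 * a < int K" using False by (simp add: a_def)
    ultimately have "n + (k + d) \<le> 8 * m \<and> K \<le> 8 * m" using d by linarith
    then show ?thesis using concl[OF W S(2-4)] by blast
  qed
qed

end

lemma graph_dist_nbr:
  assumes "connected_graph E" "y \<in> nbrs E x"
  shows "graph_dist E r y \<le> Suc (graph_dist E r x)"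
proof -
  have "\<exists>n. (r, x) \<in> adj_rel E ^^ n"
    using assms(1) rtrancl_imp_relpow by (fastforce simp: connected_graph_def)
  then have "(r, x) \<in> adj_rel E ^^ graph_dist E r x"
    unfolding graph_dist_def by (rule LeastI_ex)
  moreover have "(x, y) \<in> adj_rel E" using assms(2) by (simp add: adj_rel_def nbrs_def)
  ultimately have "(r, y) \<in> adj_rel E ^^ Suc (graph_dist E r x)" by auto
  then show ?thesis unfolding graph_dist_def[of E r y] by (rule Least_le)
qed

text \<open>
  The maximum in \<open>j_bar\<close> is attained: the degree bound at the root makes the set of
  admissible numbers finite.
\<close>

lemma j_bar_root:
  assumes "\<And>x. finite (nbrs E x)" "\<And>x. card (nbrs E x) \<le> D" "j \<le> j_bar E"
  obtains r where "\<And>x. j \<le> card {y \<in> nbrs E x. graph_dist E r y = Suc (graph_dist E r x)}"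
proof -
  define I where "I = {i. \<exists>r. \<forall>k. \<forall>x\<in>graph_sphere E k r.
     i \<le> card (graph_sphere E (Suc k) r \<inter> nbrs E x)}"
  have iD: "i \<le> D" if "i \<in> I" for i
  proof -
    from that obtain r where "\<forall>k. \<forall>x\<in>graph_sphere E k r.
     i \<le> card (graph_sphere E (Suc k) r \<inter> nbrs E x)" by (auto simp: I_def)
    then have "i \<le> card (graph_sphere E (Suc (graph_dist E r r)) r \<inter> nbrs E r)"
      by (simp add: graph_sphere_def)
    also have "\<dots> \<le> card (nbrs E r)" by (rule card_mono) (use assms in auto)
    finally show ?thesis using assms(2)[of r] by simp
  qed
  then have "finite I" by (auto intro: finite_subset[of _ "{..D}"])
  moreover have "0 \<in> I" by (auto simp: I_def)
  ultimately have "Max I \<in> I" by (intro Max_in) auto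
  then obtain r where r: "\<And>k x. x \<in> graph_sphere E k r \<Longrightarrow>
     Max I \<le> card (graph_sphere E (Suc k) r \<inter> nbrs E x)" by (auto simp: I_def)
  have "j \<le> card {y \<in> nbrs E x. graph_dist E r y = Suc (graph_dist E r x)}" for x
  proof -
    have "j \<le> Max I" using assms(3) by (simp add: j_bar_def I_def)
    also have "\<dots> \<le> card (graph_sphere E (Suc (graph_dist E r x)) r \<inter> nbrs E x)"
      by (rule r) (simp add: graph_sphere_def)
    also have "graph_sphere E (Suc (graph_dist E r x)) r \<inter> nbrs E x =
        {y \<in> nbrs E x. graph_dist E r y = Suc (graph_dist E r x)}"
      by (auto simp: graph_sphere_def)
    finally show ?thesis .
  qed
  then show ?thesis using that by blast
qed

lemma zero_path_walk:
  assumes E: "simple_graph E" "connected_graph E"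
    and nb: "\<And>x. finite (nbrs E x)" "\<And>x. card (nbrs E x) \<le> D"
    and j: "j \<le> D" "omega_good E j"
  shows "\<exists>R. dense_defect_walks E j R"
proof (cases "real j < edge_isoperimetric E + 1")
  case True
  then show ?thesis using cluster_walk_isoperimetric[OF E(1) nb, of j] j
    by (simp add: omega_good_def)
next
  case False
  then have "j \<le> j_bar E" using j by (simp add: omega_good_def)
  then obtain r where r: "\<And>x. j \<le> card {y \<in> nbrs E x. graph_dist E r y = Suc (graph_dist E r x)}"
    using j_bar_root[OF nb] by blast
  show ?thesis
    unfolding dense_defect_walks_def
  proof (intro exI[of _ 8] allI impI)
    fix Z B x K y
    assume *: "facilitated_zeros E j Z B" "(x, K) \<in> Z" "(zero_step E Z)\<^sup>*\<^sup>* (x, K) (y, 0)"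
    interpret layered_zeros E j "graph_dist E r" Z B
      by unfold_locales (use nb graph_dist_nbr[OF E(2)] r * in auto)
    show "\<exists>w. walk (spacetime_nbrs E) w \<and> hd w = (x, K) \<and> length w \<le> 8 * card (B \<inter> set w) \<and>
         K \<le> 8 * card (B \<inter> set w)"
      by (rule layered_walk) (use * in auto)
  qed
qed

section \<open>Discrete dynamics and the propagation of disagreement\<close>

text \<open>
  The symbol \<open>None\<close> stands for a cell of the time mesh in which the clock of \<open>x\<close> does not ring,
  \<open>Some b\<close> for a ring that proposes the spin \<open>b\<close>.
\<close>

definition site_update ::
  "'v set set \<Rightarrow> nat \<Rightarrow> 'v \<Rightarrow> bool option \<Rightarrow> 'v config \<Rightarrow> 'v config" where
  "site_update E j x s \<eta> =
     (case s of None \<Rightarrow> \<eta> | Some b \<Rightarrow> if j \<le> num_ones E \<eta> x then \<eta>(x := b) else \<eta>)"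

primrec trajectory ::
  "'v set set \<Rightarrow> nat \<Rightarrow> (nat \<Rightarrow> nat \<times> 'v) \<Rightarrow> (nat \<times> 'v \<Rightarrow> bool option) \<Rightarrow> 'v config \<Rightarrow> nat \<Rightarrow> 'v config" where
  "trajectory E j es a \<xi> 0 = \<xi>"
| "trajectory E j es a \<xi> (Suc n) = site_update E j (snd (es n)) (a (es n)) (trajectory E j es a \<xi> n)"

text \<open>Within each cell of the time mesh the sites of \<open>xs\<close> are updated one after the other.\<close>

definition sweep :: "'v list \<Rightarrow> nat \<Rightarrow> nat \<times> 'v" where
  "sweep xs n = (n div length xs, xs ! (n mod length xs))"

lemma site_update_other: "y \<noteq> x \<Longrightarrow> site_update E j x s \<eta> y = \<eta> y"
  by (simp add: site_update_def split: option.splits)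

lemma num_ones_card: "finite (nbrs E x) \<Longrightarrow> num_ones E \<eta> x = card {y \<in> nbrs E x. \<eta> y}"
  by (simp add: num_ones_def of_bool_def sum.If_cases Int_def conj_commute)

text \<open>
  Block \<open>0\<close> is the initial state and block \<open>m + 1\<close> consists of the cells \<open>M * m, ..., M * m + M - 1\<close>.
  The two configurations are the initial states of the two coupled copies; the symbols are common
  to both.
\<close>

definition bad_block ::
  "nat \<Rightarrow> (nat \<times> 'v \<Rightarrow> bool option) \<Rightarrow> 'v config \<Rightarrow> 'v config \<Rightarrow> 'v \<Rightarrow> nat \<Rightarrow> bool" where
  "bad_block M a \<xi> \<xi>' x k = (case k of 0 \<Rightarrow> \<not> (\<xi> x \<and> \<xi>' x)
     | Suc m \<Rightarrow> (\<forall>i\<in>{M * m..<M * Suc m}. a (i, x) = None) \<or>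
                (\<exists>i\<in>{M * m..<M * Suc m}. a (i, x) = Some False))"

text \<open>
  Consecutive blocks share a state, so that a zero at the boundary is a zero of both. Since
  \<open>0 - 1 = 0\<close>, block \<open>0\<close> contains just the initial state.
\<close>

definition zero_blocks ::
  "'v set set \<Rightarrow> nat \<Rightarrow> 'v list \<Rightarrow> nat \<Rightarrow> (nat \<times> 'v \<Rightarrow> bool option) \<Rightarrow> nat \<Rightarrow>
   'v config \<Rightarrow> 'v config \<Rightarrow> ('v \<times> nat) set" where
  "zero_blocks E j xs M a K \<xi> \<xi>' = {(x, k). x \<in> set xs \<and> k \<le> K \<and>
     (\<exists>n\<in>{length xs * M * (k - 1)..length xs * M * k}.
        \<not> (trajectory E j (sweep xs) a \<xi> n x \<and> trajectory E j (sweep xs) a \<xi>' n x))}"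

definition defect_blocks ::
  "'v list \<Rightarrow> nat \<Rightarrow> (nat \<times> 'v \<Rightarrow> bool option) \<Rightarrow> nat \<Rightarrow>
   'v config \<Rightarrow> 'v config \<Rightarrow> ('v \<times> nat) set" where
  "defect_blocks xs M a K \<xi> \<xi>' = {(x, k). x \<in> set xs \<and> k \<le> K \<and>
     (bad_block M a \<xi> \<xi>' x k \<or> 0 < k \<and> bad_block M a \<xi> \<xi>' x (k - 1))}"

context
  fixes E :: "'v set set" and j :: nat and xs :: "'v list" and M :: nat
    and a :: "nat \<times> 'v \<Rightarrow> bool option" and K :: nat
  assumes nbrs_fin: "\<And>x. finite (nbrs E x)"
    and xs: "xs \<noteq> []" "distinct xs" and M: "0 < M"
begin

abbreviation (input) "L \<equiv> length xs * M"
abbreviation (input) "traj \<xi> \<equiv> trajectory E j (sweep xs) a \<xi>"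
abbreviation (input) "zero_set \<equiv> zero_blocks E j xs M a K"
abbreviation (input) "defect_set \<equiv> defect_blocks xs M a K"

lemma sweep_site: "snd (sweep xs n) \<in> set xs"
  using xs(1) by (simp add: sweep_def)

lemma trajectory_outside: "x \<notin> set xs \<Longrightarrow> traj \<xi> n x = \<xi> x"
proof (induction n)
  case (Suc n)
  then have "x \<noteq> snd (sweep xs n)" using sweep_site by metis
  then show ?case using Suc by (simp add: site_update_other)
qed simp

lemma block_event:
  assumes "n \<in> {L * m..<L * Suc m}"
  shows "fst (sweep xs n) \<in> {M * m..<M * Suc m}"
proof -
  have "n div length xs < M * Suc m"
    by (rule less_mult_imp_div_less) (use assms in \<open>auto simp: algebra_simps\<close>)
  moreover have "length xs * (M * m) div length xs \<le> n div length xs"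
    by (rule div_le_mono) (use assms in \<open>auto simp: algebra_simps\<close>)
  ultimately show ?thesis using xs(1) by (simp add: sweep_def)
qed

lemma block_event_exists:
  assumes "x \<in> set xs" "i \<in> {M * m..<M * Suc m}"
  obtains n where "n \<in> {L * m..<L * Suc m}" "sweep xs n = (i, x)"
proof -
  obtain c where c: "c < length xs" "xs ! c = x" using assms(1) by (metis in_set_conv_nth)
  define n where "n = length xs * i + c"
  have "length xs * (M * m) \<le> n" unfolding n_def using assms(2) by (intro trans_le_add1 mult_le_mono) auto
  moreover have "length xs * Suc i \<le> length xs * (M * Suc m)" using assms(2) by (intro mult_le_mono) auto
  then have "n < length xs * (M * Suc m)" using c(1) by (simp add: n_def)
  ultimately have "n \<in> {L * m..<L * Suc m}" by (simp add: algebra_simps)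
  moreover have "n div length xs = i"
    unfolding n_def by (rule div_nat_eqI) (use c(1) in auto)
  then have "sweep xs n = (i, x)" using c by (simp add: sweep_def n_def)
  ultimately show ?thesis using that by blast
qed

lemma zero_step_back:
  assumes "\<not> traj \<xi> (Suc n) x" "\<And>i. sweep xs n = (i, x) \<Longrightarrow> a (i, x) \<noteq> Some False"
  shows "\<not> traj \<xi> n x \<and>
    (\<forall>i. sweep xs n = (i, x) \<longrightarrow> a (i, x) \<noteq> None \<longrightarrow> \<not> j \<le> num_ones E (traj \<xi> n) x)"
proof (cases "snd (sweep xs n) = x")
  case True
  then obtain i where i: "sweep xs n = (i, x)" by (metis prod.collapse)
  with assms(1) assms(2)[OF i] show ?thesis
    by (auto simp: site_update_def split: option.splits if_splits)
next
  case False
  with assms(1) show ?thesis by (auto simp: site_update_other)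
qed

lemma zero_backward:
  assumes "\<not> traj \<xi> n x" "n' \<le> n"
    and "\<And>l i. n' \<le> l \<Longrightarrow> l < n \<Longrightarrow> sweep xs l = (i, x) \<Longrightarrow> a (i, x) \<noteq> Some False"
  shows "\<not> traj \<xi> n' x"
  using assms(2,1,3)
proof (induction n rule: dec_induct)
  case (step n)
  have "\<not> traj \<xi> n x"
    using zero_step_back[OF step.prems(1)] step.prems(2)[of n] step.hyps by auto
  then show ?case using step by auto
qed simp

text \<open>
  Within good blocks no symbol creates a zero, so the zero at time \<open>n\<close> goes back to the beginning
  of block \<open>m + 1\<close> and, in block \<open>m\<close>, to a ring that proposed a one. As this proposal was not
  accepted, the site was not facilitated then.
\<close>

lemma zero_rule_single:
  assumes x: "x \<in> set xs" and n: "n \<in> {L * m..L * Suc m}" "\<not> traj \<xi> n x"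
    and good: "\<not> bad_block M a \<zeta> \<zeta>' x (Suc m)" "\<not> bad_block M a \<zeta> \<zeta>' x m"
    and init: "\<xi> x = \<zeta> x \<or> \<xi> x = \<zeta>' x"
  shows "\<exists>n'\<in>{L * (m - 1)..L * m}. \<not> traj \<xi> n' x \<and> \<not> j \<le> num_ones E (traj \<xi> n') x"
proof -
  have z: "\<not> traj \<xi> (L * m) x"
  proof (rule zero_backward[OF n(2)])
    show "a (i, x) \<noteq> Some False" if "L * m \<le> l" "l < n" "sweep xs l = (i, x)" for l i
    proof -
      have "i \<in> {M * m..<M * Suc m}" using block_event[of l m] that n by auto
      then show ?thesis using good(1) by (auto simp: bad_block_def)
    qed
  qed (use n in auto)
  show ?thesis
  proof (cases m)
    case 0
    then show ?thesis using z good(2) init by (auto simp: bad_block_def)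
  next
    case (Suc m')
    have nb: "a (i, x) \<noteq> Some False" if "L * m' \<le> l" "l < L * m" "sweep xs l = (i, x)" for l i
    proof -
      have "i \<in> {M * m'..<M * Suc m'}" using block_event[of l m'] that Suc by auto
      then show ?thesis using good(2) Suc by (auto simp: bad_block_def)
    qed
    obtain i where i: "i \<in> {M * m'..<M * Suc m'}" "a (i, x) \<noteq> None"
      using good(2) Suc by (auto simp: bad_block_def)
    from block_event_exists[OF x i(1)] obtain l where
      l: "l \<in> {L * m'..<L * Suc m'}" "sweep xs l = (i, x)" .
    have "\<not> traj \<xi> (Suc l) x"
    proof (rule zero_backward[OF z])
      show "Suc l \<le> L * m" using l Suc by simp
      show "a (i', x) \<noteq> Some False" if "Suc l \<le> l'" "l' < L * m" "sweep xs l' = (i', x)" for l' i'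
        using nb[of l' i'] that l by simp
    qed
    from zero_step_back[OF this] nb[of l] l i Suc
    have "\<not> traj \<xi> l x" "\<not> j \<le> num_ones E (traj \<xi> l) x" by auto
    then show ?thesis using l Suc by (intro bexI[of _ l]) auto
  qed
qed

text \<open>
  A neighbour that is no zero of block \<open>m\<close> is a one at all times of the block, in particular at the
  suppressed ring; so there are fewer than \<open>j\<close> of them. Neighbours outside the volume are frozen at
  one.
\<close>

lemma facilitated_zero_set:
  assumes out: "\<And>x. x \<notin> set xs \<Longrightarrow> \<xi> x \<and> \<xi>' x"
  shows "facilitated_zeros E j (zero_set \<xi> \<xi>') (defect_set \<xi> \<xi>')"
  unfolding facilitated_zeros_def
proof (intro conjI allI impI)
  show "finite (zero_set \<xi> \<xi>')"
    by (rule finite_subset[of _ "set xs \<times> {..K}"]) (auto simp: zero_blocks_def)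
  fix x k assume xk: "(x, k) \<in> zero_set \<xi> \<xi>'"
  then have x: "x \<in> set xs" "k \<le> K" by (auto simp: zero_blocks_def)
  from xk obtain n where n: "n \<in> {L * (k - 1)..L * k}" "\<not> (traj \<xi> n x \<and> traj \<xi>' n x)"
    by (auto simp: zero_blocks_def)
  show "(x, k) \<in> defect_set \<xi> \<xi>' \<or>
        (\<exists>m. k = Suc m \<and> (x, m) \<in> zero_set \<xi> \<xi>' \<and> card {y \<in> nbrs E x. (y, m) \<notin> zero_set \<xi> \<xi>'} < j)"
  proof (cases "(x, k) \<in> defect_set \<xi> \<xi>'")
    case False
    then have good: "\<not> bad_block M a \<xi> \<xi>' x k" "0 < k \<Longrightarrow> \<not> bad_block M a \<xi> \<xi>' x (k - 1)"
      using x by (auto simp: defect_blocks_def)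
    have "k \<noteq> 0"
    proof
      assume "k = 0"
      then show False using good(1) n by (auto simp: bad_block_def)
    qed
    then obtain m where m: "k = Suc m" by (cases k) auto
    from n(2) obtain \<zeta> where z: "\<zeta> = \<xi> \<or> \<zeta> = \<xi>'" "\<not> traj \<zeta> n x" by blast
    from zero_rule_single[OF x(1) _ z(2), of m \<xi> \<xi>'] n(1) m good z(1)
    obtain n' where n': "n' \<in> {L * (m - 1)..L * m}" "\<not> traj \<zeta> n' x" "\<not> j \<le> num_ones E (traj \<zeta> n') x"
      by auto
    have "(x, m) \<in> zero_set \<xi> \<xi>'" unfolding zero_blocks_def using x m n' z(1) by auto
    moreover have "{y \<in> nbrs E x. (y, m) \<notin> zero_set \<xi> \<xi>'} \<subseteq> {y \<in> nbrs E x. traj \<zeta> n' y}"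
    proof safe
      fix y assume y: "(y, m) \<notin> zero_set \<xi> \<xi>'"
      show "traj \<zeta> n' y"
      proof (cases "y \<in> set xs")
        case True
        then show ?thesis using y n' z(1) x m by (auto simp: zero_blocks_def)
      next
        case False
        then show ?thesis using trajectory_outside out z(1) by auto
      qed
    qed
    then have "card {y \<in> nbrs E x. (y, m) \<notin> zero_set \<xi> \<xi>'} \<le> num_ones E (traj \<zeta> n') x"
      unfolding num_ones_card[OF nbrs_fin] by (intro card_mono) (use nbrs_fin in auto)
    ultimately show ?thesis using m n'(3) by auto
  qed simp
qed

text \<open>
  Both copies read the same symbols, so a site where they begin to disagree has a neighbour where
  they disagreed before.
\<close>

lemma disagreement_path:
  assumes out: "\<And>x. x \<notin> set xs \<Longrightarrow> \<xi> x \<and> \<xi>' x"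
    and "traj \<xi> n x \<noteq> traj \<xi>' n x" "k \<le> K" "n \<in> {L * (k - 1)..L * k}"
  shows "(x, k) \<in> zero_set \<xi> \<xi>' \<and> (\<exists>y. (zero_step E (zero_set \<xi> \<xi>'))\<^sup>*\<^sup>* (x, k) (y, 0))"
  using assms(2-)
proof (induction n arbitrary: x k)
  case 0
  have xs': "x \<in> set xs" using 0 out by auto
  have L0: "0 < L" using xs M by simp
  then have k: "k = 0 \<or> k = 1" using 0 by (cases k) auto
  have z: "(x, k) \<in> zero_set \<xi> \<xi>'" "(x, 0) \<in> zero_set \<xi> \<xi>'"
    using 0 xs' by (auto simp: zero_blocks_def intro: bexI[of _ 0])
  then have "zero_step E (zero_set \<xi> \<xi>') (x, k) (x, 0) \<or> k = 0"
    using k by (auto simp: zero_step_def spacetime_nbrs_def)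
  then show ?case using z by blast
next
  case (Suc n)
  let ?Z = "zero_set \<xi> \<xi>'"
  have xs': "x \<in> set xs" using Suc.prems(1) trajectory_outside out by metis
  have L0: "0 < L" using xs M by simp
  have z: "(x, k) \<in> ?Z" unfolding zero_blocks_def
    using Suc.prems xs' by (auto simp del: trajectory.simps)
  have link: "(zero_step E ?Z)\<^sup>*\<^sup>* (x, k) (y, 0) \<Longrightarrow> ?case" for y using z by blast
  \<comment> \<open>\<open>l\<close> is a block containing the states before and after update \<open>n\<close>; it is \<open>k\<close> or \<open>k - 1\<close>\<close>
  define l where "l = Suc (n div L)"
  have 1: "L * (n div L) \<le> n" by (rule times_div_less_eq_dividend)
  have 2: "n < L * Suc (n div L)" using dividend_less_times_div[OF L0, of n] by simp
  have l: "n \<in> {L * (l - 1)..L * l}" "Suc n \<in> {L * (l - 1)..L * l}"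
    unfolding l_def atLeastAtMost_iff diff_Suc_1
    by (intro conjI le_SucI Suc_leI 1 2 less_imp_le[OF 2])+
  have lk: "l = k \<or> Suc l = k"
  proof -
    have b: "L * (l - 1) \<le> n" "Suc n \<le> L * l" "L * (k - 1) \<le> Suc n" "n < L * k"
      using l Suc.prems(3) by (auto simp only: atLeastAtMost_iff Suc_le_eq)
    have "L * (l - 1) < L * k" using b(1,4) by (rule le_less_trans)
    then have "l - 1 < k" by (metis mult_less_cancel1)
    have "L * (k - 1) \<le> L * l" using b(3,2) by (rule order_trans)
    then have "k - 1 \<le> l" using L0 by (metis mult_le_cancel1)
    with \<open>l - 1 < k\<close> show ?thesis by (auto simp: l_def)
  qed
  then have lK: "l \<le> K" using Suc.prems(2) by auto
  have zl: "(x, l) \<in> ?Z" unfolding zero_blocks_def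
    using Suc.prems(1) xs' l(2) lK by (auto simp del: trajectory.simps)
  have step1: "(zero_step E ?Z)\<^sup>*\<^sup>* (x, k) (x, l)"
    using lk z zl by (auto simp: zero_step_def spacetime_nbrs_def)
  have "\<exists>y. ((y, l) = (x, l) \<or> zero_step E ?Z (x, l) (y, l)) \<and> traj \<xi> n y \<noteq> traj \<xi>' n y"
  proof (cases "traj \<xi> n x = traj \<xi>' n x")
    case True
    obtain i v where iv: "sweep xs n = (i, v)" by force
    have v: "v = x"
    proof (rule ccontr)
      assume "v \<noteq> x"
      then show False using True Suc.prems(1) by (simp add: iv site_update_other)
    qed
    have "num_ones E (traj \<xi> n) x \<noteq> num_ones E (traj \<xi>' n) x"
      using True Suc.prems(1) by (auto simp: iv v site_update_def split: option.splits if_splits)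
    moreover have "num_ones E (traj \<xi> n) x = num_ones E (traj \<xi>' n) x"
      if "\<forall>y\<in>nbrs E x. traj \<xi> n y = traj \<xi>' n y"
      unfolding num_ones_def by (rule sum.cong) (use that in auto)
    ultimately obtain y where y: "y \<in> nbrs E x" "traj \<xi> n y \<noteq> traj \<xi>' n y" by blast
    have "(y, l) \<in> ?Z" using Suc.IH[OF y(2) lK l(1)] by blast
    then show ?thesis using y zl by (auto simp: zero_step_def spacetime_nbrs_def)
  qed auto
  then obtain y where y: "(y, l) = (x, l) \<or> zero_step E ?Z (x, l) (y, l)" "traj \<xi> n y \<noteq> traj \<xi>' n y"
    by blast
  from Suc.IH[OF y(2) lK l(1)] obtain v where "(zero_step E ?Z)\<^sup>*\<^sup>* (y, l) (v, 0)" by blast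
  then have "(zero_step E ?Z)\<^sup>*\<^sup>* (x, l) (v, 0)" using y(1) by (auto intro: converse_rtranclp_into_rtranclp)
  with step1 show ?case by (intro link) (rule rtranclp_trans)
qed

end

section \<open>Independent symbols and stationarity\<close>

lemma measure_pair_pmf_times:
  "measure_pmf.prob (pair_pmf A B) (X \<times> Y) = measure_pmf.prob A X * measure_pmf.prob B Y"
proof -
  have "measure_pmf.prob (pair_pmf A B) (X \<times> Y) =
      measure_pmf.prob (pair_pmf A B) ((X \<inter> set_pmf A) \<times> (Y \<inter> set_pmf B))"
    by (subst measure_Int_set_pmf[symmetric]) (simp add: Times_Int_Times)
  also have "\<dots> = measure_pmf.prob A (X \<inter> set_pmf A) * measure_pmf.prob B (Y \<inter> set_pmf B)"
    by (rule measure_pmf_prob_product) auto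
  finally show ?thesis by (simp add: measure_Int_set_pmf)
qed

lemma prob_Pi_pmf_disjoint_blocks:
  assumes "finite I" "finite A" "\<And>i. i \<in> I \<Longrightarrow> C i \<subseteq> A" "disjoint_family_on C I"
    and "\<And>i f g. i \<in> I \<Longrightarrow> (\<And>y. y \<in> C i \<Longrightarrow> f y = g y) \<Longrightarrow> Q i f = Q i g"
  shows "measure_pmf.prob (Pi_pmf A d p) {f. \<forall>i\<in>I. Q i f} =
         (\<Prod>i\<in>I. measure_pmf.prob (Pi_pmf (C i) d p) {f. Q i f})"
  using assms
proof (induction I arbitrary: A rule: finite_induct)
  case empty
  then show ?case by simp
next
  case (insert i I)
  define A' where "A' = A - C i"
  have CA: "A = C i \<union> A'" "C i \<inter> A' = {}" "finite (C i)" "finite A'"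
    using insert.prems(1,2) finite_subset[of "C i" A] by (auto simp: A'_def)
  have disj: "C i \<inter> C k = {}" if "k \<in> I" for k
    using insert.prems(3) insert.hyps that by (auto simp: disjoint_family_on_def)
  let ?m = "\<lambda>(f, g) x. if x \<in> C i then f x else g x"
  have Qi: "Q i (?m (f, g)) = Q i f" for f g
    by (rule insert.prems(4)) auto
  have Qk: "Q k (?m (f, g)) = Q k g" if "k \<in> I" for f g k
    by (rule insert.prems(4)) (use that disj in auto)
  have "measure_pmf.prob (Pi_pmf A d p) {f. \<forall>k\<in>insert i I. Q k f} =
      measure_pmf.prob (pair_pmf (Pi_pmf (C i) d p) (Pi_pmf A' d p)) ({f. Q i f} \<times> {g. \<forall>k\<in>I. Q k g})"
    unfolding CA(1) Pi_pmf_union[OF CA(3,4,2)] measure_map_pmf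
    by (rule arg_cong[where f = "measure_pmf.prob _"]) (use Qi Qk in auto)
  also have "\<dots> = measure_pmf.prob (Pi_pmf (C i) d p) {f. Q i f} *
      measure_pmf.prob (Pi_pmf A' d p) {g. \<forall>k\<in>I. Q k g}"
    by (rule measure_pair_pmf_times)
  also have "measure_pmf.prob (Pi_pmf A' d p) {g. \<forall>k\<in>I. Q k g} =
      (\<Prod>k\<in>I. measure_pmf.prob (Pi_pmf (C k) d p) {f. Q k f})"
  proof (rule insert.IH[OF CA(4)])
    show "C k \<subseteq> A'" if "k \<in> I" for k using insert.prems(2)[of k] disj[OF that] that by (auto simp: A'_def)
    show "disjoint_family_on C I" using insert.prems(3) by (auto simp: disjoint_family_on_def)
    show "Q k f = Q k g" if "k \<in> I" "\<And>y. y \<in> C k \<Longrightarrow> f y = g y" for k f g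
      by (rule insert.prems(4)) (use that in auto)
  qed
  finally show ?case using insert.hyps by simp
qed

text \<open>A ring has probability \<open>r\<close> and proposes a one with probability \<open>q\<close>.\<close>

definition symbol_pmf :: "real \<Rightarrow> real \<Rightarrow> bool option pmf" where
  "symbol_pmf r q = bind_pmf (bernoulli_pmf r)
     (\<lambda>b. if b then map_pmf Some (bernoulli_pmf q) else return_pmf None)"

lemma pmf_symbol:
  assumes "r \<in> {0..1}" "q \<in> {0..1}"
  shows "pmf (symbol_pmf r q) None = 1 - r" "pmf (symbol_pmf r q) (Some True) = r * q"
    "pmf (symbol_pmf r q) (Some False) = r * (1 - q)"
proof -
  have 1: "pmf (map_pmf Some (bernoulli_pmf q)) None = 0"
    by (subst pmf_eq_0_set_pmf) auto
  have 2: "pmf (map_pmf Some (bernoulli_pmf q)) (Some b) = pmf (bernoulli_pmf q) b" for b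
    by (rule pmf_map_inj') (auto simp: inj_on_def)
  show "pmf (symbol_pmf r q) None = 1 - r" "pmf (symbol_pmf r q) (Some True) = r * q"
    "pmf (symbol_pmf r q) (Some False) = r * (1 - q)"
    using assms by (simp_all add: symbol_pmf_def pmf_bind 1 2)
qed

abbreviation product_pmf :: "'v set \<Rightarrow> real \<Rightarrow> 'v config pmf" where
  "product_pmf V q \<equiv> Pi_pmf V True (\<lambda>_. bernoulli_pmf q)"

lemma num_ones_upd_self:
  assumes "simple_graph E" shows "num_ones E (\<eta>(x := b)) x = num_ones E \<eta> x"
proof -
  have "x \<notin> nbrs E x"
    using assms by (fastforce simp: simple_graph_def nbrs_def)
  then show ?thesis unfolding num_ones_def by (intro sum.cong) auto
qed

text \<open>
  Conditionally on the spins at the other sites, the spin at \<open>x\<close> is either left alone or replaced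
  by an independent copy, and which of the two happens is decided by the other spins and by the
  ring.
\<close>

lemma site_update_stationary:
  assumes E: "simple_graph E" and V: "finite V" "x \<in> V"
  shows "bind_pmf (product_pmf V q) (\<lambda>\<eta>. map_pmf (\<lambda>s. site_update E j x s \<eta>) (symbol_pmf r q))
         = product_pmf V q"
proof -
  let ?B = "bernoulli_pmf q"
  define W where "W = V - {x}"
  have W: "V = insert x W" "finite W" "x \<notin> W" using V by (auto simp: W_def)
  have pi: "product_pmf V q = bind_pmf (product_pmf W q) (\<lambda>f. map_pmf (\<lambda>b. f(x := b)) ?B)"
    unfolding W(1) Pi_pmf_insert[OF W(2,3)]
    by (simp add: pair_pmf_def map_pmf_def bind_assoc_pmf bind_return_pmf) (rule bind_commute_pmf)
  have one: "bind_pmf ?B (\<lambda>b. map_pmf (\<lambda>s. site_update E j x s (f(x := b))) (symbol_pmf r q))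
      = map_pmf (\<lambda>b. f(x := b)) ?B" for f
  proof -
    have upd: "site_update E j x (Some c) (f(x := b)) =
        (if j \<le> num_ones E f x then f(x := c) else f(x := b))" for b c
      by (simp add: site_update_def num_ones_upd_self[OF E])
    have no: "site_update E j x None \<eta> = \<eta>" for \<eta> by (simp add: site_update_def)
    have inner: "map_pmf (\<lambda>s. site_update E j x s (f(x := b))) (symbol_pmf r q) =
       bind_pmf (bernoulli_pmf r) (\<lambda>c. if c
         then map_pmf (\<lambda>c. if j \<le> num_ones E f x then f(x := c) else f(x := b)) ?B
         else return_pmf (f(x := b)))" for b
      unfolding symbol_pmf_def map_bind_pmf
      by (intro bind_pmf_cong refl) (auto simp: map_pmf_comp upd no)
    have "bind_pmf ?B (\<lambda>b. map_pmf (\<lambda>s. site_update E j x s (f(x := b))) (symbol_pmf r q)) =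
       bind_pmf (bernoulli_pmf r) (\<lambda>c. bind_pmf ?B (\<lambda>b. if c
         then map_pmf (\<lambda>c. if j \<le> num_ones E f x then f(x := c) else f(x := b)) ?B
         else return_pmf (f(x := b))))"
      unfolding inner by (rule bind_commute_pmf)
    also have "\<dots> = bind_pmf (bernoulli_pmf r) (\<lambda>c. map_pmf (\<lambda>b. f(x := b)) ?B)"
    proof (intro bind_pmf_cong refl)
      fix c
      show "bind_pmf ?B (\<lambda>b. if c
         then map_pmf (\<lambda>c. if j \<le> num_ones E f x then f(x := c) else f(x := b)) ?B
         else return_pmf (f(x := b))) = map_pmf (\<lambda>b. f(x := b)) ?B"
        by (cases c; cases "j \<le> num_ones E f x") (simp_all add: map_pmf_def)
    qed
    finally show ?thesis by simp
  qed
  show ?thesis unfolding pi bind_assoc_pmf bind_map_pmf one ..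
qed

lemma trajectory_cong:
  "(\<And>m. m < n \<Longrightarrow> a (es m) = a' (es m)) \<Longrightarrow> trajectory E j es a \<xi> n = trajectory E j es a' \<xi> n"
  by (induction n) auto

text \<open>Distinct updates read distinct symbols, so each update meets a fresh one.\<close>

lemma trajectory_stationary_exact:
  assumes E: "simple_graph E" and V: "finite V" "\<And>m. m < n \<Longrightarrow> snd (es m) \<in> V"
    and inj: "inj_on es {..<n}"
  shows "bind_pmf (product_pmf V q) (\<lambda>\<xi>. map_pmf (\<lambda>a. trajectory E j es a \<xi> n)
           (Pi_pmf (es ` {..<n}) None (\<lambda>_. symbol_pmf r q))) = product_pmf V q"
  using V(2) inj
proof (induction n)
  case 0
  then show ?case by (simp add: bind_return_pmf')
next
  case (Suc n)
  let ?F = "\<lambda>n. Pi_pmf (es ` {..<n}) None (\<lambda>_. symbol_pmf r q)"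
  have new: "es n \<notin> es ` {..<n}"
  proof
    assume "es n \<in> es ` {..<n}"
    then obtain m where "m < n" "es n = es m" by auto
    then show False using inj_onD[OF Suc.prems(2), of n m] by simp
  qed
  have "map_pmf (\<lambda>a. trajectory E j es a \<xi> (Suc n)) (?F (Suc n)) =
     bind_pmf (map_pmf (\<lambda>a. trajectory E j es a \<xi> n) (?F n))
       (\<lambda>\<eta>. map_pmf (\<lambda>s. site_update E j (snd (es n)) s \<eta>) (symbol_pmf r q))" for \<xi>
  proof -
    have "trajectory E j es (f(es n := y)) \<xi> n = trajectory E j es f \<xi> n" for f y
    proof (rule trajectory_cong)
      fix m assume "m < n"
      then have "es m \<noteq> es n" using new by (metis imageI lessThan_iff)
      then show "(f(es n := y)) (es m) = f (es m)" by simp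
    qed
    then have "map_pmf (\<lambda>a. trajectory E j es a \<xi> (Suc n)) (?F (Suc n)) =
        bind_pmf (symbol_pmf r q) (\<lambda>y. map_pmf (\<lambda>f. site_update E j (snd (es n)) y (trajectory E j es f \<xi> n)) (?F n))"
      unfolding lessThan_Suc image_insert
      by (subst Pi_pmf_insert) (use new in \<open>auto simp: map_pmf_comp pair_pmf_def map_bind_pmf map_pmf_def bind_assoc_pmf bind_return_pmf\<close>)
    also have "\<dots> = bind_pmf (map_pmf (\<lambda>a. trajectory E j es a \<xi> n) (?F n))
       (\<lambda>\<eta>. map_pmf (\<lambda>s. site_update E j (snd (es n)) s \<eta>) (symbol_pmf r q))"
      unfolding map_pmf_def bind_assoc_pmf bind_return_pmf by (rule bind_commute_pmf)
    finally show ?thesis .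
  qed
  then have "bind_pmf (product_pmf V q) (\<lambda>\<xi>. map_pmf (\<lambda>a. trajectory E j es a \<xi> (Suc n)) (?F (Suc n))) =
     bind_pmf (bind_pmf (product_pmf V q) (\<lambda>\<xi>. map_pmf (\<lambda>a. trajectory E j es a \<xi> n) (?F n)))
       (\<lambda>\<eta>. map_pmf (\<lambda>s. site_update E j (snd (es n)) s \<eta>) (symbol_pmf r q))"
    by (simp only: bind_assoc_pmf)
  also have "bind_pmf (product_pmf V q) (\<lambda>\<xi>. map_pmf (\<lambda>a. trajectory E j es a \<xi> n) (?F n)) = product_pmf V q"
    by (rule Suc.IH) (use Suc.prems in \<open>auto simp: inj_on_def\<close>)
  also have "bind_pmf (product_pmf V q)
       (\<lambda>\<eta>. map_pmf (\<lambda>s. site_update E j (snd (es n)) s \<eta>) (symbol_pmf r q)) = product_pmf V q"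
    by (rule site_update_stationary) (use E V Suc.prems in auto)
  finally show ?case .
qed

lemma trajectory_stationary:
  assumes E: "simple_graph E" and V: "finite V" "\<And>m. m < n \<Longrightarrow> snd (es m) \<in> V"
    and inj: "inj_on es {..<n}" and A: "finite A" "es ` {..<n} \<subseteq> A"
  shows "bind_pmf (product_pmf V q) (\<lambda>\<xi>. map_pmf (\<lambda>a. trajectory E j es a \<xi> n)
           (Pi_pmf A None (\<lambda>_. symbol_pmf r q))) = product_pmf V q"
proof -
  have "map_pmf (\<lambda>a. trajectory E j es a \<xi> n) (Pi_pmf A None (\<lambda>_. symbol_pmf r q)) =
        map_pmf (\<lambda>a. trajectory E j es a \<xi> n) (Pi_pmf (es ` {..<n}) None (\<lambda>_. symbol_pmf r q))" for \<xi>
    unfolding Pi_pmf_subset[OF A] map_pmf_comp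
    by (intro map_pmf_cong refl trajectory_cong) auto
  then show ?thesis using trajectory_stationary_exact[OF E V inj] by simp
qed

lemma sweep_inj: assumes "xs \<noteq> []" "distinct xs" shows "inj_on (sweep xs) A"
proof (rule inj_onI)
  fix m n assume eq: "sweep xs m = sweep xs n"
  then have "m div length xs = n div length xs" by (simp add: sweep_def)
  moreover have "m mod length xs = n mod length xs"
    using eq assms by (simp add: sweep_def nth_eq_iff_index_eq)
  ultimately show "m = n" by (metis div_mult_mod_eq)
qed

lemma sweep_range:
  assumes "xs \<noteq> []" "m < length xs * N" shows "sweep xs m \<in> {..<N} \<times> set xs"
  using assms by (auto simp: sweep_def less_mult_imp_div_less mult.commute)

section \<open>Union bound for the probability of disagreement\<close>

text \<open>Pairs of initial states for the coupling. Outside the volume both are frozen at one.\<close>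

definition initial_pmf :: "'v set \<Rightarrow> real \<Rightarrow> real \<Rightarrow> ('v \<Rightarrow> bool \<times> bool) pmf" where
  "initial_pmf V p q = Pi_pmf V (True, True) (\<lambda>_. pair_pmf (bernoulli_pmf p) (bernoulli_pmf q))"

definition field_pmf :: "'v set \<Rightarrow> nat \<Rightarrow> real \<Rightarrow> real \<Rightarrow> (nat \<times> 'v \<Rightarrow> bool option) pmf" where
  "field_pmf V N r q = Pi_pmf ({..<N} \<times> V) None (\<lambda>_. symbol_pmf r q)"

lemma prob_bad_initial:
  assumes "p \<in> {0..1}" "q \<in> {0..1}"
  shows "measure_pmf.prob (Pi_pmf {x} d (\<lambda>_. pair_pmf (bernoulli_pmf p) (bernoulli_pmf q)))
           {\<zeta>. \<not> (fst (\<zeta> x) \<and> snd (\<zeta> x))} \<le> (1 - p) + (1 - q)"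
proof -
  let ?B = "pair_pmf (bernoulli_pmf p) (bernoulli_pmf q)"
  have "{\<zeta>. \<not> (fst (\<zeta> x) \<and> snd (\<zeta> x))} = Pi {x} (\<lambda>_. {c. \<not> (fst c \<and> snd c)})" by auto
  then have "measure_pmf.prob (Pi_pmf {x} d (\<lambda>_. ?B)) {\<zeta>. \<not> (fst (\<zeta> x) \<and> snd (\<zeta> x))} =
      measure_pmf.prob ?B {c. \<not> (fst c \<and> snd c)}"
    by (simp add: measure_Pi_pmf_Pi)
  also have "\<dots> \<le> measure_pmf.prob ?B ({False} \<times> UNIV \<union> UNIV \<times> {False})"
    by (rule measure_pmf.finite_measure_mono) auto
  also have "\<dots> \<le> measure_pmf.prob ?B ({False} \<times> UNIV) + measure_pmf.prob ?B (UNIV \<times> {False})"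
    by (rule measure_Un_le) auto
  also have "\<dots> = (1 - p) + (1 - q)"
    using assms by (simp add: measure_pair_pmf_times measure_pmf_single)
  finally show ?thesis .
qed

lemma prob_bad_symbols:
  fixes r q :: real
  assumes "r \<in> {0..1}" "q \<in> {0..1}" "finite I"
  shows "measure_pmf.prob (Pi_pmf (I \<times> {x}) None (\<lambda>_. symbol_pmf r q))
           {a. (\<forall>i\<in>I. a (i, x) = None) \<or> (\<exists>i\<in>I. a (i, x) = Some False)}
         \<le> (1 - r) ^ card I + card I * (r * (1 - q))"
proof -
  let ?P = "Pi_pmf (I \<times> {x}) None (\<lambda>_. symbol_pmf r q)"
  let ?N = "{a. \<forall>i\<in>I. a (i, x) = None}" and ?F = "\<lambda>i. {a. a (i, x) = Some False}"
  have fin: "finite (I \<times> {x})" using assms by simp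
  have N: "?N = Pi (I \<times> {x}) (\<lambda>_. {None})" by auto
  have 1: "measure_pmf.prob ?P ?N = (1 - r) ^ card I"
    unfolding N using assms by (simp add: measure_Pi_pmf_Pi[OF fin] measure_pmf_single pmf_symbol card_cartesian_product)
  have 2: "measure_pmf.prob ?P (?F i) = r * (1 - q)" if "i \<in> I" for i
  proof -
    have "measure_pmf.prob ?P (?F i) = measure_pmf.prob (map_pmf (\<lambda>f. f (i, x)) ?P) {Some False}"
      by (simp add: vimage_def)
    also have "\<dots> = r * (1 - q)"
      using that assms by (simp add: Pi_pmf_component[OF fin] measure_pmf_single pmf_symbol)
    finally show ?thesis .
  qed
  have "measure_pmf.prob ?P {a. (\<forall>i\<in>I. a (i, x) = None) \<or> (\<exists>i\<in>I. a (i, x) = Some False)}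
      = measure_pmf.prob ?P (?N \<union> (\<Union>i\<in>I. ?F i))"
    by (rule arg_cong[where f = "measure_pmf.prob _"]) auto
  also have "\<dots> \<le> measure_pmf.prob ?P ?N + measure_pmf.prob ?P (\<Union>i\<in>I. ?F i)"
    by (rule measure_Un_le) auto
  also have "measure_pmf.prob ?P (\<Union>i\<in>I. ?F i) \<le> (\<Sum>i\<in>I. measure_pmf.prob ?P (?F i))"
    by (rule measure_pmf.finite_measure_subadditive_finite) (use assms in auto)
  also have "\<dots> = card I * (r * (1 - q))" using 2 by simp
  finally show ?thesis using 1 by simp
qed

text \<open>
  Badness of a site-block depends on its own initial spins or on its own symbols only, so distinct
  site-blocks are independent.
\<close>

lemma prob_all_bad_le:
  fixes p q r e :: real
  assumes "finite V" and B: "B \<subseteq> V \<times> {..K}" and M: "0 < M"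
    and par: "r \<in> {0..1}" "p \<in> {0..1}" "q \<in> {0..1}"
    and e: "(1 - p) + (1 - q) \<le> e" "(1 - r) ^ M + M * (r * (1 - q)) \<le> e"
  shows "measure_pmf.prob (pair_pmf (initial_pmf V p q) (field_pmf V (M * K) r q))
     {(\<zeta>, a). \<forall>(x, k)\<in>B. bad_block M a (fst \<circ> \<zeta>) (snd \<circ> \<zeta>) x k} \<le> e ^ card B"
proof -
  define B0 where "B0 = {b \<in> B. snd b = 0}"
  define B1 where "B1 = {b \<in> B. snd b \<noteq> 0}"
  have finB: "finite B" using B assms(1) finite_subset by blast
  then have fin: "finite B0" "finite B1" by (auto simp: B0_def B1_def)
  have cB: "card B = card B0 + card B1"
    by (subst card_Un_disjoint[OF fin, symmetric]) (auto simp: B0_def B1_def intro: arg_cong[where f = card])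
  define I where "I k = {M * (k - 1)..<M * k}" for k
  define Q0 where "Q0 b \<zeta> \<longleftrightarrow> \<not> (fst (\<zeta> (fst b)) \<and> snd (\<zeta> (fst b)))" for b :: "'a \<times> nat" and \<zeta> :: "'a \<Rightarrow> bool \<times> bool"
  define Q1 where "Q1 b a \<longleftrightarrow> (\<forall>i\<in>I (snd b). a (i, fst b) = None) \<or> (\<exists>i\<in>I (snd b). a (i, fst b) = Some False)"
    for b :: "'a \<times> nat" and a
  have ev: "{(\<zeta>, a). \<forall>(x, k)\<in>B. bad_block M a (fst \<circ> \<zeta>) (snd \<circ> \<zeta>) x k} =
     {\<zeta>. \<forall>b\<in>B0. Q0 b \<zeta>} \<times> {a. \<forall>b\<in>B1. Q1 b a}" (is "?ev = _")
  proof -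
    have "bad_block M a (fst \<circ> \<zeta>) (snd \<circ> \<zeta>) x k = (if k = 0 then Q0 (x, k) \<zeta> else Q1 (x, k) a)" for a \<zeta> x k
      by (cases k) (auto simp: bad_block_def Q0_def Q1_def I_def)
    then show ?thesis by (fastforce simp: B0_def B1_def split: if_splits)
  qed
  have e0: "0 \<le> e" using e(1) par by auto
  have "measure_pmf.prob (initial_pmf V p q) {\<zeta>. \<forall>b\<in>B0. Q0 b \<zeta>} =
     (\<Prod>b\<in>B0. measure_pmf.prob (Pi_pmf {fst b} (True, True) (\<lambda>_. pair_pmf (bernoulli_pmf p) (bernoulli_pmf q))) {\<zeta>. Q0 b \<zeta>})"
    unfolding initial_pmf_def
    by (rule prob_Pi_pmf_disjoint_blocks)
      (use fin assms(1) B in \<open>auto simp: disjoint_family_on_def B0_def Q0_def prod_eq_iff\<close>)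
  also have "\<dots> \<le> (\<Prod>b\<in>B0. e)"
  proof (rule prod_mono, safe)
    fix x k
    show "measure_pmf.prob (Pi_pmf {fst (x, k)} (True, True) (\<lambda>_. pair_pmf (bernoulli_pmf p) (bernoulli_pmf q))) {\<zeta>. Q0 (x, k) \<zeta>} \<le> e"
      using prob_bad_initial[OF par(2,3), of x "(True, True)"] e(1) unfolding Q0_def by simp
  qed auto
  finally have 1: "measure_pmf.prob (initial_pmf V p q) {\<zeta>. \<forall>b\<in>B0. Q0 b \<zeta>} \<le> e ^ card B0" by simp
  have disjI: "k = l" if "i \<in> I k" "i \<in> I l" "k \<noteq> 0" "l \<noteq> 0" for i k l
  proof -
    have *: "i div M = k - 1" if "i \<in> I k" "k \<noteq> 0" for k
      by (rule div_nat_eqI) (use that in \<open>auto simp: I_def mult.commute\<close>)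
    from *[of k] *[of l] that show ?thesis by auto
  qed
  have "measure_pmf.prob (field_pmf V (M * K) r q) {a. \<forall>b\<in>B1. Q1 b a} =
     (\<Prod>b\<in>B1. measure_pmf.prob (Pi_pmf (I (snd b) \<times> {fst b}) None (\<lambda>_. symbol_pmf r q)) {a. Q1 b a})"
    unfolding field_pmf_def
  proof (rule prob_Pi_pmf_disjoint_blocks)
    show "I (snd b) \<times> {fst b} \<subseteq> {..<M * K} \<times> V" if "b \<in> B1" for b
    proof -
      have "M * snd b \<le> M * K" using that B by (auto simp: B1_def)
      then have "I (snd b) \<subseteq> {..<M * K}" by (auto simp: I_def intro: less_le_trans[of _ "M * snd b"])
      then show ?thesis using that B by (auto simp: B1_def)
    qed
    show "disjoint_family_on (\<lambda>b. I (snd b) \<times> {fst b}) B1"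
      unfolding disjoint_family_on_def using disjI by (fastforce simp: B1_def)
    show "Q1 b f = Q1 b g" if "b \<in> B1" "\<And>y. y \<in> I (snd b) \<times> {fst b} \<Longrightarrow> f y = g y" for b f g
      unfolding Q1_def using that(2) by auto
  qed (use fin assms(1) in auto)
  also have "\<dots> \<le> (\<Prod>b\<in>B1. e)"
  proof (rule prod_mono, safe)
    fix x k assume "(x, k) \<in> B1"
    then have "card (I k) = M" by (cases k) (auto simp: I_def B1_def)
    then show "measure_pmf.prob (Pi_pmf (I (snd (x, k)) \<times> {fst (x, k)}) None (\<lambda>_. symbol_pmf r q)) {a. Q1 (x, k) a} \<le> e"
      using prob_bad_symbols[OF par(1,3), of "I k" x] e(2) unfolding Q1_def by (simp add: I_def)
  qed auto
  finally have 2: "measure_pmf.prob (field_pmf V (M * K) r q) {a. \<forall>b\<in>B1. Q1 b a} \<le> e ^ card B1" by simp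
  show ?thesis unfolding ev measure_pair_pmf_times cB power_add
    by (rule mult_mono[OF 1 2]) (use e0 in auto)
qed

text \<open>A defect at \<open>(x, k)\<close> is caused by badness in block \<open>k\<close> or in block \<open>k - 1\<close>.\<close>

definition with_past :: "('v \<times> nat) set \<Rightarrow> ('v \<times> nat) set" where
  "with_past T = T \<union> (\<lambda>(x, k). (x, k - 1)) ` T"

lemma card_with_past: "finite T \<Longrightarrow> card (with_past T) \<le> 2 * card T"
  unfolding with_past_def
  using card_Un_le[of T "(\<lambda>(x, k). (x, k - 1)) ` T"] card_image_le[of T "\<lambda>(x, k). (x, k - 1)"] by linarith

context
  fixes E :: "'v set set" and j D R :: nat
  assumes nb: "\<And>x. finite (nbrs E x)" "\<And>x. card (nbrs E x) \<le> D"
    and R: "0 < R"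
    and walks: "dense_defect_walks E j R"
begin

text \<open>
  Each bad site-block accounts for at most two defects, so \<open>n\<close> bad site-blocks allow a walk of
  length at most \<open>2 * R * n\<close>. The walk is padded to this length in order that \<open>n\<close> determines it.
\<close>

lemma disagreement_bad_walk:
  assumes xs: "xs \<noteq> []" "distinct xs" "0 < M"
    and out: "\<And>x. x \<notin> set xs \<Longrightarrow> \<xi> x \<and> \<xi>' x"
    and dis: "trajectory E j (sweep xs) a \<xi> (length xs * M * K) x \<noteq>
              trajectory E j (sweep xs) a \<xi>' (length xs * M * K) x"
  shows "\<exists>n w B. 1 \<le> n \<and> K \<le> 2 * R * n \<and> n \<le> card (set xs \<times> {..K}) \<and>
     walk (spacetime_nbrs E) w \<and> hd w = (x, K) \<and> length w = 2 * R * n \<and>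
     B \<subseteq> with_past (set w) \<inter> (set xs \<times> {..K}) \<and> card B = n \<and>
     (\<forall>(y, k)\<in>B. bad_block M a \<xi> \<xi>' y k)"
proof -
  note nbf = nb(1)
  let ?Z = "zero_blocks E j xs M a K \<xi> \<xi>'" and ?F = "defect_blocks xs M a K \<xi> \<xi>'"
  have fz: "facilitated_zeros E j ?Z ?F"
    by (rule facilitated_zero_set) (use nbf xs out in auto)
  have "(x, K) \<in> ?Z \<and> (\<exists>y. (zero_step E ?Z)\<^sup>*\<^sup>* (x, K) (y, 0))"
    by (rule disagreement_path[OF _ _ _ _ _ dis]) (use nbf xs out in auto)
  then obtain y where "(x, K) \<in> ?Z" "(zero_step E ?Z)\<^sup>*\<^sup>* (x, K) (y, 0)" by blast
  from walks[unfolded dense_defect_walks_def, rule_format, OF fz this] obtain w where w: "walk (spacetime_nbrs E) w" "hd w = (x, K)"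
    "length w \<le> R * card (?F \<inter> set w)" "K \<le> R * card (?F \<inter> set w)" by blast
  define B where "B = {(y, k) \<in> with_past (set w) \<inter> (set xs \<times> {..K}). bad_block M a \<xi> \<xi>' y k}"
  have finB: "finite B" unfolding B_def by (rule finite_subset[of _ "set xs \<times> {..K}"]) auto
  have sub: "?F \<inter> set w \<subseteq> B \<union> (\<lambda>(y, k). (y, Suc k)) ` B"
  proof safe
    fix y k assume F: "(y, k) \<in> ?F" and yw: "(y, k) \<in> set w"
      and n: "(y, k) \<notin> (\<lambda>(y, k). (y, Suc k)) ` B"
    have yk: "y \<in> set xs" "k \<le> K" using F by (auto simp: defect_blocks_def)
    show "(y, k) \<in> B"
    proof (cases "bad_block M a \<xi> \<xi>' y k")
      case True
      then show ?thesis using yw yk by (auto simp: B_def with_past_def)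
    next
      case False
      then obtain l where l: "k = Suc l" "bad_block M a \<xi> \<xi>' y l"
        using F by (cases k) (auto simp: defect_blocks_def)
      have "(y, l) \<in> with_past (set w)" unfolding with_past_def using yw l by force
      then have "(y, l) \<in> B" using l yk by (auto simp: B_def)
      then have "(y, k) \<in> (\<lambda>(y, k). (y, Suc k)) ` B" using l by force
      with n show ?thesis by blast
    qed
  qed
  define n where "n = card B"
  have "card (?F \<inter> set w) \<le> card (B \<union> (\<lambda>(y, k). (y, Suc k)) ` B)"
    by (rule card_mono) (use sub finB in auto)
  also have "\<dots> \<le> n + n"
    unfolding n_def using card_Un_le[of B "(\<lambda>(y, k). (y, Suc k)) ` B"] card_image_le[OF finB, of "\<lambda>(y, k). (y, Suc k)"]
    by linarith
  finally have c: "R * card (?F \<inter> set w) \<le> 2 * R * n" by simp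
  have lw: "0 < length w" using w(1) by (simp add: walk_def)
  then have n1: "1 \<le> n" using w(3) c by (cases n) auto
  from walk_pad[OF w(1) spacetime_nbrs_refl, of "2 * R * n"] w(3) c obtain w' where
    w': "walk (spacetime_nbrs E) w'" "hd w' = hd w" "set w \<subseteq> set w'" "length w' = 2 * R * n" by auto
  have "B \<subseteq> with_past (set w') \<inter> (set xs \<times> {..K})"
    using w'(3) by (auto simp: B_def with_past_def)
  moreover have "n \<le> card (set xs \<times> {..K})"
    unfolding n_def by (rule card_mono) (auto simp: B_def)
  moreover have "\<forall>(y, k)\<in>B. bad_block M a \<xi> \<xi>' y k" by (auto simp: B_def)
  moreover have "K \<le> 2 * R * n" using w(4) c by (rule order_trans)
  ultimately show ?thesis using n1 w' w(2)
    by (intro exI[of _ n] exI[of _ w'] exI[of _ B]) (auto simp: n_def)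
qed

text \<open>
  For given \<open>n\<close> there are at most \<open>(D + 3) ^ (2 * R * n)\<close> walks, each with at most
  \<open>2 ^ (4 * R * n)\<close> sets \<open>B\<close> of bad site-blocks, and each set has probability at most \<open>e ^ n\<close>. By
  the assumption on \<open>e\<close> the product is at most \<open>4 ^ (- n)\<close>; half of the decay is kept for
  the bound in \<open>K \<le> 2 * R * n\<close> and the other half makes the sum over \<open>n\<close> converge.
\<close>

lemma prob_disagreement_le:
  fixes K :: nat and p q r e :: real
  assumes xs: "xs \<noteq> []" "distinct xs" "0 < M"
    and par: "r \<in> {0..1}" "p \<in> {0..1}" "q \<in> {0..1}"
    and e: "(1 - p) + (1 - q) \<le> e" "(1 - r) ^ M + M * (r * (1 - q)) \<le> e"
    and small: "(4 * (real D + 3)) ^ (2 * R) * e \<le> 1 / 4"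
  shows "measure_pmf.prob (pair_pmf (initial_pmf (set xs) p q) (field_pmf (set xs) (M * K) r q))
     {(\<zeta>, a). trajectory E j (sweep xs) a (fst \<circ> \<zeta>) (length xs * M * K) x \<noteq>
              trajectory E j (sweep xs) a (snd \<circ> \<zeta>) (length xs * M * K) x}
     \<le> (1 / 2) powr (K / (2 * R))"
proof -
  let ?P = "pair_pmf (initial_pmf (set xs) p q) (field_pmf (set xs) (M * K) r q)"
  let ?pr = "measure_pmf.prob ?P"
  let ?V = "set xs"
  define N where "N = {n. 1 \<le> n \<and> K \<le> 2 * R * n \<and> n \<le> card (?V \<times> {..K})}"
  define W where "W n = {w. walk (spacetime_nbrs E) w \<and> hd w = (x, K) \<and> length w = 2 * R * n}" for n
  define BB where "BB n w = {B. B \<subseteq> with_past (set w) \<inter> (?V \<times> {..K}) \<and> card B = n}" for n w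
  define Ev where "Ev B = {(\<zeta>, a). \<forall>(y, k)\<in>B. bad_block M a (fst \<circ> \<zeta>) (snd \<circ> \<zeta>) y k}"
    for B :: "('v \<times> nat) set"
  have finN: "finite N" unfolding N_def by (rule finite_subset[of _ "{..card (?V \<times> {..K})}"]) auto
  have e0: "0 \<le> e" using e(1) par by auto
  have W: "finite (W n) \<and> real (card (W n)) \<le> (real D + 3) ^ (2 * R * n)" if "n \<in> N" for n
  proof -
    have Suc: "2 * R * n = Suc (2 * R * n - 1)" using that R by (simp add: N_def)
    have "finite (W n) \<and> card (W n) \<le> (D + 3) ^ (2 * R * n - 1)"
      unfolding W_def by (subst (1 2) Suc) (rule card_walks, (rule card_spacetime_nbrs[OF nb])+)
    moreover have "(D + 3) ^ (2 * R * n - 1) \<le> (D + 3) ^ (2 * R * n)"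
      by (rule power_increasing) auto
    ultimately have "finite (W n)" "card (W n) \<le> (D + 3) ^ (2 * R * n)"
      by (blast, meson order_trans)
    moreover from this(2) have "real (card (W n)) \<le> real ((D + 3) ^ (2 * R * n))"
      by (rule of_nat_mono)
    ultimately show ?thesis by (simp add: add.commute)
  qed
  have BB: "finite (BB n w) \<and> real (card (BB n w)) \<le> 4 ^ (2 * R * n)" if "w \<in> W n" for n w
  proof -
    have f: "finite (with_past (set w))" by (auto simp: with_past_def)
    have "BB n w \<subseteq> Pow (with_past (set w))" by (auto simp: BB_def)
    then have "finite (BB n w)" "card (BB n w) \<le> 2 ^ card (with_past (set w))"
      using f finite_subset card_mono[of "Pow (with_past (set w))" "BB n w"] by (auto simp: card_Pow)
    moreover have "card (with_past (set w)) \<le> 2 * (2 * R * n)"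
      using card_with_past[of "set w"] card_length[of w] that by (simp add: W_def)
    then have "(2::nat) ^ card (with_past (set w)) \<le> 2 ^ (2 * (2 * R * n))"
      by (intro power_increasing) auto
    ultimately have "finite (BB n w)" "card (BB n w) \<le> 4 ^ (2 * R * n)"
      by (auto simp: power_mult)
    moreover from this(2) have "real (card (BB n w)) \<le> real (4 ^ (2 * R * n))"
      by (rule of_nat_mono)
    ultimately show ?thesis by simp
  qed
  have EvB: "?pr (Ev B) \<le> e ^ n" if "B \<in> BB n w" for B n w
    using prob_all_bad_le[OF _ _ xs(3) par e, of ?V B K] that by (auto simp: BB_def Ev_def)
  have supp: "?pr {(\<zeta>, a). trajectory E j (sweep xs) a (fst \<circ> \<zeta>) (length xs * M * K) x \<noteq>
              trajectory E j (sweep xs) a (snd \<circ> \<zeta>) (length xs * M * K) x}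
     \<le> ?pr (\<Union>n\<in>N. \<Union>w\<in>W n. \<Union>B\<in>BB n w. Ev B)"
  proof (rule measure_pmf.finite_measure_mono_AE)
    show "AE \<omega> in measure_pmf ?P. \<omega> \<in> {(\<zeta>, a). trajectory E j (sweep xs) a (fst \<circ> \<zeta>) (length xs * M * K) x \<noteq>
              trajectory E j (sweep xs) a (snd \<circ> \<zeta>) (length xs * M * K) x} \<longrightarrow>
          \<omega> \<in> (\<Union>n\<in>N. \<Union>w\<in>W n. \<Union>B\<in>BB n w. Ev B)"
    proof (rule AE_pmfI, rule impI)
      fix \<omega> assume \<omega>: "\<omega> \<in> set_pmf ?P" "\<omega> \<in> {(\<zeta>, a). trajectory E j (sweep xs) a (fst \<circ> \<zeta>) (length xs * M * K) x \<noteq>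
              trajectory E j (sweep xs) a (snd \<circ> \<zeta>) (length xs * M * K) x}"
      obtain \<zeta> a where za: "\<omega> = (\<zeta>, a)" by force
      from \<omega> have supp: "(\<zeta>, a) \<in> set_pmf ?P"
        and dis: "trajectory E j (sweep xs) a (fst \<circ> \<zeta>) (length xs * M * K) x \<noteq>
              trajectory E j (sweep xs) a (snd \<circ> \<zeta>) (length xs * M * K) x"
        by (auto simp: za)
      have "\<zeta> \<in> set_pmf (initial_pmf ?V p q)" using supp by auto
      then have "\<zeta> y = (True, True)" if "y \<notin> ?V" for y
        unfolding initial_pmf_def using set_Pi_pmf_subset[of ?V] that by fastforce
      then have out: "(fst \<circ> \<zeta>) y \<and> (snd \<circ> \<zeta>) y" if "y \<notin> ?V" for y using that by simp
      from disagreement_bad_walk[OF xs out dis] obtain n w B where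
        "1 \<le> n" "K \<le> 2 * R * n" "n \<le> card (set xs \<times> {..K})"
        "walk (spacetime_nbrs E) w" "hd w = (x, K)" "length w = 2 * R * n"
        "B \<subseteq> with_past (set w) \<inter> (set xs \<times> {..K})" "card B = n"
        "\<forall>(y, k)\<in>B. bad_block M a (fst \<circ> \<zeta>) (snd \<circ> \<zeta>) y k" by blast
      then have "n \<in> N" "w \<in> W n" "B \<in> BB n w" "(\<zeta>, a) \<in> Ev B"
        by (auto simp: N_def W_def BB_def Ev_def)
      then show "\<omega> \<in> (\<Union>n\<in>N. \<Union>w\<in>W n. \<Union>B\<in>BB n w. Ev B)" unfolding za by blast
    qed
  qed auto
  have one: "?pr (\<Union>B\<in>BB n w. Ev B) \<le> 4 ^ (2 * R * n) * e ^ n" if "w \<in> W n" for n w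
  proof -
    have "?pr (\<Union>B\<in>BB n w. Ev B) \<le> (\<Sum>B\<in>BB n w. ?pr (Ev B))"
      by (rule measure_pmf.finite_measure_subadditive_finite) (use BB that in auto)
    also have "\<dots> \<le> (\<Sum>B\<in>BB n w. e ^ n)" by (intro sum_mono EvB)
    also have "\<dots> \<le> 4 ^ (2 * R * n) * e ^ n"
      using BB[OF that] e0 by (auto intro: mult_right_mono)
    finally show ?thesis .
  qed
  have two: "?pr (\<Union>w\<in>W n. \<Union>B\<in>BB n w. Ev B) \<le> (1 / 2) ^ n * (1 / 2) powr (K / (2 * R))" if n: "n \<in> N" for n
  proof -
    have "?pr (\<Union>w\<in>W n. \<Union>B\<in>BB n w. Ev B) \<le> (\<Sum>w\<in>W n. ?pr (\<Union>B\<in>BB n w. Ev B))"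
      by (rule measure_pmf.finite_measure_subadditive_finite) (use W n in auto)
    also have "\<dots> \<le> (\<Sum>w\<in>W n. 4 ^ (2 * R * n) * e ^ n)" by (intro sum_mono one)
    also have "\<dots> \<le> (real D + 3) ^ (2 * R * n) * (4 ^ (2 * R * n) * e ^ n)"
      using W[OF n] e0 by (auto intro: mult_right_mono)
    also have "\<dots> = (4 * (real D + 3)) ^ (2 * R * n) * e ^ n"
      unfolding power_mult_distrib by (simp only: mult_ac)
    also have "\<dots> = ((4 * (real D + 3)) ^ (2 * R) * e) ^ n"
      by (simp only: power_mult_distrib power_mult[of _ "2 * R" n])
    also have "\<dots> \<le> (1 / 4) ^ n" by (rule power_mono[OF small]) (use e0 in auto)
    also have "\<dots> = (1 / 2) ^ n * (1 / 2) ^ n" by (simp flip: power_mult_distrib)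
    also have "\<dots> \<le> (1 / 2) ^ n * (1 / 2) powr (K / (2 * R))"
    proof (rule mult_left_mono)
      have "real K \<le> real (2 * R * n)" using n by (simp only: N_def mem_Collect_eq of_nat_le_iff)
      then have "real K / (2 * R) \<le> real n" using R by (simp add: field_simps)
      then have "(1 / 2 :: real) powr n \<le> (1 / 2) powr (K / (2 * R))" by (rule powr_mono') auto
      then show "(1 / 2 :: real) ^ n \<le> (1 / 2) powr (K / (2 * R))" by (simp add: powr_realpow)
    qed simp
    finally show ?thesis .
  qed
  have "?pr (\<Union>n\<in>N. \<Union>w\<in>W n. \<Union>B\<in>BB n w. Ev B) \<le> (\<Sum>n\<in>N. ?pr (\<Union>w\<in>W n. \<Union>B\<in>BB n w. Ev B))"
    by (rule measure_pmf.finite_measure_subadditive_finite) (use finN in auto)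
  also have "\<dots> \<le> (\<Sum>n\<in>N. (1 / 2) ^ n * (1 / 2) powr (K / (2 * R)))" by (intro sum_mono two)
  also have "\<dots> = (\<Sum>n\<in>N. (1 / 2) ^ n) * (1 / 2) powr (K / (2 * R))" by (simp add: sum_distrib_right)
  also have "\<dots> \<le> 1 * (1 / 2) powr (K / (2 * R))"
  proof (rule mult_right_mono)
    have "Suc (n - 1) = n" if "n \<in> N" for n using that by (simp add: N_def)
    then have "(\<Sum>n\<in>N. (1 / 2 :: real) ^ n) = (\<Sum>n\<in>N. (1 / 2) ^ Suc (n - 1))"
      by (intro sum.cong refl) (simp del: power_Suc)
    also have "\<dots> = (\<Sum>n\<in>(\<lambda>n. n - 1) ` N. (1 / 2) ^ Suc n)"
      by (subst sum.reindex) (auto simp: N_def inj_on_def simp del: power_Suc)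
    also have "\<dots> \<le> (\<Sum>n. (1 / 2 :: real) ^ Suc n)"
      by (rule sum_le_suminf) (use finN in \<open>auto intro: summable_mult summable_geometric\<close>)
    also have "\<dots> = 1" using power_half_series by (simp add: sums_iff)
    finally show "(\<Sum>n\<in>N. (1 / 2 :: real) ^ n) \<le> 1" .
  qed simp
  finally show ?thesis using supp by simp
qed

end

text \<open>
  By stationarity both expectations are expectations over the coupling, and \<open>f\<close> distinguishes the
  copies only if they disagree somewhere on \<open>S\<close>. The bound depends neither on the volume nor
  on the number \<open>M\<close> of cells in a block.
\<close>

lemma discrete_convergence:
  fixes f :: "'v config \<Rightarrow> real" and p q r e C :: real
  assumes E: "simple_graph E"
    and nb: "\<And>x. finite (nbrs E x)" "\<And>x. card (nbrs E x) \<le> D"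
    and R: "0 < R"
    and walks: "dense_defect_walks E j R"
    and xs: "xs \<noteq> []" "distinct xs" "0 < M"
    and par: "r \<in> {0..1}" "p \<in> {0..1}" "q \<in> {0..1}"
    and e: "(1 - p) + (1 - q) \<le> e" "(1 - r) ^ M + M * (r * (1 - q)) \<le> e"
    and small: "(4 * (real D + 3)) ^ (2 * R) * e \<le> 1 / 4"
    and S: "finite S" "\<And>\<eta> \<eta>'. (\<And>x. x \<in> S \<Longrightarrow> \<eta> x = \<eta>' x) \<Longrightarrow> f \<eta> = f \<eta>'"
    and C: "\<And>\<eta>. \<bar>f \<eta>\<bar> \<le> C"
  shows "\<bar>measure_pmf.expectation (pair_pmf (product_pmf (set xs) p) (field_pmf (set xs) (M * K) r q))
            (\<lambda>(\<xi>, a). f (trajectory E j (sweep xs) a \<xi> (length xs * M * K)))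
          - measure_pmf.expectation (product_pmf (set xs) q) f\<bar>
         \<le> 2 * C * card S * (1 / 2) powr (K / (2 * R))"
proof -
  define I where "I = initial_pmf (set xs) p q"
  define F where "F = field_pmf (set xs) (M * K) r q"
  define P where "P = pair_pmf I F"
  define T where "T a \<xi> = trajectory E j (sweep xs) a \<xi> (length xs * M * K)" for a \<xi>
  have I: "map_pmf (\<lambda>\<zeta>. fst \<circ> \<zeta>) I = product_pmf (set xs) p" "map_pmf (\<lambda>\<zeta>. snd \<circ> \<zeta>) I = product_pmf (set xs) q"
    unfolding I_def initial_pmf_def
    by (subst Pi_pmf_map[symmetric]; simp add: map_fst_pair_pmf map_snd_pair_pmf)+
  have int: "integrable (measure_pmf Q) (\<lambda>\<omega>. f (g \<omega>))" for g :: "'z \<Rightarrow> 'v config" and Q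
    by (rule measure_pmf.integrable_const_bound[of _ C]) (use C in auto)
  have p: "measure_pmf.expectation (pair_pmf (product_pmf (set xs) p) F) (\<lambda>(\<xi>, a). f (T a \<xi>))
      = measure_pmf.expectation P (\<lambda>(\<zeta>, a). f (T a (fst \<circ> \<zeta>)))"
  proof -
    have "pair_pmf (product_pmf (set xs) p) F = map_pmf (apfst (\<lambda>\<zeta>. fst \<circ> \<zeta>)) P"
      unfolding P_def I(1)[symmetric] by (rule pair_map_pmf1)
    then show ?thesis by (simp add: case_prod_unfold)
  qed
  have q: "measure_pmf.expectation (product_pmf (set xs) q) f
      = measure_pmf.expectation P (\<lambda>(\<zeta>, a). f (T a (snd \<circ> \<zeta>)))"
  proof -
    have range: "sweep xs ` {..<length xs * M * K} \<subseteq> {..<M * K} \<times> set xs"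
    proof (rule image_subsetI)
      fix m assume "m \<in> {..<length xs * M * K}"
      then show "sweep xs m \<in> {..<M * K} \<times> set xs"
        by (intro sweep_range xs) (simp add: mult.assoc)
    qed
    have "product_pmf (set xs) q = bind_pmf (product_pmf (set xs) q) (\<lambda>\<xi>. map_pmf (\<lambda>a. T a \<xi>) F)"
      unfolding T_def F_def field_pmf_def
      by (rule trajectory_stationary[symmetric, OF E _ _ sweep_inj[OF xs(1,2)] _ range])
        (use xs(1) in \<open>auto simp: sweep_def\<close>)
    also have "\<dots> = map_pmf (\<lambda>(\<xi>, a). T a \<xi>) (pair_pmf (product_pmf (set xs) q) F)"
      by (simp add: pair_pmf_def map_pmf_def bind_assoc_pmf bind_return_pmf)
    also have "pair_pmf (product_pmf (set xs) q) F = map_pmf (apfst (\<lambda>\<zeta>. snd \<circ> \<zeta>)) P"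
      unfolding P_def I(2)[symmetric] by (rule pair_map_pmf1)
    finally have eq: "product_pmf (set xs) q = map_pmf (\<lambda>(\<zeta>, a). T a (snd \<circ> \<zeta>)) P"
      by (simp add: map_pmf_comp case_prod_unfold)
    show ?thesis by (subst eq) (simp add: case_prod_unfold)
  qed
  let ?dis = "\<lambda>x. {(\<zeta>, a). T a (fst \<circ> \<zeta>) x \<noteq> T a (snd \<circ> \<zeta>) x}"
  have C0: "0 \<le> C" using C[of undefined] by linarith
  have "\<bar>measure_pmf.expectation P (\<lambda>(\<zeta>, a). f (T a (fst \<circ> \<zeta>))) - measure_pmf.expectation P (\<lambda>(\<zeta>, a). f (T a (snd \<circ> \<zeta>)))\<bar>
     = \<bar>measure_pmf.expectation P (\<lambda>(\<zeta>, a). f (T a (fst \<circ> \<zeta>)) - f (T a (snd \<circ> \<zeta>)))\<bar>"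
    unfolding case_prod_beta by (subst Bochner_Integration.integral_diff) (use int in auto)
  also have "\<dots> \<le> measure_pmf.expectation P (\<lambda>\<omega>. \<bar>case \<omega> of (\<zeta>, a) \<Rightarrow> f (T a (fst \<circ> \<zeta>)) - f (T a (snd \<circ> \<zeta>))\<bar>)"
    by (rule integral_abs_bound)
  also have "\<dots> \<le> measure_pmf.expectation P (\<lambda>\<omega>. 2 * C * indicator (\<Union>x\<in>S. ?dis x) \<omega>)"
  proof (rule integral_mono)
    show "integrable (measure_pmf P) (\<lambda>\<omega>. \<bar>case \<omega> of (\<zeta>, a) \<Rightarrow> f (T a (fst \<circ> \<zeta>)) - f (T a (snd \<circ> \<zeta>))\<bar>)"
      unfolding case_prod_beta by (intro integrable_abs Bochner_Integration.integrable_diff int)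
  next
    fix \<omega> :: "('v \<Rightarrow> bool \<times> bool) \<times> (nat \<times> 'v \<Rightarrow> bool option)"
    obtain \<zeta> a where \<omega>: "\<omega> = (\<zeta>, a)" by force
    show "\<bar>case \<omega> of (\<zeta>, a) \<Rightarrow> f (T a (fst \<circ> \<zeta>)) - f (T a (snd \<circ> \<zeta>))\<bar> \<le> 2 * C * indicator (\<Union>x\<in>S. ?dis x) \<omega>"
    proof (cases "\<forall>x\<in>S. T a (fst \<circ> \<zeta>) x = T a (snd \<circ> \<zeta>) x")
      case True
      then have "f (T a (fst \<circ> \<zeta>)) = f (T a (snd \<circ> \<zeta>))" by (intro S(2)) auto
      then show ?thesis using C0 by (simp add: \<omega>)
    next
      case False
      then have "\<omega> \<in> (\<Union>x\<in>S. ?dis x)" by (auto simp: \<omega>)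
      moreover have "\<bar>f (T a (fst \<circ> \<zeta>)) - f (T a (snd \<circ> \<zeta>))\<bar> \<le> 2 * C"
        using C[of "T a (fst \<circ> \<zeta>)"] C[of "T a (snd \<circ> \<zeta>)"] by linarith
      ultimately show ?thesis by (simp add: \<omega>)
    qed
  next
    show "integrable (measure_pmf P) (\<lambda>\<omega>. 2 * C * indicator (\<Union>x\<in>S. ?dis x) \<omega>)"
      by (intro integrable_mult_right measure_pmf.integrable_const_bound[of _ 1]) auto
  qed
  also have "\<dots> = 2 * C * measure_pmf.prob P (\<Union>x\<in>S. ?dis x)" by simp
  also have "\<dots> \<le> 2 * C * (\<Sum>x\<in>S. measure_pmf.prob P (?dis x))"
    by (intro mult_left_mono measure_pmf.finite_measure_subadditive_finite) (use S C0 in auto)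
  also have "\<dots> \<le> 2 * C * (\<Sum>x\<in>S. (1 / 2) powr (K / (2 * R)))"
  proof (intro mult_left_mono sum_mono)
    show "measure_pmf.prob P (?dis x) \<le> (1 / 2) powr (K / (2 * R))" for x
      unfolding P_def I_def F_def T_def
      by (rule prob_disagreement_le[OF nb R walks xs par e small])
  qed (use C0 in auto)
  finally show ?thesis unfolding p[unfolded F_def T_def, symmetric] q[symmetric]
    using p q unfolding F_def T_def by simp
qed

section \<open>Paths driven by fixed clocks and marks\<close>

lemma tendsto_coordinate:
  fixes h :: "'b \<Rightarrow> 'v config"
  assumes "(h \<longlongrightarrow> l) F" shows "((\<lambda>t. h t x) \<longlongrightarrow> l x) F"
proof (rule topological_tendstoI)
  fix A :: "bool set" assume A: "open A" "l x \<in> A"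
  have "open ((\<lambda>f :: 'v config. f x) -` A)"
    by (rule open_vimage[OF A(1)]) (rule continuous_on_product_coordinates)
  from topological_tendstoD[OF assms this] A(2)
  show "eventually (\<lambda>t. h t x \<in> A) F" by simp
qed

lemma left_limit_eqI:
  fixes h :: "real \<Rightarrow> 'v config"
  assumes "eventually (\<lambda>s. h s x = b) (at_left t)"
  shows "left_limit h t x = b"
  unfolding left_limit_def
  by (rule tendsto_Lim) (use assms in \<open>auto intro: tendsto_eventually\<close>)

lemma continuous_bool_constant:
  fixes g :: "real \<Rightarrow> bool"
  assumes "continuous_on {a..b} g" "u \<in> {a..b}"
  shows "g u = g a"
proof -
  obtain c where "\<forall>s\<in>{a..b}. g s = c"
    using connectedD_const[OF connected_Icc assms(1)] by blast
  then show ?thesis using assms(2) by auto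
qed

lemma nth_point_card:
  assumes S: "S \<subseteq> {0..}" "\<And>b. finite (S \<inter> {..b})" and r: "r \<in> S"
  shows "nth_point S (card {s \<in> S. s < r}) = r"
  unfolding nth_point_def
proof (rule the_equality)
  have fin: "finite {s \<in> S. s < t}" for t
    by (rule finite_subset[OF _ S(2)[of t]]) auto
  have less: "card {s \<in> S. s < t} < card {s \<in> S. s < t'}" if "t \<in> S" "t < t'" for t t'
    by (rule psubset_card_mono[OF fin]) (use that in auto)
  fix t assume t: "t \<in> S \<and> card {s \<in> S. s < t} = card {s \<in> S. s < r}"
  show "t = r"
    using less[of t r] less[of r t] t r by (cases t r rule: linorder_cases) auto
qed (use r in auto)

text \<open>One realisation of the model: a path that obeys the update rule for given clocks and marks.\<close>

locale driven_path =
  fixes E :: "'v set set" and j :: nat and q :: real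
    and P :: "'v \<Rightarrow> real set" and U :: "'v \<Rightarrow> real \<Rightarrow> real" and h :: "real \<Rightarrow> 'v config"
  assumes E: "simple_graph E" and nbf: "\<And>x. finite (nbrs E x)"
    and P_pos: "\<And>x. P x \<subseteq> {0..}" and P_fin: "\<And>x b. finite (P x \<inter> {..b})"
    and cad: "cadlag h"
    and dyn: "\<And>x t. 0 < t \<Longrightarrow> h t x =
        (if t \<in> P x \<and> j \<le> num_ones E (left_limit h t) x then U x t \<le> q else left_limit h t x)"
begin

text \<open>
  Without a ring the spin equals its left limit, so it is a continuous function of time with values
  in a discrete space.
\<close>

lemma no_ring_constant:
  assumes "0 \<le> a" "P x \<inter> {a<..b} = {}" "u \<in> {a..b}"
  shows "h u x = h a x"
proof -
  have left: "((\<lambda>t. h t x) \<longlongrightarrow> h t x) (at_left t)" if t: "a < t" "t \<le> b" for t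
  proof -
    have "0 < t" using assms t by simp
    then obtain l where l: "(h \<longlongrightarrow> l) (at_left t)" using cad by (auto simp: cadlag_def)
    then have lx: "((\<lambda>t. h t x) \<longlongrightarrow> l x) (at_left t)" by (rule tendsto_coordinate)
    then have "left_limit h t x = l x"
      unfolding left_limit_def by (intro tendsto_Lim) auto
    moreover have "t \<notin> P x" using assms(2) t by auto
    ultimately show ?thesis using dyn[OF \<open>0 < t\<close>, of x] lx by simp
  qed
  have right: "((\<lambda>t. h t x) \<longlongrightarrow> h t x) (at_right t)" if t: "a \<le> t" for t
  proof -
    have "(h \<longlongrightarrow> h t) (at_right t)" using cad t assms(1) by (simp add: cadlag_def)
    then show ?thesis by (rule tendsto_coordinate)
  qed
  have "continuous_on {a..b} (\<lambda>t. h t x)" if ab: "a < b"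
    unfolding continuous_on_def
  proof
    fix t assume t: "t \<in> {a..b}"
    show "((\<lambda>t. h t x) \<longlongrightarrow> h t x) (at t within {a..b})"
    proof (cases "t = a")
      case True
      then show ?thesis using right[of a] at_within_Icc_at_right[OF ab] by simp
    next
      case False
      then have "((\<lambda>t. h t x) \<longlongrightarrow> h t x) (at t)"
        by (intro filterlim_split_at left right) (use t False in auto)
      then show ?thesis by (rule tendsto_within_subset) auto
    qed
  qed
  then have "h u x = h a x" if "a < b"
    using continuous_bool_constant[OF _ assms(3), of "\<lambda>t. h t x"] that by blast
  moreover have "u = a" if "\<not> a < b" using that assms(3) by simp
  ultimately show ?thesis by blast
qed

text \<open>
  As no neighbour rings in the interval, the left limit at the ring agrees with the configuration at
  the beginning of the interval.
\<close>

lemma ring_update: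
  assumes ab: "0 \<le> a" "P x \<inter> {a<..b} = {r}" "\<And>y. y \<in> nbrs E x \<Longrightarrow> P y \<inter> {a<..b} = {}"
  shows "h b x = (if j \<le> num_ones E (h a) x then U x r \<le> q else h a x)"
proof -
  have r: "a < r" "r \<le> b" "r \<in> P x" using ab(2) by auto
  have ev: "eventually (\<lambda>s. a < s \<and> s < r) (at_left r)"
    using eventually_at_left_real[OF r(1)] by simp
  have nx: "left_limit h r y = h a y" if y: "y \<in> nbrs E x" for y
  proof (rule left_limit_eqI, rule eventually_mono[OF ev])
    fix s assume "a < s \<and> s < r"
    then show "h s y = h a y" using no_ring_constant[OF ab(1) ab(3)[OF y], of s] r by auto
  qed
  have x: "left_limit h r x = h a x"
  proof (rule left_limit_eqI, rule eventually_mono[OF ev])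
    fix s assume s: "a < s \<and> s < r"
    have "v = r" if "v \<in> P x \<inter> {a<..s}" for v
    proof -
      have "v \<in> P x \<inter> {a<..b}" using that r s by auto
      then show ?thesis by (simp only: ab(2) singleton_iff)
    qed
    then have "P x \<inter> {a<..s} = {}" using s by force
    then show "h s x = h a x" using no_ring_constant[OF ab(1), of x s s] s by auto
  qed
  have "num_ones E (left_limit h r) x = num_ones E (h a) x"
    unfolding num_ones_def by (rule sum.cong) (use nx in auto)
  then have "h r x = (if j \<le> num_ones E (h a) x then U x r \<le> q else h a x)"
    using dyn[of r x] r ab(1) x by auto
  moreover have "P x \<inter> {r<..b} = {}"
  proof (rule ccontr)
    assume "P x \<inter> {r<..b} \<noteq> {}"
    then obtain v where "v \<in> P x" "r < v" "v \<le> b" by auto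
    then have "v \<in> P x \<inter> {a<..b}" using r by auto
    then show False using ab(2) \<open>r < v\<close> by auto
  qed
  then have "h b x = h r x"
    using no_ring_constant[of r x b b] r ab(1) by auto
  ultimately show ?thesis by simp
qed

end

definition cell :: "real \<Rightarrow> nat \<Rightarrow> real set" where
  "cell d i = {d * real i<..d * real (Suc i)}"

text \<open>
  The marks are numbered by the rings of a clock, starting from \<open>0\<close>. Hence the first ring in cell
  \<open>i\<close> carries the number of points up to the beginning of the cell.
\<close>

definition cell_symbol ::
  "real \<Rightarrow> real \<Rightarrow> ('v \<Rightarrow> real set) \<Rightarrow> ('v \<times> nat \<Rightarrow> real) \<Rightarrow> nat \<times> 'v \<Rightarrow> bool option" where
  "cell_symbol q d c m = (\<lambda>(i, x). if card (c x \<inter> cell d i) = 0 then None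
      else Some (m (x, card (c x \<inter> {0..d * real i})) \<le> q))"

definition separated :: "'v set \<Rightarrow> real \<Rightarrow> nat \<Rightarrow> ('v \<Rightarrow> real set) \<Rightarrow> bool" where
  "separated V d N c \<longleftrightarrow> (\<forall>i<N. (\<forall>x\<in>V. card (c x \<inter> cell d i) \<le> 1) \<and>
     (\<forall>x\<in>V. \<forall>y\<in>V. x \<noteq> y \<longrightarrow> card (c x \<inter> cell d i) = 0 \<or> card (c y \<inter> cell d i) = 0))"

lemma separated_le_one: "separated V d N c \<Longrightarrow> i < N \<Longrightarrow> x \<in> V \<Longrightarrow> card (c x \<inter> cell d i) \<le> 1"
  by (simp add: separated_def)

lemma separated_unique:
  "separated V d N c \<Longrightarrow> i < N \<Longrightarrow> x \<in> V \<Longrightarrow> y \<in> V \<Longrightarrow> x \<noteq> y \<Longrightarrow>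
     card (c x \<inter> cell d i) = 0 \<or> card (c y \<inter> cell d i) = 0"
  by (simp add: separated_def)

text \<open>If at most one site rings in a cell, the order of the updates in the sweep is irrelevant.\<close>

lemma trajectory_sweep_idle:
  assumes xs: "distinct xs" "xs \<noteq> []"
    and idle: "\<And>x. x \<in> set xs \<Longrightarrow> x \<noteq> y \<Longrightarrow> a (i, x) = None"
    and y: "y \<in> set xs"
  shows "trajectory E j (sweep xs) a \<xi> (length xs * Suc i) =
    site_update E j y (a (i, y)) (trajectory E j (sweep xs) a \<xi> (length xs * i))"
proof -
  let ?T = "trajectory E j (sweep xs) a \<xi>" and ?n = "length xs * i"
  obtain c where c: "c < length xs" "xs ! c = y" using y by (metis in_set_conv_nth)
  have "?T (?n + l) = (if l \<le> c then ?T ?n else site_update E j y (a (i, y)) (?T ?n))"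
    if "l \<le> length xs" for l
    using that
  proof (induction l)
    case (Suc l)
    then have l: "l < length xs" by simp
    have "(?n + l) div length xs = i" by (rule div_nat_eqI) (use l in auto)
    then have sw: "sweep xs (?n + l) = (i, xs ! l)" using l by (simp add: sweep_def)
    show ?case
    proof (cases "l = c")
      case True
      then show ?thesis using Suc sw c by simp
    next
      case False
      then have "xs ! l \<noteq> y" using c l xs(1) nth_eq_iff_index_eq by metis
      then have "a (i, xs ! l) = None" using idle l by simp
      then have "?T (Suc (?n + l)) = ?T (?n + l)" using sw by (simp add: site_update_def)
      then show ?thesis using Suc False by auto
    qed
  qed simp
  from this[of "length xs"] c show ?thesis by (simp add: add.commute)
qed

text \<open>
  During a block of length \<open>s\<close> the spin at \<open>x\<close> depends on that of a neighbour only if \<open>x\<close> rings. The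
  vertices reachable by these steps contain everything that can influence \<open>x\<close> in this block.
\<close>

definition ring_step :: "'v set set \<Rightarrow> ('v \<Rightarrow> real set) \<Rightarrow> real \<Rightarrow> nat \<Rightarrow> 'v \<Rightarrow> 'v \<Rightarrow> bool" where
  "ring_step E c s b x y \<longleftrightarrow> c x \<inter> cell s b \<noteq> {} \<and> y \<in> nbrs E x"

lemma cell_subset:
  assumes "i \<in> {m * b..<m * Suc b}" "0 < m" "0 < s"
  shows "cell (s / real m) i \<subseteq> cell s b"
proof
  fix u assume u: "u \<in> cell (s / real m) i"
  have "real (m * b) \<le> real i" "real (Suc i) \<le> real (m * Suc b)"
    using assms(1) by (simp_all only: of_nat_le_iff atLeastLessThan_iff Suc_le_eq)
  then have "s / real m * real (m * b) \<le> s / real m * real i"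
    "s / real m * real (Suc i) \<le> s / real m * real (m * Suc b)"
    using assms(2,3) by (intro mult_left_mono; simp)+
  moreover have "s / real m * real (m * b) = s * real b" "s / real m * real (m * Suc b) = s * real (Suc b)"
    using assms(2) by (simp_all add: field_simps)
  ultimately show "u \<in> cell s b" using u by (auto simp: cell_def)
qed

context driven_path
begin

text \<open>
  On a set \<open>C\<close> that contains the neighbours of its ringing vertices, agreement of the path with the
  discrete trajectory is passed on from the beginning to the end of a cell.
\<close>

lemma cell_trajectory_step:
  fixes d :: real
  defines "a \<equiv> cell_symbol q d P (\<lambda>(x, n). U x (nth_point (P x) n))"
  assumes xs: "distinct xs" and d: "0 < d" and sep: "separated (set xs) d N P" "i < N"
    and C: "C \<subseteq> set xs" "\<And>x y. x \<in> C \<Longrightarrow> P x \<inter> cell d i \<noteq> {} \<Longrightarrow> y \<in> nbrs E x \<Longrightarrow> y \<in> C"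
    and eq: "\<And>x. x \<in> C \<Longrightarrow> h (d * real i) x = trajectory E j (sweep xs) a \<xi> (length xs * i) x"
    and x: "x \<in> C"
  shows "h (d * real (Suc i)) x = trajectory E j (sweep xs) a \<xi> (length xs * Suc i) x"
proof -
  let ?T = "trajectory E j (sweep xs) a \<xi>"
  have xs0: "xs \<noteq> []" using C(1) x by auto
  have fin: "finite (P z \<inter> cell d i)" for z
    by (rule finite_subset[OF _ P_fin[of z "d * real (Suc i)"]]) (auto simp: cell_def)
  have di: "0 \<le> d * real i" using d by simp
  have none: "a (i, z) = None" if "P z \<inter> cell d i = {}" for z
    using that by (simp add: a_def cell_symbol_def)
  have idle: "P z \<inter> cell d i = {}" if "z \<in> set xs" "y \<in> set xs" "z \<noteq> y" "P y \<inter> cell d i \<noteq> {}" for y z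
  proof -
    have "card (P y \<inter> cell d i) \<noteq> 0" using that fin by simp
    moreover have "card (P z \<inter> cell d i) = 0 \<or> card (P y \<inter> cell d i) = 0"
      by (rule separated_unique[OF sep that(1-3)])
    ultimately have "card (P z \<inter> cell d i) = 0" by simp
    then show ?thesis using fin by simp
  qed
  obtain y where y: "y \<in> set xs" "\<And>z. z \<in> set xs \<Longrightarrow> z \<noteq> y \<Longrightarrow> P z \<inter> cell d i = {}"
  proof (cases "\<exists>y\<in>set xs. P y \<inter> cell d i \<noteq> {}")
    case True
    then show ?thesis using that idle by blast
  next
    case False
    then show ?thesis using that[of x] x C(1) by auto
  qed
  have step: "?T (length xs * Suc i) = site_update E j y (a (i, y)) (?T (length xs * i))"
    by (rule trajectory_sweep_idle[OF xs xs0 _ y(1)]) (use y none in auto)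
  show ?thesis
  proof (cases "P x \<inter> cell d i = {}")
    case True
    have "?T (length xs * Suc i) x = ?T (length xs * i) x"
    proof (cases "x = y")
      case True
      then show ?thesis unfolding step using none[OF \<open>P x \<inter> cell d i = {}\<close>] by (simp add: site_update_def)
    next
      case False
      then show ?thesis unfolding step by (rule site_update_other)
    qed
    moreover have "h (d * real (Suc i)) x = h (d * real i) x"
      by (rule no_ring_constant[OF di]) (use True d in \<open>auto simp: cell_def\<close>)
    ultimately show ?thesis using eq[OF x] by simp
  next
    case False
    then have xy: "x = y" using y x C(1) by auto
    have "card (P x \<inter> cell d i) = 1"
    proof -
      have "x \<in> set xs" using x C(1) by auto
      then have "card (P x \<inter> cell d i) \<le> 1"
        by (rule separated_le_one[OF sep])
      moreover have "card (P x \<inter> cell d i) \<noteq> 0" using False fin[of x] by simp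
      ultimately show ?thesis by linarith
    qed
    then obtain r where r: "P x \<inter> cell d i = {r}" by (auto simp: card_1_singleton_iff)
    have nx: "P z \<inter> cell d i = {}" if z: "z \<in> nbrs E x" for z
    proof -
      have "z \<noteq> x" using z E by (fastforce simp: simple_graph_def nbrs_def)
      moreover have "z \<in> set xs" using C(2)[OF x False z] C(1) by auto
      ultimately show ?thesis using y(2) xy by auto
    qed
    have nn: "num_ones E (h (d * real i)) x = num_ones E (?T (length xs * i)) x"
      unfolding num_ones_def by (rule sum.cong) (use eq C(2)[OF x False] in auto)
    have "{s \<in> P x. s < r} = P x \<inter> {0..d * real i}"
    proof (intro equalityI subsetI)
      fix s assume s: "s \<in> {s \<in> P x. s < r}"
      then have "s \<notin> cell d i" using r by auto
      moreover have "r \<le> d * real (Suc i)" using r by (auto simp: cell_def)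
      ultimately show "s \<in> P x \<inter> {0..d * real i}" using s P_pos[of x] by (auto simp: cell_def)
    next
      fix s assume s: "s \<in> P x \<inter> {0..d * real i}"
      have "d * real i < r" using r by (auto simp: cell_def)
      then show "s \<in> {s \<in> P x. s < r}" using s by auto
    qed
    moreover have "r \<in> P x" using r by auto
    ultimately have "nth_point (P x) (card (P x \<inter> {0..d * real i})) = r"
      using nth_point_card[OF P_pos P_fin, of r x] by simp
    then have a: "a (i, x) = Some (U x r \<le> q)"
      using r by (simp add: a_def cell_symbol_def)
    have "h (d * real (Suc i)) x = (if j \<le> num_ones E (h (d * real i)) x then U x r \<le> q else h (d * real i) x)"
      by (rule ring_update[OF di]) (use r nx in \<open>auto simp: cell_def\<close>)
    then show ?thesis unfolding step xy[symmetric] a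
      using nn eq[OF x] by (simp add: site_update_def)
  qed
qed

text \<open>
  The sets \<open>W b\<close> shrink in time: everything that can influence \<open>W (b + 1)\<close> during block \<open>b\<close> lies
  in \<open>W b\<close>. So agreement on \<open>W b\<close> at the beginning of the block is sufficient for agreement on
  \<open>W (b + 1)\<close> at its end, even though it may be lost on the rest of \<open>W b\<close>.
\<close>

lemma cell_trajectory:
  fixes s :: real and m B :: nat
  defines "d \<equiv> s / real m"
  defines "a \<equiv> cell_symbol q d P (\<lambda>(x, n). U x (nth_point (P x) n))"
  assumes xs: "distinct xs" and s: "0 < s" and m: "0 < m" and sep: "separated (set xs) d (m * B) P"
    and W: "\<And>b. b < B \<Longrightarrow> W (Suc b) \<subseteq> W b"
    and W0: "W 0 \<subseteq> set xs"
    and cl: "\<And>b x y. b < B \<Longrightarrow> x \<in> W (Suc b) \<Longrightarrow> (ring_step E P s b)\<^sup>*\<^sup>* x y \<Longrightarrow> y \<in> W b"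
    and init: "\<And>x. x \<in> set xs \<Longrightarrow> \<xi> x = h 0 x"
  shows "b \<le> B \<Longrightarrow> x \<in> W b \<Longrightarrow> h (s * real b) x = trajectory E j (sweep xs) a \<xi> (length xs * (m * b)) x"
proof (induction b arbitrary: x)
  case 0
  then show ?case using init W0 by auto
next
  case (Suc b)
  then have b: "b < B" by simp
  define C where "C = {y. \<exists>x\<in>W (Suc b). (ring_step E P s b)\<^sup>*\<^sup>* x y}"
  have CW: "C \<subseteq> W b" using cl[OF b] by (auto simp: C_def)
  have Wxs: "k \<le> B \<Longrightarrow> W k \<subseteq> set xs" for k
  proof (induction k)
    case (Suc k)
    then have "W (Suc k) \<subseteq> W k" using W[of k] by simp
    then show ?case using Suc by auto
  qed (use W0 in auto)
  have Cxs: "C \<subseteq> set xs" using CW Wxs[of b] b by auto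
  have d0: "0 < d" using s m by (simp add: d_def)
  have "h (d * real (m * b + k)) y = trajectory E j (sweep xs) a \<xi> (length xs * (m * b + k)) y"
    if "k \<le> m" "y \<in> C" for k y
    using that
  proof (induction k arbitrary: y)
    case 0
    have d: "d * real (m * b) = s * real b" using m by (simp add: d_def)
    have "h (s * real b) y = trajectory E j (sweep xs) a \<xi> (length xs * (m * b)) y"
      by (rule Suc.IH) (use CW 0 b in auto)
    then show ?case unfolding add_0_right d .
  next
    case (Suc k)
    have ik: "m * b + k \<in> {m * b..<m * Suc b}" using Suc.prems by simp
    have "m * Suc b \<le> m * B" using b by (intro mult_le_mono) auto
    then have iN: "m * b + k < m * B" using ik by simp
    have "h (d * real (Suc (m * b + k))) y = trajectory E j (sweep xs) a \<xi> (length xs * Suc (m * b + k)) y"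
      unfolding a_def
    proof (rule cell_trajectory_step[OF xs d0 sep iN Cxs])
      show "z \<in> C" if "x \<in> C" "P x \<inter> cell d (m * b + k) \<noteq> {}" "z \<in> nbrs E x" for x z
      proof -
        have "cell d (m * b + k) \<subseteq> cell s b" unfolding d_def by (rule cell_subset[OF ik m s])
        then have "ring_step E P s b x z" using that by (auto simp: ring_step_def)
        then show ?thesis using that(1) unfolding C_def by (auto intro: rtranclp.rtrancl_into_rtrancl)
      qed
      show "h (d * real (m * b + k)) x = trajectory E j (sweep xs) (cell_symbol q d P (\<lambda>(x, n). U x (nth_point (P x) n))) \<xi> (length xs * (m * b + k)) x"
        if "x \<in> C" for x
        using Suc.IH[of x] that Suc.prems(1) unfolding a_def by simp
      show "y \<in> C" by fact
    qed
    then show ?case by simp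
  qed
  from this[of m x] have "h (d * real (m * b + m)) x = trajectory E j (sweep xs) a \<xi> (length xs * (m * b + m)) x"
    using Suc.prems(2) by (auto simp: C_def)
  moreover have "m * b + m = m * Suc b" by simp
  moreover have "d * real (m * Suc b) = s * real (Suc b)"
    unfolding d_def of_nat_mult using m by (simp del: of_nat_Suc)
  ultimately show ?case by simp
qed

end

section \<open>Law of the symbols read from the clocks\<close>

lemma (in prob_space) indep_vars_prob_all:
  assumes "indep_vars M' X I" "finite J" "J \<subseteq> I" "\<And>j. j \<in> J \<Longrightarrow> A j \<in> sets (M' j)"
  shows "prob {\<omega> \<in> space M. \<forall>j\<in>J. X j \<omega> \<in> A j} = (\<Prod>j\<in>J. prob (X j -` A j \<inter> space M))"
proof (cases "J = {}")
  case True
  then show ?thesis by (simp add: prob_space)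
next
  case False
  have "{\<omega> \<in> space M. \<forall>j\<in>J. X j \<omega> \<in> A j} = (\<Inter>j\<in>J. X j -` A j \<inter> space M)"
    using False by auto
  then show ?thesis using indep_varsD[OF assms(1) False assms(2-4)] by simp
qed

definition point_sets :: "real set set" where
  "point_sets = {S. S \<subseteq> {0..} \<and> (\<forall>b. finite (S \<inter> {..b}))}"

lemma point_configs_eq:
  "point_configs = sigma point_sets {{S \<in> point_sets. card (S \<inter> A) = n} | A n. A \<in> sets borel \<and> bounded A}"
  by (simp add: point_configs_def point_sets_def Let_def)

lemma space_point_configs: "space point_configs = point_sets"
  by (simp add: point_configs_eq space_measure_of_conv)

lemma measurable_card_points:
  assumes "A \<in> sets borel" "bounded A"
  shows "(\<lambda>S. card (S \<inter> A)) \<in> point_configs \<rightarrow>\<^sub>M count_space UNIV"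
proof -
  have "(\<lambda>S. card (S \<inter> A)) -` {n} \<inter> space point_configs \<in> sets point_configs" for n
  proof -
    have "{S \<in> point_sets. card (S \<inter> A) = n} \<in> sets point_configs"
      unfolding point_configs_eq by (rule in_measure_of) (use assms in auto)
    moreover have "(\<lambda>S. card (S \<inter> A)) -` {n} \<inter> space point_configs = {S \<in> point_sets. card (S \<inter> A) = n}"
      by (auto simp: space_point_configs)
    ultimately show ?thesis by simp
  qed
  then show ?thesis by (simp add: measurable_count_space_eq_countable)
qed

lemma cell_borel: "cell d i \<in> sets borel" "bounded (cell d i)"
  by (auto simp: cell_def intro: bounded_subset[OF bounded_closed_interval[of "d * real i" "d * real (Suc i)", unfolded box_real]])

lemma cell_pos: "0 < d \<Longrightarrow> cell d i \<subseteq> {0..}"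
  by (auto simp: cell_def intro: order_trans[of 0 "d * real i"])

lemma measure_cell: "0 < d \<Longrightarrow> measure lborel (cell d i) = d"
  by (simp add: cell_def algebra_simps)

lemma disjoint_cells: assumes "0 < d" shows "disjoint_family_on (cell d) I"
  unfolding disjoint_family_on_def
proof (intro ballI impI)
  have aux: "cell d m \<inter> cell d n = {}" if "m < n" for m n :: nat
  proof -
    have "d * real (Suc m) \<le> d * real n"
      using that assms by (intro mult_left_mono) auto
    then show ?thesis by (fastforce simp: cell_def)
  qed
  fix m n :: nat assume "m \<noteq> n"
  then show "cell d m \<inter> cell d n = {}" using aux[of m n] aux[of n m] by (cases "m < n") auto
qed

context marked_clocks
begin

lemma clock_measurable: "P x \<in> M \<rightarrow>\<^sub>M point_configs"
  using clocks_poisson[of x] by (simp add: unit_poisson_process_def)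

lemma clock_points: "\<omega> \<in> space M \<Longrightarrow> P x \<omega> \<in> point_sets"
  using measurable_space[OF clock_measurable] by (simp add: space_point_configs)

lemma count_measurable:
  assumes "A \<in> sets borel" "bounded A"
  shows "(\<lambda>\<omega>. card (P x \<omega> \<inter> A)) \<in> M \<rightarrow>\<^sub>M count_space UNIV"
  using measurable_comp[OF clock_measurable measurable_card_points[OF assms]] by (simp add: comp_def)

lemma prob_count:
  assumes "0 < d"
  shows "prob {\<omega> \<in> space M. card (P x \<omega> \<inter> cell d i) = n} = d ^ n / fact n * exp (- d)"
  using clocks_poisson[of x] cell_borel[of d i] cell_pos[OF assms, of i]
  by (simp add: unit_poisson_process_def measure_cell[OF assms])

lemma counts_indep:
  assumes "0 < d"
  shows "indep_vars (\<lambda>_. count_space UNIV) (\<lambda>i \<omega>. card (P x \<omega> \<inter> cell d i)) {..<N}"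
proof -
  have *: "finite I \<and> disjoint_family_on A I \<and>
        (\<forall>i\<in>I. A i \<in> sets borel \<and> bounded (A i) \<and> A i \<subseteq> {0..}) \<longrightarrow>
        indep_vars (\<lambda>_. count_space UNIV) (\<lambda>i \<omega>. card (P x \<omega> \<inter> A i)) I" for A and I :: "nat set"
    using clocks_poisson[of x] unfolding unit_poisson_process_def by simp
  show ?thesis
    by (rule *[THEN mp]) (use cell_borel cell_pos[OF assms] disjoint_cells[OF assms] in simp)
qed

lemma prob_no_ring:
  assumes "0 < d"
  shows "prob {\<omega> \<in> space M. (card (P x \<omega> \<inter> cell d i) = 0) = \<beta>} = (if \<beta> then exp (- d) else 1 - exp (- d))"
proof (cases \<beta>)
  case True
  then show ?thesis using prob_count[OF assms, of x i 0] by simp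
next
  case False
  have "prob (space M - {\<omega> \<in> space M. card (P x \<omega> \<inter> cell d i) = 0}) = 1 - exp (- d)"
    using prob_count[OF assms, of x i 0] count_measurable[OF cell_borel]
    by (subst prob_compl) auto
  moreover have "space M - {\<omega> \<in> space M. card (P x \<omega> \<inter> cell d i) = 0} =
      {\<omega> \<in> space M. (card (P x \<omega> \<inter> cell d i) = 0) = \<beta>}" using False by auto
  ultimately show ?thesis using False by simp
qed

text \<open>Independence is used twice: between disjoint cells of one clock and between the clocks.\<close>

lemma prob_ring_pattern:
  assumes "0 < d" "finite V"
  shows "prob {\<omega> \<in> space M. \<forall>e\<in>{..<N} \<times> V. (card (P (snd e) \<omega> \<inter> cell d (fst e)) = 0) = \<beta> e} =
    (\<Prod>e\<in>{..<N} \<times> V. if \<beta> e then exp (- d) else 1 - exp (- d))"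
proof -
  define Y where "Y x = {S \<in> space point_configs. \<forall>i\<in>{..<N}. (card (S \<inter> cell d i) = 0) = \<beta> (i, x)}" for x
  have Y: "Y x \<in> sets point_configs" for x
  proof -
    have [measurable]: "(\<lambda>S. card (S \<inter> cell d i)) \<in> point_configs \<rightarrow>\<^sub>M count_space UNIV" for i
      by (rule measurable_card_points[OF cell_borel])
    show ?thesis unfolding Y_def by measurable
  qed
  have "prob (P x -` Y x \<inter> space M) = (\<Prod>i<N. if \<beta> (i, x) then exp (- d) else 1 - exp (- d))" for x
  proof -
    have ind: "indep_vars (\<lambda>_. count_space UNIV) (\<lambda>i \<omega>. card (P x \<omega> \<inter> cell d i)) {..<N}"
      by (rule counts_indep[OF assms(1)])
    have "P x -` Y x \<inter> space M =
        {\<omega> \<in> space M. \<forall>i\<in>{..<N}. card (P x \<omega> \<inter> cell d i) \<in> {n. (n = 0) = \<beta> (i, x)}}"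
      using measurable_space[OF clock_measurable] by (auto simp: Y_def)
    also have "prob \<dots> = (\<Prod>i<N. prob ((\<lambda>\<omega>. card (P x \<omega> \<inter> cell d i)) -` {n. (n = 0) = \<beta> (i, x)} \<inter> space M))"
      by (rule indep_vars_prob_all[OF ind]) auto
    also have "\<dots> = (\<Prod>i<N. prob {\<omega> \<in> space M. (card (P x \<omega> \<inter> cell d i) = 0) = \<beta> (i, x)})"
      by (intro prod.cong refl arg_cong[where f = prob]) auto
    also have "\<dots> = (\<Prod>i<N. if \<beta> (i, x) then exp (- d) else 1 - exp (- d))"
      by (simp only: prob_no_ring[OF assms(1)])
    finally show ?thesis .
  qed
  moreover have "{\<omega> \<in> space M. \<forall>e\<in>{..<N} \<times> V. (card (P (snd e) \<omega> \<inter> cell d (fst e)) = 0) = \<beta> e} =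
      {\<omega> \<in> space M. \<forall>x\<in>V. P x \<omega> \<in> Y x}"
    using measurable_space[OF clock_measurable] by (force simp: Y_def)
  moreover have "prob {\<omega> \<in> space M. \<forall>x\<in>V. P x \<omega> \<in> Y x} = (\<Prod>x\<in>V. prob (P x -` Y x \<inter> space M))"
    by (rule indep_vars_prob_all[OF clocks_indep assms(2)]) (use Y in auto)
  ultimately have "prob {\<omega> \<in> space M. \<forall>e\<in>{..<N} \<times> V. (card (P (snd e) \<omega> \<inter> cell d (fst e)) = 0) = \<beta> e} =
     (\<Prod>x\<in>V. \<Prod>i<N. if \<beta> (i, x) then exp (- d) else 1 - exp (- d))" by simp
  also have "\<dots> = (\<Prod>i<N. \<Prod>x\<in>V. if \<beta> (i, x) then exp (- d) else 1 - exp (- d))" by (rule prod.swap)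
  also have "\<dots> = (\<Prod>e\<in>{..<N} \<times> V. if \<beta> e then exp (- d) else 1 - exp (- d))"
    by (subst prod.cartesian_product) (simp add: case_prod_unfold)
  finally show ?thesis .
qed

lemma prob_mark:
  assumes "q \<in> {0..1}"
  shows "prob ((\<lambda>\<omega>. marks \<omega> i) -` (if b then {..q} else {q<..}) \<inter> space M) = (if b then q else 1 - q)"
proof -
  have m: "(\<lambda>\<omega>. marks \<omega> i) \<in> M \<rightarrow>\<^sub>M borel"
    using marks_indep unfolding indep_vars_def by blast
  have "prob ((\<lambda>\<omega>. marks \<omega> i) -` A \<inter> space M) = measure (uniform_measure lborel {0..1}) A" if "A \<in> sets borel" for A
    using measure_distr[OF m that] marks_uniform[of i] by simp
  moreover have "{0..1} \<inter> {..q} = {0..q}" "{0..1} \<inter> {q<..} = {q<..1}" using assms by auto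
  ultimately show ?thesis using assms by auto
qed

lemma prob_mark_pattern:
  assumes "q \<in> {0..1}" "finite J" "inj_on g J"
  shows "prob {\<omega> \<in> space M. \<forall>e\<in>J. (marks \<omega> (g e) \<le> q) = b e} = (\<Prod>e\<in>J. if b e then q else 1 - q)"
proof -
  define A where "A i = (if b (inv_into J g i) then {..q} else {q<..})" for i
  have A: "A (g e) = (if b e then {..q} else {q<..})" if "e \<in> J" for e
    using that assms(3) by (simp add: A_def)
  have "{\<omega> \<in> space M. \<forall>e\<in>J. (marks \<omega> (g e) \<le> q) = b e} = {\<omega> \<in> space M. \<forall>i\<in>g ` J. marks \<omega> i \<in> A i}"
    using A by (auto split: if_splits simp: not_le)
  also have "prob \<dots> = (\<Prod>i\<in>g ` J. prob ((\<lambda>\<omega>. marks \<omega> i) -` A i \<inter> space M))"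
    by (rule indep_vars_prob_all[OF marks_indep]) (use assms(2) in \<open>auto simp: A_def\<close>)
  also have "\<dots> = (\<Prod>e\<in>J. prob ((\<lambda>\<omega>. marks \<omega> (g e)) -` (if b e then {..q} else {q<..}) \<inter> space M))"
    by (subst prod.reindex[OF assms(3)]) (simp add: A)
  finally show ?thesis by (simp only: prob_mark[OF assms(1)])
qed

end

lemma pmf_symbol_split:
  assumes "0 < d" "q \<in> {0..1}"
  shows "pmf (symbol_pmf (1 - exp (- d)) q) s =
    (if s = None then exp (- d) else 1 - exp (- d)) * (if s = None then 1 else if the s then q else 1 - q)"
proof -
  have "1 - exp (- d) \<in> {0..1}" using assms by auto
  from pmf_symbol[OF this assms(2)] show ?thesis
    by (cases s; cases "the s") auto
qed

context marked_clocks
begin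

text \<open>
  Which marks enter the symbols depends on the clocks. This dependence disappears when the numbers
  \<open>k\<close> of earlier rings are prescribed: then the event that the symbols are \<open>a\<close> is a condition on the
  clocks, \<open>symbols_set\<close>, together with one on a fixed family of marks, \<open>symbols_marks\<close>.
\<close>

definition symbols_set :: "real \<Rightarrow> real \<Rightarrow> nat \<Rightarrow> 'v set \<Rightarrow> (nat \<times> 'v \<Rightarrow> bool option) \<Rightarrow>
    (nat \<times> 'v \<Rightarrow> nat) \<Rightarrow> ('v \<Rightarrow> real set) set" where
  "symbols_set q d N V a k = {c \<in> space (PiM UNIV (\<lambda>_. point_configs)). \<forall>e\<in>{..<N} \<times> V.
     card (c (snd e) \<inter> {0..d * real (fst e)}) = k e \<and> (card (c (snd e) \<inter> cell d (fst e)) = 0) = (a e = None)}"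

definition symbols_marks :: "real \<Rightarrow> nat \<Rightarrow> 'v set \<Rightarrow> (nat \<times> 'v \<Rightarrow> bool option) \<Rightarrow>
    (nat \<times> 'v \<Rightarrow> nat) \<Rightarrow> ('v \<times> nat \<Rightarrow> real) set" where
  "symbols_marks q N V a k = {m \<in> space (PiM UNIV (\<lambda>_. borel)). \<forall>e\<in>{e \<in> {..<N} \<times> V. a e \<noteq> None}.
     (m (snd e, k e) \<le> q) = the (a e)}"

lemma symbols_setD:
  assumes "c \<in> symbols_set q d N V a k" "e \<in> {..<N} \<times> V"
  shows "card (c (snd e) \<inter> {0..d * real (fst e)}) = k e"
    "(card (c (snd e) \<inter> cell d (fst e)) = 0) = (a e = None)"
proof -
  note * = assms(1)[unfolded symbols_set_def mem_Collect_eq, THEN conjunct2, THEN bspec, OF assms(2)]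
  show "card (c (snd e) \<inter> {0..d * real (fst e)}) = k e" by (rule *[THEN conjunct1])
  show "(card (c (snd e) \<inter> cell d (fst e)) = 0) = (a e = None)" by (rule *[THEN conjunct2])
qed

lemma symbols_marksD:
  assumes "m \<in> symbols_marks q N V a k" "e \<in> {..<N} \<times> V" "a e \<noteq> None"
  shows "(m (snd e, k e) \<le> q) = the (a e)"
proof -
  have "e \<in> {e \<in> {..<N} \<times> V. a e \<noteq> None}" using assms(2,3) by simp
  from assms(1)[unfolded symbols_marks_def mem_Collect_eq[of m], THEN conjunct2, THEN bspec, OF this]
  show ?thesis .
qed

lemma symbols_set_measurable:
  assumes "finite V" shows "symbols_set q d N V a k \<in> sets (PiM UNIV (\<lambda>_. point_configs))"
  unfolding symbols_set_def
proof (rule sets.sets_Collect_finite_All)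
  let ?\<Omega> = "PiM UNIV (\<lambda>_ :: 'v. point_configs)"
  have 1: "(\<lambda>c. card (c x \<inter> A)) \<in> ?\<Omega> \<rightarrow>\<^sub>M count_space UNIV"
    if "A \<in> sets borel" "bounded A" for A and x :: 'v
  proof -
    have "(\<lambda>c. c x) \<in> ?\<Omega> \<rightarrow>\<^sub>M point_configs"
      by (rule measurable_component_singleton) auto
    from measurable_compose[OF this measurable_card_points[OF that]] show ?thesis .
  qed
  fix e assume "e \<in> {..<N} \<times> V"
  have "{c \<in> space ?\<Omega>. card (c (snd e) \<inter> {0..d * real (fst e)}) = k e \<and>
      (card (c (snd e) \<inter> cell d (fst e)) = 0) = (a e = None)} =
    ((\<lambda>c. card (c (snd e) \<inter> {0..d * real (fst e)})) -` {k e} \<inter> space ?\<Omega>) \<inter>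
    ((\<lambda>c. card (c (snd e) \<inter> cell d (fst e))) -` {v. (v = 0) = (a e = None)} \<inter> space ?\<Omega>)"
    by auto
  also have "\<dots> \<in> sets ?\<Omega>"
    by (intro sets.Int measurable_sets[OF 1] cell_borel) auto
  finally show "{c \<in> space ?\<Omega>. card (c (snd e) \<inter> {0..d * real (fst e)}) = k e \<and>
      (card (c (snd e) \<inter> cell d (fst e)) = 0) = (a e = None)} \<in> sets ?\<Omega>" .
qed (use assms in simp)

lemma symbols_marks_measurable:
  assumes "finite V" shows "symbols_marks q N V a k \<in> sets (PiM UNIV (\<lambda>_. borel))"
  unfolding symbols_marks_def
proof (rule sets.sets_Collect_finite_All)
  let ?\<Omega> = "PiM UNIV (\<lambda>_ :: 'v \<times> nat. borel :: real measure)"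
  fix e assume "e \<in> {e \<in> {..<N} \<times> V. a e \<noteq> None}"
  have m: "(\<lambda>m. m (snd e, k e)) \<in> ?\<Omega> \<rightarrow>\<^sub>M borel"
    by (rule measurable_component_singleton) auto
  have "{m \<in> space ?\<Omega>. (m (snd e, k e) \<le> q) = the (a e)} =
      (\<lambda>m. m (snd e, k e)) -` (if the (a e) then {..q} else {q<..}) \<inter> space ?\<Omega>" by auto
  also have "\<dots> \<in> sets ?\<Omega>" by (rule measurable_sets[OF m]) auto
  finally show "{m \<in> space ?\<Omega>. (m (snd e, k e) \<le> q) = the (a e)} \<in> sets ?\<Omega>" .
qed (use assms in simp)

text \<open>Different ringing cells read different marks, because the ring number increases strictly from one to the next.\<close>

lemma ring_indices_inj:
  assumes c: "\<And>x. c x \<in> point_sets" and k: "\<And>e. e \<in> J \<Longrightarrow> card (c (snd e) \<inter> {0..d * real (fst e)}) = k e"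
    and ne: "\<And>e. e \<in> J \<Longrightarrow> card (c (snd e) \<inter> cell d (fst e)) \<noteq> 0" and d: "0 < d"
  shows "inj_on (\<lambda>e. (snd e, k e)) J"
proof -
  have less: "k (i, x) < k (i', x)" if "(i, x) \<in> J" "(i', x) \<in> J" "i < i'" for i i' x
  proof -
    have fin: "finite (c x \<inter> {0..d * real i'})"
      by (rule finite_subset[of _ "c x \<inter> {..d * real i'}"]) (use c[of x] in \<open>auto simp: point_sets_def\<close>)
    have le: "d * real (Suc i) \<le> d * real i'" using that d by (intro mult_left_mono) auto
    have "c x \<inter> cell d i \<noteq> {}" using ne[OF that(1)] by auto
    then obtain r where r: "r \<in> c x \<inter> cell d i" by blast
    have "d * real i \<le> d * real i'" using that d by (intro mult_left_mono) auto
    then have "c x \<inter> {0..d * real i} \<subseteq> c x \<inter> {0..d * real i'}" by auto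
    moreover have "r \<in> c x \<inter> {0..d * real i'}" "r \<notin> c x \<inter> {0..d * real i}"
      using r le c[of x] by (auto simp: cell_def point_sets_def)
    ultimately have "c x \<inter> {0..d * real i} \<subset> c x \<inter> {0..d * real i'}" by blast
    then have "card (c x \<inter> {0..d * real i}) < card (c x \<inter> {0..d * real i'})"
      by (rule psubset_card_mono[OF fin])
    then show ?thesis using k[OF that(1)] k[OF that(2)] by simp
  qed
  show ?thesis
  proof (rule inj_onI)
    fix e e' assume e: "e \<in> J" "e' \<in> J" "(snd e, k e) = (snd e', k e')"
    obtain i x i' where ee: "e = (i, x)" "e' = (i', x)" using e(3) by (cases e; cases e') auto
    show "e = e'" using less[of i x i'] less[of i' x i] e ee by (cases i i' rule: linorder_cases) auto
  qed
qed

lemma clocks_marks_rect: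
  assumes "A \<in> sets (PiM UNIV (\<lambda>_. point_configs))" "B \<in> sets (PiM UNIV (\<lambda>_. borel))"
  shows "prob ((clocks -` A \<inter> space M) \<inter> (marks -` B \<inter> space M)) =
         prob (clocks -` A \<inter> space M) * prob (marks -` B \<inter> space M)"
  by (rule indep_setD) (use clocks_marks_indep assms in \<open>auto simp: indep_rvs_def\<close>)

lemma clocks_meas: "clocks \<in> M \<rightarrow>\<^sub>M PiM UNIV (\<lambda>_. point_configs)"
  and marks_meas: "marks \<in> M \<rightarrow>\<^sub>M PiM UNIV (\<lambda>_. borel)"
  using clocks_marks_indep by (auto simp: indep_rvs_def)

lemma clocks_point_sets: "\<omega> \<in> space M \<Longrightarrow> clocks \<omega> x \<in> point_sets"
  using clock_points by (simp add: clocks_def)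

text \<open>If no clocks are compatible with \<open>k\<close>, both sides vanish; otherwise the marks that are read are distinct.\<close>

lemma prob_symbols_rect:
  assumes V: "finite V" and d: "0 < d" and q: "q \<in> {0..1}"
  shows "prob ((clocks -` symbols_set q d N V a k \<inter> space M) \<inter> (marks -` symbols_marks q N V a k \<inter> space M)) =
     prob (clocks -` symbols_set q d N V a k \<inter> space M) *
     (\<Prod>e\<in>{e \<in> {..<N} \<times> V. a e \<noteq> None}. if the (a e) then q else 1 - q)"
proof (cases "clocks -` symbols_set q d N V a k \<inter> space M = {}")
  case True
  then show ?thesis by simp
next
  case False
  then obtain \<omega> where \<omega>: "\<omega> \<in> space M" "clocks \<omega> \<in> symbols_set q d N V a k" by auto
  let ?J = "{e \<in> {..<N} \<times> V. a e \<noteq> None}"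
  have fin: "finite ?J" using V by simp
  have inj: "inj_on (\<lambda>e. (snd e, k e)) ?J"
  proof (rule ring_indices_inj[of "clocks \<omega>" _ d])
    fix e assume "e \<in> ?J"
    then have e: "e \<in> {..<N} \<times> V" "a e \<noteq> None" by simp_all
    show "card (clocks \<omega> (snd e) \<inter> {0..d * real (fst e)}) = k e"
      by (rule symbols_setD[OF \<omega>(2) e(1)])
    show "card (clocks \<omega> (snd e) \<inter> cell d (fst e)) \<noteq> 0"
      using symbols_setD(2)[OF \<omega>(2) e(1)] e(2) by simp
  qed (use \<omega> clocks_point_sets d in auto)
  have "marks -` symbols_marks q N V a k \<inter> space M =
     {\<omega> \<in> space M. \<forall>e\<in>?J. (marks \<omega> (snd e, k e) \<le> q) = the (a e)}"
    using measurable_space[OF marks_meas] by (auto simp: symbols_marks_def)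
  also have "prob \<dots> = (\<Prod>e\<in>?J. if the (a e) then q else 1 - q)"
    by (rule prob_mark_pattern[OF q fin inj])
  finally show ?thesis
    using clocks_marks_rect[OF symbols_set_measurable[OF V] symbols_marks_measurable[OF V]] by simp
qed

definition symbols_event :: "real \<Rightarrow> real \<Rightarrow> nat \<Rightarrow> 'v set \<Rightarrow> (nat \<times> 'v \<Rightarrow> bool option) \<Rightarrow>
    (('v \<Rightarrow> real set) \<times> ('v \<times> nat \<Rightarrow> real)) set" where
  "symbols_event q d N V a = (\<Union>k\<in>PiE ({..<N} \<times> V) (\<lambda>_. UNIV).
     symbols_set q d N V a k \<times> symbols_marks q N V a k)"

lemma countable_indices:
  fixes N :: nat
  shows "finite V \<Longrightarrow> countable (PiE ({..<N} \<times> V) (\<lambda>_. UNIV :: nat set))"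
  by (rule countable_PiE) auto

lemma symbols_event_measurable:
  assumes "finite V"
  shows "symbols_event q d N V a \<in> sets (PiM UNIV (\<lambda>_. point_configs) \<Otimes>\<^sub>M PiM UNIV (\<lambda>_. borel))"
  unfolding symbols_event_def
  by (intro sets.countable_UN'' countable_indices[OF assms] pair_measureI
      symbols_set_measurable[OF assms] symbols_marks_measurable[OF assms])

lemma symbols_event_iff:
  assumes "\<omega> \<in> space M"
  shows "(clocks \<omega>, marks \<omega>) \<in> symbols_event q d N V a \<longleftrightarrow>
    (\<forall>e\<in>{..<N} \<times> V. cell_symbol q d (clocks \<omega>) (marks \<omega>) e = a e)"
proof
  assume "(clocks \<omega>, marks \<omega>) \<in> symbols_event q d N V a"
  then obtain k where k: "clocks \<omega> \<in> symbols_set q d N V a k" "marks \<omega> \<in> symbols_marks q N V a k"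
    by (auto simp: symbols_event_def)
  show "\<forall>e\<in>{..<N} \<times> V. cell_symbol q d (clocks \<omega>) (marks \<omega>) e = a e"
  proof
    fix e assume e: "e \<in> {..<N} \<times> V"
    obtain i x where ix: "e = (i, x)" by force
    show "cell_symbol q d (clocks \<omega>) (marks \<omega>) e = a e"
    proof (cases "a e")
      case None
      then show ?thesis using symbols_setD(2)[OF k(1) e] by (simp add: ix cell_symbol_def)
    next
      case (Some b)
      have "card (clocks \<omega> x \<inter> cell d i) \<noteq> 0" "card (clocks \<omega> x \<inter> {0..d * real i}) = k e"
        using symbols_setD[OF k(1) e] Some by (auto simp: ix)
      moreover have "(marks \<omega> (x, k e) \<le> q) = b"
        using symbols_marksD[OF k(2) e] Some by (auto simp: ix)
      ultimately show ?thesis using Some by (simp add: ix cell_symbol_def)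
    qed
  qed
next
  assume *: "\<forall>e\<in>{..<N} \<times> V. cell_symbol q d (clocks \<omega>) (marks \<omega>) e = a e"
  define k where "k = restrict (\<lambda>e. card (clocks \<omega> (snd e) \<inter> {0..d * real (fst e)})) ({..<N} \<times> V)"
  have sp: "clocks \<omega> \<in> space (PiM UNIV (\<lambda>_. point_configs))" "marks \<omega> \<in> space (PiM UNIV (\<lambda>_. borel))"
    using measurable_space[OF clocks_meas assms] measurable_space[OF marks_meas assms] by auto
  have "clocks \<omega> \<in> symbols_set q d N V a k"
    unfolding symbols_set_def mem_Collect_eq
  proof (intro conjI ballI sp)
    fix e assume e: "e \<in> {..<N} \<times> V"
    then show "card (clocks \<omega> (snd e) \<inter> {0..d * real (fst e)}) = k e" by (simp add: k_def)
    have "cell_symbol q d (clocks \<omega>) (marks \<omega>) e = a e" using * e by (rule bspec)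
    then have "cell_symbol q d (clocks \<omega>) (marks \<omega>) (fst e, snd e) = a e" by simp
    then show "(card (clocks \<omega> (snd e) \<inter> cell d (fst e)) = 0) = (a e = None)"
      unfolding cell_symbol_def by (cases e; cases "a e") (auto split: if_splits)
  qed
  moreover have "marks \<omega> \<in> symbols_marks q N V a k"
    unfolding symbols_marks_def mem_Collect_eq
  proof (intro conjI ballI sp)
    fix e assume e: "e \<in> {e \<in> {..<N} \<times> V. a e \<noteq> None}"
    then have "cell_symbol q d (clocks \<omega>) (marks \<omega>) e = a e" using * by blast
    then have "cell_symbol q d (clocks \<omega>) (marks \<omega>) (fst e, snd e) = a e" by simp
    moreover have "k e = card (clocks \<omega> (snd e) \<inter> {0..d * real (fst e)})" using e by (simp add: k_def)
    ultimately show "(marks \<omega> (snd e, k e) \<le> q) = the (a e)"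
      using e unfolding cell_symbol_def by (auto split: if_splits)
  qed
  moreover have "k \<in> PiE ({..<N} \<times> V) (\<lambda>_. UNIV)" by (simp add: k_def)
  ultimately show "(clocks \<omega>, marks \<omega>) \<in> symbols_event q d N V a"
    unfolding symbols_event_def by blast
qed

text \<open>
  For prescribed \<open>k\<close> the probability factorises, and the factor coming from the marks does not
  depend on \<open>k\<close>. Summing over the countably many \<open>k\<close> leaves the probability of the ring pattern.
\<close>

lemma prob_symbols:
  assumes V: "finite V" and d: "0 < d" and q: "q \<in> {0..1}"
  shows "prob ((\<lambda>\<omega>. (clocks \<omega>, marks \<omega>)) -` symbols_event q d N V a \<inter> space M) =
     (\<Prod>e\<in>{..<N} \<times> V. pmf (symbol_pmf (1 - exp (- d)) q) (a e))"
proof -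
  let ?J = "{..<N} \<times> V" and ?K = "PiE ({..<N} \<times> V) (\<lambda>_. UNIV :: nat set)"
  define A where "A k = clocks -` symbols_set q d N V a k \<inter> space M" for k
  define B where "B k = marks -` symbols_marks q N V a k \<inter> space M" for k
  define w where "w = (\<Prod>e\<in>{e \<in> ?J. a e \<noteq> None}. if the (a e) then q else 1 - q)"
  have w0: "0 \<le> w" unfolding w_def using q by (intro prod_nonneg) auto
  have meas: "A k \<in> events" "B k \<in> events" for k
    unfolding A_def B_def
    using measurable_sets[OF clocks_meas symbols_set_measurable[OF V]]
      measurable_sets[OF marks_meas symbols_marks_measurable[OF V]] by auto
  have uniq: "k = k'" if "\<omega> \<in> A k" "\<omega> \<in> A k'" "k \<in> ?K" "k' \<in> ?K" for \<omega> k k'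
  proof (rule PiE_ext[OF that(3,4)])
    fix e assume e: "e \<in> ?J"
    have "clocks \<omega> \<in> symbols_set q d N V a k" "clocks \<omega> \<in> symbols_set q d N V a k'"
      using that(1,2) by (auto simp: A_def)
    from symbols_setD(1)[OF this(1) e] symbols_setD(1)[OF this(2) e] show "k e = k' e" by simp
  qed
  have disjA: "disjoint_family_on A ?K"
    unfolding disjoint_family_on_def using uniq by (metis (no_types, lifting) disjoint_iff)
  then have disjAB: "disjoint_family_on (\<lambda>k. A k \<inter> B k) ?K"
    unfolding disjoint_family_on_def by blast
  have "(\<lambda>\<omega>. (clocks \<omega>, marks \<omega>)) -` symbols_event q d N V a \<inter> space M = (\<Union>k\<in>?K. A k \<inter> B k)"
    by (auto simp: symbols_event_def A_def B_def)
  then have "emeasure M ((\<lambda>\<omega>. (clocks \<omega>, marks \<omega>)) -` symbols_event q d N V a \<inter> space M) =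
      (\<integral>\<^sup>+k. emeasure M (A k \<inter> B k) \<partial>count_space ?K)"
    using emeasure_UN_countable[OF _ countable_indices[OF V] disjAB, of M] meas by auto
  also have "\<dots> = (\<integral>\<^sup>+k. emeasure M (A k) * ennreal w \<partial>count_space ?K)"
  proof (rule nn_integral_cong)
    fix k
    have "prob (A k \<inter> B k) = prob (A k) * w"
      unfolding A_def B_def w_def by (rule prob_symbols_rect[OF V d q])
    then show "emeasure M (A k \<inter> B k) = emeasure M (A k) * ennreal w"
      using w0 by (simp add: emeasure_eq_measure ennreal_mult)
  qed
  also have "\<dots> = (\<integral>\<^sup>+k. emeasure M (A k) \<partial>count_space ?K) * ennreal w"
    by (rule nn_integral_multc) simp
  also have "(\<integral>\<^sup>+k. emeasure M (A k) \<partial>count_space ?K) = emeasure M (\<Union>k\<in>?K. A k)"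
    using emeasure_UN_countable[OF _ countable_indices[OF V] disjA, of M] meas by auto
  also have "(\<Union>k\<in>?K. A k) = {\<omega> \<in> space M. \<forall>e\<in>?J. (card (P (snd e) \<omega> \<inter> cell d (fst e)) = 0) = (a e = None)}"
  proof (intro equalityI subsetI)
    fix \<omega> assume \<omega>: "\<omega> \<in> {\<omega> \<in> space M. \<forall>e\<in>?J. (card (P (snd e) \<omega> \<inter> cell d (fst e)) = 0) = (a e = None)}"
    define k where "k = restrict (\<lambda>e. card (clocks \<omega> (snd e) \<inter> {0..d * real (fst e)})) ?J"
    have "\<omega> \<in> A k"
      unfolding A_def symbols_set_def
      using \<omega> measurable_space[OF clocks_meas, of \<omega>] by (simp add: k_def clocks_def)
    moreover have "k \<in> ?K" by (simp add: k_def)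
    ultimately show "\<omega> \<in> (\<Union>k\<in>?K. A k)" by blast
  next
    fix \<omega> assume "\<omega> \<in> (\<Union>k\<in>?K. A k)"
    then obtain k where \<omega>: "\<omega> \<in> space M" "clocks \<omega> \<in> symbols_set q d N V a k" by (auto simp: A_def)
    show "\<omega> \<in> {\<omega> \<in> space M. \<forall>e\<in>?J. (card (P (snd e) \<omega> \<inter> cell d (fst e)) = 0) = (a e = None)}"
      unfolding mem_Collect_eq
      by (intro conjI ballI \<omega>(1)) (rule symbols_setD(2)[OF \<omega>(2), unfolded clocks_def])
  qed
  finally have "prob ((\<lambda>\<omega>. (clocks \<omega>, marks \<omega>)) -` symbols_event q d N V a \<inter> space M) =
     prob {\<omega> \<in> space M. \<forall>e\<in>?J. (card (P (snd e) \<omega> \<inter> cell d (fst e)) = 0) = (a e = None)} * w"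
    using w0 by (simp add: emeasure_eq_measure flip: ennreal_mult)
  also have "\<dots> = (\<Prod>e\<in>?J. if a e = None then exp (- d) else 1 - exp (- d)) * w"
    by (simp only: prob_ring_pattern[OF d V])
  also have "w = (\<Prod>e\<in>?J. if a e = None then 1 else if the (a e) then q else 1 - q)"
    unfolding w_def using V by (subst prod.inter_filter) (auto intro!: prod.cong)
  finally show ?thesis
    by (simp only: prod.distrib[symmetric] pmf_symbol_split[OF d q])
qed

end

section \<open>Finite marginals of configurations\<close>

lemma expectation_finite_range:
  fixes g :: "'z \<Rightarrow> real"
  assumes "prob_space N" and F: "finite F" and Z: "\<And>\<omega>. \<omega> \<in> space N \<Longrightarrow> Z \<omega> \<in> F"
    and meas: "\<And>z. z \<in> F \<Longrightarrow> {\<omega> \<in> space N. Z \<omega> = z} \<in> sets N"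
  shows "(\<integral>\<omega>. g (Z \<omega>) \<partial>N) = (\<Sum>z\<in>F. g z * measure N {\<omega> \<in> space N. Z \<omega> = z})"
    and "(\<lambda>\<omega>. g (Z \<omega>)) \<in> borel_measurable N"
proof -
  interpret prob_space N by fact
  have eq: "g (Z \<omega>) = (\<Sum>z\<in>F. g z * indicator {\<omega> \<in> space N. Z \<omega> = z} \<omega>)" if "\<omega> \<in> space N" for \<omega>
  proof -
    have "(\<Sum>z\<in>F. g z * indicator {\<omega> \<in> space N. Z \<omega> = z} \<omega>) = (\<Sum>z\<in>F. if z = Z \<omega> then g z else 0)"
      using that by (intro sum.cong) (auto simp: indicator_def)
    then show ?thesis using Z[OF that] F by simp
  qed
  have "(\<integral>\<omega>. g (Z \<omega>) \<partial>N) = (\<integral>\<omega>. (\<Sum>z\<in>F. g z * indicator {\<omega> \<in> space N. Z \<omega> = z} \<omega>) \<partial>N)"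
    by (rule Bochner_Integration.integral_cong[OF refl eq])
  also have "\<dots> = (\<Sum>z\<in>F. g z * measure N {\<omega> \<in> space N. Z \<omega> = z})"
  proof (subst Bochner_Integration.integral_sum)
    show "integrable N (\<lambda>\<omega>. g z * indicator {\<omega> \<in> space N. Z \<omega> = z} \<omega>)" if "z \<in> F" for z
      using meas[OF that] by (intro integrable_mult_right) (simp add: emeasure_eq_measure)
    show "(\<Sum>z\<in>F. \<integral>\<omega>. g z * indicator {\<omega> \<in> space N. Z \<omega> = z} \<omega> \<partial>N) =
      (\<Sum>z\<in>F. g z * measure N {\<omega> \<in> space N. Z \<omega> = z})"
      using meas by (intro sum.cong) auto
  qed
  finally show "(\<integral>\<omega>. g (Z \<omega>) \<partial>N) = (\<Sum>z\<in>F. g z * measure N {\<omega> \<in> space N. Z \<omega> = z})" .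
  have "(\<lambda>\<omega>. \<Sum>z\<in>F. g z * indicator {\<omega> \<in> space N. Z \<omega> = z} \<omega>) \<in> borel_measurable N"
    using meas by (intro borel_measurable_sum borel_measurable_times borel_measurable_indicator) auto
  then show "(\<lambda>\<omega>. g (Z \<omega>)) \<in> borel_measurable N"
    by (subst measurable_cong[OF eq])
qed

text \<open>
  The default outside \<open>S\<close> gives functions of the form in which \<open>Pi_pmf\<close> represents
  families of independent variables; for finite \<open>S\<close> and finitely many values they are finite in
  number.
\<close>

definition fill :: "'v set \<Rightarrow> 'b \<Rightarrow> ('v \<Rightarrow> 'b) \<Rightarrow> 'v \<Rightarrow> 'b" where
  "fill S d \<eta> = (\<lambda>x. if x \<in> S then \<eta> x else d)"

lemma fill_PiE_dflt: "fill S d \<eta> \<in> PiE_dflt S d (\<lambda>_. UNIV)"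
  by (simp add: fill_def PiE_dflt_def)

lemma fill_eq_iff: "\<xi> \<in> PiE_dflt S d (\<lambda>_. UNIV) \<Longrightarrow> fill S d \<eta> = \<xi> \<longleftrightarrow> (\<forall>x\<in>S. \<eta> x = \<xi> x)"
  by (auto simp: fill_def PiE_dflt_def fun_eq_iff)

lemma cylinder_measurable:
  fixes \<xi> :: "'v config"
  assumes "finite S" shows "{\<eta> \<in> space config_space. \<forall>x\<in>S. \<eta> x = \<xi> x} \<in> sets config_space"
proof (rule sets.sets_Collect_finite_All)
  fix x :: 'v
  have m: "(\<lambda>\<eta>. \<eta> x) \<in> config_space \<rightarrow>\<^sub>M count_space UNIV"
    unfolding config_space_def by (rule measurable_component_singleton) simp
  have "{\<eta> \<in> space config_space. \<eta> x = \<xi> x} = (\<lambda>\<eta>. \<eta> x) -` {\<xi> x} \<inter> space config_space" by auto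
  then show "{\<eta> \<in> space config_space. \<eta> x = \<xi> x} \<in> sets config_space"
    using measurable_sets[OF m, of "{\<xi> x}"] by simp
qed (rule assms)

lemma sets_bernoulli_product: "sets (bernoulli_product p) = sets config_space"
  unfolding bernoulli_product_def config_space_def by (rule sets_PiM_cong) auto

lemma space_bernoulli_product: "space (bernoulli_product p) = UNIV" "space config_space = UNIV"
  by (simp_all add: bernoulli_product_def config_space_def space_PiM)

lemma prob_space_bernoulli_product: "prob_space (bernoulli_product p)"
  unfolding bernoulli_product_def by (rule prob_space_PiM) (rule prob_space_measure_pmf)

lemma emeasure_bernoulli_cylinder:
  fixes p :: real and S :: "'a set"
  assumes "finite S"
  shows "emeasure (PiM UNIV (\<lambda>_. measure_pmf (bernoulli_pmf p)))
      (prod_emb UNIV (\<lambda>_. measure_pmf (bernoulli_pmf p)) S (PiE S (\<lambda>x. {\<xi> x})))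
    = (\<Prod>x\<in>S. emeasure (measure_pmf (bernoulli_pmf p)) {\<xi> x})"
proof -
  interpret product_prob_space "\<lambda>_ :: 'a. measure_pmf (bernoulli_pmf p)" UNIV
    by (rule product_prob_spaceI) (rule prob_space_measure_pmf)
  have "S \<subseteq> UNIV \<Longrightarrow> finite S \<Longrightarrow> (\<And>i. i \<in> S \<Longrightarrow> {\<xi> i} \<in> sets (measure_pmf (bernoulli_pmf p))) \<Longrightarrow> ?thesis"
    by (fact emeasure_PiM_emb)
  then show ?thesis using assms by simp
qed

lemma bernoulli_product_cylinder:
  fixes p :: real and S :: "'v set"
  assumes "finite S"
  shows "measure (bernoulli_product p) {\<eta>. \<forall>x\<in>S. \<eta> x = \<xi> x} = (\<Prod>x\<in>S. pmf (bernoulli_pmf p) (\<xi> x))"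
proof -
  have C: "{\<eta>. \<forall>x\<in>S. \<eta> x = \<xi> x} =
      prod_emb UNIV (\<lambda>_. measure_pmf (bernoulli_pmf p)) S (PiE S (\<lambda>x. {\<xi> x}))"
  proof (rule set_eqI)
    fix \<eta> :: "'v config"
    have "restrict \<eta> S \<in> PiE S (\<lambda>x. {\<xi> x}) \<longleftrightarrow> (\<forall>x\<in>S. \<eta> x = \<xi> x)"
      unfolding PiE_iff by auto
    moreover have "\<eta> \<in> extensional UNIV" by (simp add: extensional_def)
    ultimately show "\<eta> \<in> {\<eta>. \<forall>x\<in>S. \<eta> x = \<xi> x} \<longleftrightarrow>
        \<eta> \<in> prod_emb UNIV (\<lambda>_. measure_pmf (bernoulli_pmf p)) S (PiE S (\<lambda>x. {\<xi> x}))"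
      unfolding prod_emb_iff by simp
  qed
  have nn: "0 \<le> (\<Prod>x\<in>S. pmf (bernoulli_pmf p) (\<xi> x))" by (intro prod_nonneg ballI pmf_nonneg)
  have "(\<Prod>x\<in>S. emeasure (measure_pmf (bernoulli_pmf p)) {\<xi> x}) = (\<Prod>x\<in>S. ennreal (pmf (bernoulli_pmf p) (\<xi> x)))"
    by (simp only: emeasure_pmf_single)
  also have "\<dots> = ennreal (\<Prod>x\<in>S. pmf (bernoulli_pmf p) (\<xi> x))"
    by (rule prod_ennreal) (rule pmf_nonneg)
  finally have "emeasure (bernoulli_product p) {\<eta>. \<forall>x\<in>S. \<eta> x = \<xi> x} =
      ennreal (\<Prod>x\<in>S. pmf (bernoulli_pmf p) (\<xi> x))"
    unfolding C bernoulli_product_def by (rule trans[OF emeasure_bernoulli_cylinder[OF assms]])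
  then show ?thesis using nn by (simp add: measure_def)
qed

lemma finite_PiE_dflt_UNIV: "finite S \<Longrightarrow> finite (PiE_dflt S d (\<lambda>_. UNIV :: 'b::finite set))"
  by (rule finite_PiE_dflt) auto

lemma integral_bernoulli_product:
  fixes f :: "'v config \<Rightarrow> real"
  assumes V: "finite V" "S \<subseteq> V" and f: "\<And>\<eta> \<eta>'. (\<And>x. x \<in> S \<Longrightarrow> \<eta> x = \<eta>' x) \<Longrightarrow> f \<eta> = f \<eta>'"
  shows "(\<integral>\<xi>. f \<xi> \<partial>bernoulli_product q) = measure_pmf.expectation (product_pmf V q) f"
proof -
  have S: "finite S" using V finite_subset by auto
  let ?F = "PiE_dflt S True (\<lambda>_. UNIV)"
  have ff: "f \<eta> = f (fill S True \<eta>)" for \<eta> by (rule f) (simp add: fill_def)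
  have fin: "finite ?F" using S by (rule finite_PiE_dflt_UNIV)
  have cyl: "{\<omega> \<in> space (bernoulli_product q). fill S True \<omega> = z} = {\<eta>. \<forall>x\<in>S. \<eta> x = z x}" if "z \<in> ?F" for z
    using fill_eq_iff[OF that] by (simp add: space_bernoulli_product)
  have "(\<integral>\<xi>. f \<xi> \<partial>bernoulli_product q) = (\<integral>\<xi>. f (fill S True \<xi>) \<partial>bernoulli_product q)"
    by (simp add: ff[symmetric])
  also have "\<dots> = (\<Sum>z\<in>?F. f z * measure (bernoulli_product q) {\<omega> \<in> space (bernoulli_product q). fill S True \<omega> = z})"
  proof (rule expectation_finite_range(1)[OF prob_space_bernoulli_product fin fill_PiE_dflt])
    fix z :: "'v config" assume z: "z \<in> ?F"
    show "{\<omega> \<in> space (bernoulli_product q). fill S True \<omega> = z} \<in> sets (bernoulli_product q)"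
      unfolding cyl[OF z] sets_bernoulli_product
      using cylinder_measurable[OF S, of z] by (simp add: space_bernoulli_product)
  qed
  also have "\<dots> = (\<Sum>z\<in>?F. f z * pmf (product_pmf S q) z)"
    by (intro sum.cong refl) (simp add: cyl bernoulli_product_cylinder[OF S] pmf_Pi[OF S] PiE_dflt_def)
  also have "\<dots> = measure_pmf.expectation (product_pmf S q) f"
    by (rule integral_measure_pmf_real[symmetric, OF fin])
      (use set_Pi_pmf_subset[OF S] in \<open>force simp: PiE_dflt_def\<close>)
  also have "\<dots> = measure_pmf.expectation (product_pmf V q) (\<lambda>\<eta>. f (fill S True \<eta>))"
    unfolding Pi_pmf_subset[OF V] by (simp add: fill_def)
  finally show ?thesis by (simp add: ff[symmetric])
qed

section \<open>Separated rings and regions of influence\<close>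

context marked_clocks
begin

lemma prob_all_ring:
  assumes "0 < s" "finite Y"
  shows "{\<omega> \<in> space M. \<forall>x\<in>Y. card (P x \<omega> \<inter> cell s b) \<noteq> 0} \<in> events"
    and "prob {\<omega> \<in> space M. \<forall>x\<in>Y. card (P x \<omega> \<inter> cell s b) \<noteq> 0} = (1 - exp (- s)) ^ card Y"
proof -
  let ?A = "{S \<in> space point_configs. card (S \<inter> cell s b) \<noteq> 0}"
  have "?A = (\<lambda>S. card (S \<inter> cell s b)) -` {n. n \<noteq> 0} \<inter> space point_configs" by auto
  then have A: "?A \<in> sets point_configs"
    using measurable_sets[OF measurable_card_points[OF cell_borel], of "{n. n \<noteq> 0}" s b] by simp
  have eq: "{\<omega> \<in> space M. \<forall>x\<in>Y. card (P x \<omega> \<inter> cell s b) \<noteq> 0} = {\<omega> \<in> space M. \<forall>x\<in>Y. P x \<omega> \<in> ?A}"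
    using measurable_space[OF clock_measurable] by auto
  have "prob {\<omega> \<in> space M. \<forall>x\<in>Y. P x \<omega> \<in> ?A} = (\<Prod>x\<in>Y. prob (P x -` ?A \<inter> space M))"
    by (rule indep_vars_prob_all[OF clocks_indep assms(2)]) (use A in auto)
  also have "\<dots> = (\<Prod>x\<in>Y. 1 - exp (- s))"
  proof (rule prod.cong[OF refl])
    fix x
    have "P x -` ?A \<inter> space M = {\<omega> \<in> space M. (card (P x \<omega> \<inter> cell s b) = 0) = False}"
      using measurable_space[OF clock_measurable] by auto
    then show "prob (P x -` ?A \<inter> space M) = 1 - exp (- s)"
      by (simp only: prob_no_ring[OF assms(1)]) simp
  qed
  finally show "prob {\<omega> \<in> space M. \<forall>x\<in>Y. card (P x \<omega> \<inter> cell s b) \<noteq> 0} = (1 - exp (- s)) ^ card Y"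
    by (simp only: eq prod_constant)
  show "{\<omega> \<in> space M. \<forall>x\<in>Y. card (P x \<omega> \<inter> cell s b) \<noteq> 0} \<in> events"
  proof (rule sets.sets_Collect_finite_All[OF _ assms(2)])
    fix x
    have "{\<omega> \<in> space M. card (P x \<omega> \<inter> cell s b) \<noteq> 0} = P x -` ?A \<inter> space M"
      using measurable_space[OF clock_measurable] by auto
    then show "{\<omega> \<in> space M. card (P x \<omega> \<inter> cell s b) \<noteq> 0} \<in> events"
      using measurable_sets[OF clock_measurable A] by simp
  qed
qed

lemma prob_two_rings:
  assumes "0 < d"
  shows "{\<omega> \<in> space M. 2 \<le> card (P x \<omega> \<inter> cell d i)} \<in> events"
    and "prob {\<omega> \<in> space M. 2 \<le> card (P x \<omega> \<inter> cell d i)} \<le> d\<^sup>2"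
proof -
  let ?E = "\<lambda>n. {\<omega> \<in> space M. card (P x \<omega> \<inter> cell d i) = n}"
  have E: "?E n \<in> events" for n
    using measurable_sets[OF count_measurable[OF cell_borel], of "{n}" x d i]
    by (simp add: vimage_def Int_def conj_commute)
  have eq: "{\<omega> \<in> space M. 2 \<le> card (P x \<omega> \<inter> cell d i)} = space M - (?E 0 \<union> ?E 1)" by auto
  show "{\<omega> \<in> space M. 2 \<le> card (P x \<omega> \<inter> cell d i)} \<in> events"
    unfolding eq using E by auto
  have "prob (?E 0 \<union> ?E 1) = prob (?E 0) + prob (?E 1)"
    by (rule finite_measure_Union) (use E in auto)
  also have "\<dots> = exp (- d) + d * exp (- d)" using assms by (simp add: prob_count)
  finally have "prob (space M - (?E 0 \<union> ?E 1)) = 1 - (1 + d) * exp (- d)"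
    using E by (subst prob_compl) (auto simp: algebra_simps)
  also have "\<dots> \<le> 1 - (1 + d) * (1 - d)"
    using exp_ge_add_one_self[of "- d"] assms by (intro diff_left_mono mult_left_mono) auto
  finally show "prob {\<omega> \<in> space M. 2 \<le> card (P x \<omega> \<inter> cell d i)} \<le> d\<^sup>2"
    unfolding eq by (simp add: algebra_simps power2_eq_square)
qed

text \<open>
  A cell violates the condition by two rings of one clock or by rings of two clocks; each has
  probability at most \<open>d\<^sup>2\<close>. With \<open>N\<close> of order \<open>1 / d\<close> the total is of order \<open>d\<close>.
\<close>

lemma prob_not_separated:
  assumes d: "0 < d" and V: "finite V"
  obtains A where "A \<in> events" "prob A \<le> real N * (real (card V) + real (card V) * real (card V)) * d\<^sup>2"
    "\<And>\<omega>. \<omega> \<in> space M \<Longrightarrow> \<omega> \<notin> A \<Longrightarrow> separated V d N (\<lambda>x. P x \<omega>)"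
proof -
  define T where "T i x = {\<omega> \<in> space M. 2 \<le> card (P x \<omega> \<inter> cell d i)}" for i x
  define Q where "Q i z = (if fst z = snd z then {} else
      {\<omega> \<in> space M. \<forall>x\<in>{fst z, snd z}. card (P x \<omega> \<inter> cell d i) \<noteq> 0})" for i :: nat and z :: "'v \<times> 'v"
  define A where "A = (\<Union>i<N. (\<Union>x\<in>V. T i x) \<union> (\<Union>z\<in>V \<times> V. Q i z))"
  have T: "T i x \<in> events" "prob (T i x) \<le> d\<^sup>2" for i x
    unfolding T_def using prob_two_rings[OF d] by auto
  have Q: "Q i z \<in> events \<and> prob (Q i z) \<le> d\<^sup>2" for i z
  proof (cases "fst z = snd z")
    case False
    have "prob (Q i z) = (1 - exp (- d)) ^ card {fst z, snd z}"
      unfolding Q_def using False prob_all_ring(2)[OF d, of "{fst z, snd z}" i] by (simp only: if_False) simp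
    also have "card {fst z, snd z} = 2" using False by simp
    also have "(1 - exp (- d))\<^sup>2 \<le> d\<^sup>2"
    proof (rule power_mono)
      show "1 - exp (- d) \<le> d" using exp_ge_add_one_self[of "- d"] by simp
      show "0 \<le> 1 - exp (- d)" using d by simp
    qed
    finally have "prob (Q i z) \<le> d\<^sup>2" .
    moreover have "Q i z = {\<omega> \<in> space M. \<forall>x\<in>{fst z, snd z}. card (P x \<omega> \<inter> cell d i) \<noteq> 0}"
      using False by (simp add: Q_def)
    then have "Q i z \<in> events" using prob_all_ring(1)[OF d, of "{fst z, snd z}" i] by simp
    ultimately show ?thesis by blast
  qed (simp add: Q_def)
  have UT: "(\<Union>x\<in>V. T i x) \<in> events" for i by (rule sets.finite_UN[OF V]) (rule T)
  have UQ: "(\<Union>z\<in>V \<times> V. Q i z) \<in> events" for i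
    by (rule sets.finite_UN) (use V Q in blast)+
  have U: "(\<Union>x\<in>V. T i x) \<union> (\<Union>z\<in>V \<times> V. Q i z) \<in> events" for i
    by (rule sets.Un[OF UT UQ])
  have cell: "prob ((\<Union>x\<in>V. T i x) \<union> (\<Union>z\<in>V \<times> V. Q i z)) \<le> (card V + card V * card V) * d\<^sup>2" for i
  proof -
    have "prob ((\<Union>x\<in>V. T i x) \<union> (\<Union>z\<in>V \<times> V. Q i z)) \<le> prob (\<Union>x\<in>V. T i x) + prob (\<Union>z\<in>V \<times> V. Q i z)"
      by (rule measure_Un_le[OF UT UQ])
    also have "prob (\<Union>x\<in>V. T i x) \<le> (\<Sum>x\<in>V. prob (T i x))"
      by (rule finite_measure_subadditive_finite[OF V]) (use T in blast)
    also have "\<dots> \<le> (\<Sum>x\<in>V. d\<^sup>2)" by (intro sum_mono T)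
    also have "prob (\<Union>z\<in>V \<times> V. Q i z) \<le> (\<Sum>z\<in>V \<times> V. prob (Q i z))"
      by (rule finite_measure_subadditive_finite) (use Q V in blast)+
    also have "\<dots> \<le> (\<Sum>z\<in>V \<times> V. d\<^sup>2)" by (intro sum_mono) (use Q in blast)
    finally show ?thesis by (simp add: algebra_simps card_cartesian_product)
  qed
  have "prob A \<le> (\<Sum>i<N. prob ((\<Union>x\<in>V. T i x) \<union> (\<Union>z\<in>V \<times> V. Q i z)))"
    unfolding A_def by (rule finite_measure_subadditive_finite) (use U in blast)+
  also have "\<dots> \<le> (\<Sum>i<N. (card V + card V * card V) * d\<^sup>2)" by (intro sum_mono cell)
  finally have "prob A \<le> real N * (real (card V) + real (card V) * real (card V)) * d\<^sup>2"
    by (simp add: mult.assoc)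
  moreover have "A \<in> events" unfolding A_def by (rule sets.finite_UN) (use U in auto)
  moreover have "separated V d N (\<lambda>x. P x \<omega>)" if \<omega>: "\<omega> \<in> space M" "\<omega> \<notin> A" for \<omega>
    unfolding separated_def
  proof (intro allI impI conjI ballI)
    fix i x assume i: "i < N" and x: "x \<in> V"
    show "card (P x \<omega> \<inter> cell d i) \<le> 1"
    proof (rule ccontr)
      assume "\<not> ?thesis"
      then have "\<omega> \<in> T i x" using \<omega> by (simp add: T_def)
      then show False using i x \<omega> by (auto simp: A_def)
    qed
    fix y assume y: "y \<in> V" "x \<noteq> y"
    show "card (P x \<omega> \<inter> cell d i) = 0 \<or> card (P y \<omega> \<inter> cell d i) = 0"
    proof (rule ccontr)
      assume "\<not> ?thesis"
      then have "\<omega> \<in> Q i (x, y)" using \<omega> y by (simp add: Q_def)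
      moreover have "(x, y) \<in> V \<times> V" using x y by simp
      ultimately show False using i \<omega> unfolding A_def by blast
    qed
  qed
  ultimately show ?thesis using that by blast
qed

end

context marked_clocks
begin

text \<open>
  The clocks along a self-avoiding walk are independent, so all of its \<open>n\<close> vertices ring with
  probability at most \<open>s ^ n\<close>, and there are at most \<open>D ^ n\<close> walks from each starting point.
\<close>

lemma prob_ring_walk:
  assumes nb: "\<And>x. finite (nbrs E x)" "\<And>x. card (nbrs E x) \<le> D" and s: "0 < s" "D * s \<le> 1 / 2" and D: "0 < D"
    and X: "finite X" and n: "0 < n"
  obtains A where "A \<in> events" "prob A \<le> card X * (1 / 2) ^ n"
    "\<And>\<omega> x w. \<omega> \<in> space M \<Longrightarrow> \<omega> \<notin> A \<Longrightarrow> x \<in> X \<Longrightarrow> walk (nbrs E) w \<Longrightarrow> hd w = x \<Longrightarrow> length w = n \<Longrightarrow>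
       distinct w \<Longrightarrow> \<exists>y\<in>set w. P y \<omega> \<inter> cell s b = {}"
proof -
  define W where "W x = {w. walk (nbrs E) w \<and> hd w = x \<and> length w = n}" for x
  define R where "R w = (if distinct w then {\<omega> \<in> space M. \<forall>y\<in>set w. card (P y \<omega> \<inter> cell s b) \<noteq> 0} else {})" for w
  define A where "A = (\<Union>x\<in>X. \<Union>w\<in>W x. R w)"
  have W: "finite (W x) \<and> card (W x) \<le> D ^ n" for x
  proof -
    have Suc: "n = Suc (n - 1)" using n by simp
    have "finite (W x) \<and> card (W x) \<le> D ^ (n - 1)"
      unfolding W_def by (subst (1 2) Suc) (rule card_walks[OF nb])
    moreover have "D ^ (n - 1) \<le> D ^ n" by (rule power_increasing) (use D in auto)
    ultimately show ?thesis by (meson order_trans)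
  qed
  have R: "R w \<in> events \<and> prob (R w) \<le> s ^ n" if "w \<in> W x" for w x
  proof (cases "distinct w")
    case True
    have "prob (R w) = (1 - exp (- s)) ^ card (set w)"
      unfolding R_def using True prob_all_ring(2)[OF s(1), of "set w" b] by (simp only: if_True) simp
    also have "card (set w) = n" using True that by (simp add: distinct_card W_def)
    also have "(1 - exp (- s)) ^ n \<le> s ^ n"
    proof (rule power_mono)
      show "1 - exp (- s) \<le> s" using exp_ge_add_one_self[of "- s"] by simp
      show "0 \<le> 1 - exp (- s)" using s by simp
    qed
    finally have "prob (R w) \<le> s ^ n" .
    moreover have "R w = {\<omega> \<in> space M. \<forall>y\<in>set w. card (P y \<omega> \<inter> cell s b) \<noteq> 0}"
      using True by (simp add: R_def)
    then have "R w \<in> events" using prob_all_ring(1)[OF s(1), of "set w" b] by simp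
    ultimately show ?thesis by blast
  qed (use s in \<open>simp add: R_def\<close>)
  have UW: "(\<Union>w\<in>W x. R w) \<in> events" for x
    by (rule sets.finite_UN) (use W R in blast)+
  have pW: "prob (\<Union>w\<in>W x. R w) \<le> (1 / 2) ^ n" for x
  proof -
    have "prob (\<Union>w\<in>W x. R w) \<le> (\<Sum>w\<in>W x. prob (R w))"
      by (rule finite_measure_subadditive_finite) (use W R in blast)+
    also have "\<dots> \<le> (\<Sum>w\<in>W x. s ^ n)" by (rule sum_mono) (use R in blast)
    also have "\<dots> = real (card (W x)) * s ^ n" by simp
    also have "\<dots> \<le> real (D ^ n) * s ^ n"
    proof (rule mult_right_mono)
      have "card (W x) \<le> D ^ n" using W by blast
      then show "real (card (W x)) \<le> real (D ^ n)" by (rule of_nat_mono)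
    qed (use s in simp)
    also have "\<dots> = (D * s) ^ n" by (simp add: power_mult_distrib)
    also have "\<dots> \<le> (1 / 2) ^ n" by (rule power_mono[OF s(2)]) (use s in simp)
    finally show ?thesis .
  qed
  have "A \<in> events" unfolding A_def by (rule sets.finite_UN[OF X UW])
  moreover have "prob A \<le> card X * (1 / 2) ^ n"
  proof -
    have "prob A \<le> (\<Sum>x\<in>X. prob (\<Union>w\<in>W x. R w))"
      unfolding A_def by (rule finite_measure_subadditive_finite[OF X]) (use UW in blast)
    also have "\<dots> \<le> (\<Sum>x\<in>X. (1 / 2) ^ n)" by (rule sum_mono) (rule pW)
    finally show ?thesis by simp
  qed
  moreover have "\<exists>y\<in>set w. P y \<omega> \<inter> cell s b = {}"
    if \<omega>: "\<omega> \<in> space M" "\<omega> \<notin> A" and w: "x \<in> X" "walk (nbrs E) w" "hd w = x" "length w = n" "distinct w" for \<omega> x w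
  proof (rule ccontr)
    assume no: "\<not> ?thesis"
    have "card (P y \<omega> \<inter> cell s b) \<noteq> 0" if "y \<in> set w" for y
    proof -
      have "finite (P y \<omega> \<inter> {..s * real (Suc b)})"
        using clock_points[OF \<omega>(1), of y] by (simp add: point_sets_def)
      then have "finite (P y \<omega> \<inter> cell s b)" by (rule rev_finite_subset) (auto simp: cell_def)
      then show ?thesis using no that by simp
    qed
    then have "\<omega> \<in> R w" using \<omega> w by (simp add: R_def)
    moreover have "w \<in> W x" using w by (simp add: W_def)
    ultimately have "\<omega> \<in> A" using w(1) unfolding A_def by blast
    then show False using \<omega> by simp
  qed
  ultimately show ?thesis using that by blast
qed

end

lemma rtrancl_path_walk:
  assumes "rtrancl_path (ring_step E c s b) x ys z"
  shows "walk (nbrs E) (x # ys)" "last (x # ys) = z" "\<And>y. y \<in> set (butlast (x # ys)) \<Longrightarrow> c y \<inter> cell s b \<noteq> {}"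
  using assms
proof (induction rule: rtrancl_path.induct)
  case (base x)
  { case 1 then show ?case by (simp add: walk_def) }
  { case 2 then show ?case by simp }
  { case (3 y) then show ?case by simp }
next
  case (step x y ys z)
  { case 1 then show ?case using step by (auto simp: walk_def ring_step_def) }
  { case 2 then show ?case using step by simp }
  { case (3 u) then show ?case using step by (auto simp: ring_step_def split: if_splits) }
qed

lemma walk_take: "walk N w \<Longrightarrow> 0 < n \<Longrightarrow> walk N (take n w)"
  unfolding walk_def by (metis append_take_drop_id successively_append_iff take_eq_Nil neq0_conv)

lemma within_steps_walk:
  "walk (nbrs E) (x # ys) \<Longrightarrow> length ys \<le> n \<Longrightarrow> within_steps E n x (last (x # ys))"
proof (induction ys arbitrary: n rule: rev_induct)
  case Nil
  then show ?case by (simp add: within_steps_refl)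
next
  case (snoc y ys)
  obtain m where m: "n = Suc m" using snoc.prems(2) by (cases n) auto
  have w: "walk (nbrs E) (x # ys)" "y \<in> nbrs E (last (x # ys))"
  proof -
    have "successively (\<lambda>x y. y \<in> nbrs E x) ((x # ys) @ [y])" using snoc.prems(1) by (simp add: walk_def)
    then show "walk (nbrs E) (x # ys)" "y \<in> nbrs E (last (x # ys))"
      unfolding successively_append_iff walk_def by simp_all
  qed
  have "within_steps E m x (last (x # ys))"
    by (rule snoc.IH[OF w(1)]) (use snoc.prems(2) m in simp)
  from within_steps_Suc[OF this w(2)] show ?case by (simp add: m)
qed

text \<open>A shortest path of ring steps is self-avoiding, and all its vertices except the last one ring.\<close>

lemma ring_reach_within:
  assumes "\<And>w. walk (nbrs E) w \<Longrightarrow> hd w = x \<Longrightarrow> length w = n \<Longrightarrow> distinct w \<Longrightarrow> \<exists>y\<in>set w. c y \<inter> cell s b = {}"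
    and "0 < n" and "(ring_step E c s b)\<^sup>*\<^sup>* x z"
  shows "within_steps E n x z"
proof -
  from assms(3) obtain zs where "rtrancl_path (ring_step E c s b) x zs z"
    by (auto simp: rtranclp_eq_rtrancl_path)
  then obtain ys where ys: "rtrancl_path (ring_step E c s b) x ys z" "distinct (x # ys)"
    using rtrancl_path_distinct by metis
  note w = rtrancl_path_walk[OF ys(1)]
  have "length ys < n"
  proof (rule ccontr)
    assume *: "\<not> length ys < n"
    let ?w = "take n (x # ys)"
    have "walk (nbrs E) ?w" by (rule walk_take[OF w(1) assms(2)])
    moreover have "hd ?w = x" using assms(2) by (simp add: take_Cons')
    moreover have "length ?w = n" using * by simp
    moreover have "distinct ?w" by (rule distinct_take[OF ys(2)])
    ultimately obtain y where y: "y \<in> set ?w" "c y \<inter> cell s b = {}" using assms(1) by blast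
    have "?w = take n (butlast (x # ys))" using * by (simp add: butlast_conv_take min_def)
    then have "y \<in> set (butlast (x # ys))" using y(1) by (metis in_set_takeD)
    then show False using w(3) y(2) by blast
  qed
  then have "length ys \<le> n" by simp
  from within_steps_walk[OF w(1) this] show ?thesis unfolding w(2) .
qed

lemma finite_within_steps:
  assumes "\<And>x. finite (nbrs E x)"
  shows "finite {y. within_steps E n x y}"
proof (induction n)
  case 0
  have "{y. within_steps E 0 x y} = {x}" by (auto simp: within_steps_def)
  then show ?case by simp
next
  case (Suc n)
  have "{y. within_steps E (Suc n) x y} \<subseteq> {y. within_steps E n x y} \<union> (\<Union>z\<in>{y. within_steps E n x y}. nbrs E z)"
  proof
    fix y assume "y \<in> {y. within_steps E (Suc n) x y}"
    then obtain i where i: "i \<le> Suc n" "(x, y) \<in> adj_rel E ^^ i" by (auto simp: within_steps_def)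
    show "y \<in> {y. within_steps E n x y} \<union> (\<Union>z\<in>{y. within_steps E n x y}. nbrs E z)"
    proof (cases "i \<le> n")
      case True
      then show ?thesis using i by (auto simp: within_steps_def)
    next
      case False
      then have "i = Suc n" using i by simp
      then obtain z where "(x, z) \<in> adj_rel E ^^ n" "(z, y) \<in> adj_rel E" using i by auto
      then have "within_steps E n x z" "y \<in> nbrs E z" by (auto simp: within_steps_def adj_rel_def nbrs_def)
      then show ?thesis by auto
    qed
  qed
  then show ?case by (rule finite_subset) (use Suc assms in auto)
qed

context marked_clocks
begin

text \<open>
  The regions are built backwards in time, each from the next one by adding a ball so large that
  ringing walks rarely leave it.
\<close>

lemma influence_regions:
  assumes nb: "\<And>x. finite (nbrs E x)" "\<And>x. card (nbrs E x) \<le> D" and s: "0 < s" "D * s \<le> 1 / 2" and D: "0 < D"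
    and S: "finite S" and \<delta>: "0 < \<delta>"
  shows "\<exists>W A. A \<in> events \<and> prob A \<le> \<delta> \<and> (\<forall>b. finite (W b)) \<and> W B = S \<and>
     (\<forall>b<B. W (Suc b) \<subseteq> W b) \<and>
     (\<forall>\<omega>\<in>space M - A. \<forall>b<B. \<forall>x\<in>W (Suc b). \<forall>y. (ring_step E (\<lambda>x. P x \<omega>) s b)\<^sup>*\<^sup>* x y \<longrightarrow> y \<in> W b)"
  using S \<delta>
proof (induction B arbitrary: S \<delta>)
  case 0
  show ?case by (rule exI[of _ "\<lambda>_. S"], rule exI[of _ "{}"]) (use 0 in auto)
next
  case (Suc B)
  obtain n0 where n0: "(1 / 2) ^ n0 < \<delta> / (2 * (card S + 1))"
    using real_arch_pow_inv[of "\<delta> / (2 * (card S + 1))" "1 / 2"] Suc.prems by auto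
  define n where "n = Suc n0"
  have "(1 / 2 :: real) ^ n \<le> (1 / 2) ^ n0" unfolding n_def by (rule power_decreasing) auto
  then have n: "real (card S) * (1 / 2) ^ n \<le> \<delta> / 2"
  proof -
    have "(1 / 2) ^ n \<le> \<delta> / (2 * (card S + 1))"
      using \<open>(1 / 2 :: real) ^ n \<le> (1 / 2) ^ n0\<close> n0 by linarith
    then have "real (card S) * (1 / 2) ^ n \<le> (card S + 1) * (\<delta> / (2 * (card S + 1)))"
      by (intro mult_mono) auto
    also have "\<dots> = \<delta> / 2" by (simp add: field_simps)
    finally show ?thesis .
  qed
  obtain A1 where A1: "A1 \<in> events" "prob A1 \<le> card S * (1 / 2) ^ n"
    "\<And>\<omega> x w. \<omega> \<in> space M \<Longrightarrow> \<omega> \<notin> A1 \<Longrightarrow> x \<in> S \<Longrightarrow> walk (nbrs E) w \<Longrightarrow> hd w = x \<Longrightarrow> length w = n \<Longrightarrow>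
       distinct w \<Longrightarrow> \<exists>y\<in>set w. P y \<omega> \<inter> cell s B = {}"
    using prob_ring_walk[OF nb s D Suc.prems(1), of n B] by (auto simp: n_def)
  define T where "T = (\<Union>x\<in>S. {y. within_steps E n x y})"
  have T: "finite T" unfolding T_def using Suc.prems(1) finite_within_steps[OF nb(1)] by auto
  have ST: "S \<subseteq> T" unfolding T_def using within_steps_refl by fast
  have "0 < \<delta> / 2" using Suc.prems(2) by simp
  from Suc.IH[OF T this] obtain W A where WA: "A \<in> events \<and> prob A \<le> \<delta> / 2 \<and> (\<forall>b. finite (W b)) \<and> W B = T \<and>
     (\<forall>b<B. W (Suc b) \<subseteq> W b) \<and>
     (\<forall>\<omega>\<in>space M - A. \<forall>b<B. \<forall>x\<in>W (Suc b). \<forall>y. (ring_step E (\<lambda>x. P x \<omega>) s b)\<^sup>*\<^sup>* x y \<longrightarrow> y \<in> W b)"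
    by (elim exE)
  then have W: "A \<in> events" "prob A \<le> \<delta> / 2"
    "\<And>b. finite (W b)" "W B = T" "\<And>b. b < B \<Longrightarrow> W (Suc b) \<subseteq> W b"
    "\<And>\<omega> b x y. \<omega> \<in> space M - A \<Longrightarrow> b < B \<Longrightarrow> x \<in> W (Suc b) \<Longrightarrow>
        (ring_step E (\<lambda>x. P x \<omega>) s b)\<^sup>*\<^sup>* x y \<Longrightarrow> y \<in> W b"
    by simp_all
  define W' where "W' = W(Suc B := S)"
  have W'_le: "W' b = W b" if "b \<le> B" for b using that by (simp add: W'_def)
  have W'_Suc: "W' (Suc B) = S" by (simp add: W'_def)
  show ?case
  proof (intro exI[of _ W'] exI[of _ "A \<union> A1"] conjI allI impI ballI)
    show "A \<union> A1 \<in> events" using W A1 by auto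
    have "prob (A \<union> A1) \<le> prob A + prob A1" by (rule measure_Un_le) (use W A1 in auto)
    then show "prob (A \<union> A1) \<le> \<delta>" using W(2) A1(2) n by linarith
    show "finite (W' b)" for b using W(3) Suc.prems by (simp add: W'_def)
    show "W' (Suc B) = S" by (rule W'_Suc)
    show "W' (Suc b) \<subseteq> W' b" if "b < Suc B" for b
    proof (cases "b = B")
      case True
      then show ?thesis using ST W(4) W'_le[of B] W'_Suc by simp
    next
      case False
      then have "b < B" using that by simp
      then show ?thesis using W(5)[of b] W'_le[of b] W'_le[of "Suc b"] by simp
    qed
    fix \<omega> b x y assume \<omega>: "\<omega> \<in> space M - (A \<union> A1)" and b: "b < Suc B" and x: "x \<in> W' (Suc b)"
      and r: "(ring_step E (\<lambda>x. P x \<omega>) s b)\<^sup>*\<^sup>* x y"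
    show "y \<in> W' b"
    proof (cases "b = B")
      case True
      have xS: "x \<in> S" using x W'_Suc True by simp
      have "within_steps E n x y"
      proof (rule ring_reach_within[of E x n "\<lambda>x. P x \<omega>" s b])
        show "\<exists>y\<in>set w. P y \<omega> \<inter> cell s b = {}"
          if "walk (nbrs E) w" "hd w = x" "length w = n" "distinct w" for w
          using A1(3)[of \<omega> x w] that \<omega> xS True by auto
      qed (use r n_def in auto)
      then have "y \<in> T" using xS unfolding T_def by blast
      then show ?thesis using W(4) W'_le[of B] True by simp
    next
      case False
      then have "b < B" using b by simp
      then show ?thesis using W(6)[of \<omega> b x y] \<omega> x r W'_le[of b] W'_le[of "Suc b"] by simp
    qed
  qed
qed

end

section \<open>Comparison of the model with the discrete dynamics\<close>

context FA_model
begin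

text \<open>The initial state is independent of the clocks and the marks, hence of the symbols.\<close>

lemma joint_law:
  fixes \<xi> :: "'v config" and N :: nat and a :: "nat \<times> 'v \<Rightarrow> bool option"
  assumes mu: "\<mu>\<^sub>0 = bernoulli_product p" and V: "finite V" and d: "0 < d" and q: "q \<in> {0..1}"
  defines "Ev \<equiv> {\<omega> \<in> space M. (\<forall>x\<in>V. \<eta> 0 \<omega> x = \<xi> x) \<and>
      (\<forall>e\<in>{..<N} \<times> V. cell_symbol q d (clocks \<omega>) (marks \<omega>) e = a e)}"
  shows "Ev \<in> events"
    and "prob Ev = (\<Prod>x\<in>V. pmf (bernoulli_pmf p) (\<xi> x)) *
       (\<Prod>e\<in>{..<N} \<times> V. pmf (symbol_pmf (1 - exp (- d)) q) (a e))"
proof -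
  let ?I = "{\<eta>. \<forall>x\<in>V. \<eta> x = \<xi> x}"
  let ?cm = "\<lambda>\<omega>. (clocks \<omega>, marks \<omega>)"
  let ?S = "symbols_event q d N V a"
  have I: "?I \<in> sets config_space"
    using cylinder_measurable[OF V, of \<xi>] by (simp add: space_bernoulli_product)
  have S: "?S \<in> sets (PiM UNIV (\<lambda>_. point_configs) \<Otimes>\<^sub>M PiM UNIV (\<lambda>_. borel))"
    by (rule symbols_event_measurable[OF V])
  have e0: "\<eta> 0 \<in> M \<rightarrow>\<^sub>M config_space" by (rule state_measurable) simp
  have cm: "?cm \<in> M \<rightarrow>\<^sub>M PiM UNIV (\<lambda>_. point_configs) \<Otimes>\<^sub>M PiM UNIV (\<lambda>_. borel)"
    using initial_indep by (simp add: indep_rvs_def)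
  have ev: "Ev = (\<eta> 0 -` ?I \<inter> space M) \<inter> (?cm -` ?S \<inter> space M)"
  proof (rule set_eqI)
    fix \<omega>
    show "\<omega> \<in> Ev \<longleftrightarrow> \<omega> \<in> (\<eta> 0 -` ?I \<inter> space M) \<inter> (?cm -` ?S \<inter> space M)"
    proof (cases "\<omega> \<in> space M")
      case True
      then show ?thesis
        unfolding Ev_def Int_iff vimage_eq mem_Collect_eq symbols_event_iff[OF True] by simp
    qed (simp add: Ev_def)
  qed
  show "Ev \<in> events"
    unfolding ev by (rule sets.Int[OF measurable_sets[OF e0 I] measurable_sets[OF cm S]])
  have "prob Ev = prob (\<eta> 0 -` ?I \<inter> space M) * prob (?cm -` ?S \<inter> space M)"
    unfolding ev
  proof (rule indep_setD)
    show "indep_set {\<eta> 0 -` A \<inter> space M |A. A \<in> sets config_space}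
        {?cm -` B \<inter> space M |B. B \<in> sets (PiM UNIV (\<lambda>_. point_configs) \<Otimes>\<^sub>M PiM UNIV (\<lambda>_. borel))}"
      using initial_indep unfolding indep_rvs_def by blast
  qed (use I S in blast)+
  also have "prob (\<eta> 0 -` ?I \<inter> space M) = measure (distr M config_space (\<eta> 0)) ?I"
    using measure_distr[OF e0 I] by simp
  also have "\<dots> = (\<Prod>x\<in>V. pmf (bernoulli_pmf p) (\<xi> x))"
    unfolding initial_law mu by (rule bernoulli_product_cylinder[OF V])
  also have "prob (?cm -` ?S \<inter> space M) = (\<Prod>e\<in>{..<N} \<times> V. pmf (symbol_pmf (1 - exp (- d)) q) (a e))"
    by (rule prob_symbols[OF V d q])
  finally show "prob Ev = (\<Prod>x\<in>V. pmf (bernoulli_pmf p) (\<xi> x)) *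
       (\<Prod>e\<in>{..<N} \<times> V. pmf (symbol_pmf (1 - exp (- d)) q) (a e))" .
qed

lemma expectation_discrete:
  fixes g :: "'v config \<times> (nat \<times> 'v \<Rightarrow> bool option) \<Rightarrow> real" and N :: nat
  assumes mu: "\<mu>\<^sub>0 = bernoulli_product p" and V: "finite V" and d: "0 < d" and q: "q \<in> {0..1}"
  defines "Z \<equiv> \<lambda>\<omega>. (fill V True (\<eta> 0 \<omega>), fill ({..<N} \<times> V) None (cell_symbol q d (clocks \<omega>) (marks \<omega>)))"
  shows "expectation (\<lambda>\<omega>. g (Z \<omega>)) =
      measure_pmf.expectation (pair_pmf (product_pmf V p) (field_pmf V N (1 - exp (- d)) q)) g"
    and "(\<lambda>\<omega>. g (Z \<omega>)) \<in> borel_measurable M"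
proof -
  let ?J = "{..<N} \<times> V"
  let ?F1 = "PiE_dflt V True (\<lambda>_. UNIV :: bool set)" and ?F2 = "PiE_dflt ?J None (\<lambda>_. UNIV :: bool option set)"
  let ?Q = "pair_pmf (product_pmf V p) (field_pmf V N (1 - exp (- d)) q)"
  have J: "finite ?J" using V by simp
  have fin: "finite (?F1 \<times> ?F2)"
    by (rule finite_cartesian_product[OF finite_PiE_dflt_UNIV[OF V] finite_PiE_dflt_UNIV[OF J]])
  have Zin: "Z \<omega> \<in> ?F1 \<times> ?F2" for \<omega>
    unfolding Z_def by (intro SigmaI fill_PiE_dflt)
  have ev: "{\<omega> \<in> space M. Z \<omega> = z} = {\<omega> \<in> space M. (\<forall>x\<in>V. \<eta> 0 \<omega> x = fst z x) \<and>
      (\<forall>e\<in>?J. cell_symbol q d (clocks \<omega>) (marks \<omega>) e = snd z e)}" if "z \<in> ?F1 \<times> ?F2" for z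
  proof -
    have f: "fst z \<in> ?F1" "snd z \<in> ?F2" using that by auto
    show ?thesis unfolding Z_def prod_eq_iff fst_conv snd_conv fill_eq_iff[OF f(1)] fill_eq_iff[OF f(2)] ..
  qed
  have meas: "{\<omega> \<in> space M. Z \<omega> = z} \<in> events" if "z \<in> ?F1 \<times> ?F2" for z
    unfolding ev[OF that] by (rule joint_law(1)[OF mu V d q])
  have pz: "prob {\<omega> \<in> space M. Z \<omega> = z} = pmf ?Q z" if z: "z \<in> ?F1 \<times> ?F2" for z
  proof -
    have f: "\<And>x. x \<notin> V \<Longrightarrow> fst z x = True" "\<And>e. e \<notin> ?J \<Longrightarrow> snd z e = None"
    proof -
      have "fst z \<in> ?F1" "snd z \<in> ?F2" using z by auto
      then show "\<And>x. x \<notin> V \<Longrightarrow> fst z x = True" "\<And>e. e \<notin> ?J \<Longrightarrow> snd z e = None"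
        by (simp_all only: PiE_dflt_def mem_Collect_eq UNIV_I simp_thms)
    qed
    have "pmf ?Q z = pmf (product_pmf V p) (fst z) * pmf (field_pmf V N (1 - exp (- d)) q) (snd z)"
      by (metis pmf_pair prod.collapse)
    also have "\<dots> = (\<Prod>x\<in>V. pmf (bernoulli_pmf p) (fst z x)) *
       (\<Prod>e\<in>?J. pmf (symbol_pmf (1 - exp (- d)) q) (snd z e))"
      unfolding field_pmf_def using pmf_Pi'[OF V f(1)] pmf_Pi'[OF J f(2)] by simp
    finally show ?thesis unfolding ev[OF z] using joint_law(2)[OF mu V d q, of "fst z" N "snd z"] by simp
  qed
  have sub: "set_pmf ?Q \<subseteq> ?F1 \<times> ?F2"
  proof
    fix z assume "z \<in> set_pmf ?Q"
    then have "fst z \<in> set_pmf (product_pmf V p)" "snd z \<in> set_pmf (field_pmf V N (1 - exp (- d)) q)" by auto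
    note z = this[unfolded field_pmf_def]
    have *: "\<forall>x. x \<notin> V \<longrightarrow> fst z x = True" "\<forall>e. e \<notin> ?J \<longrightarrow> snd z e = None"
      using subsetD[OF set_Pi_pmf_subset[OF V] z(1)] subsetD[OF set_Pi_pmf_subset[OF J] z(2)]
      unfolding mem_Collect_eq .
    have "fst z \<in> ?F1" "snd z \<in> ?F2" using * by (simp_all only: PiE_dflt_def mem_Collect_eq UNIV_I simp_thms)
    then show "z \<in> ?F1 \<times> ?F2" by (metis mem_Times_iff)
  qed
  have "expectation (\<lambda>\<omega>. g (Z \<omega>)) = (\<Sum>z\<in>?F1 \<times> ?F2. g z * prob {\<omega> \<in> space M. Z \<omega> = z})"
    by (rule expectation_finite_range(1)[OF prob_space_axioms fin Zin meas])
  also have "\<dots> = (\<Sum>z\<in>?F1 \<times> ?F2. g z * pmf ?Q z)"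
    by (rule sum.cong[OF refl]) (simp only: pz)
  also have "\<dots> = measure_pmf.expectation ?Q g"
    by (rule integral_measure_pmf_real[symmetric, OF fin]) (use sub in blast)
  finally show "expectation (\<lambda>\<omega>. g (Z \<omega>)) = measure_pmf.expectation ?Q g" .
  show "(\<lambda>\<omega>. g (Z \<omega>)) \<in> borel_measurable M"
    by (rule expectation_finite_range(2)[OF prob_space_axioms fin Zin meas])
qed

lemma local_measurable:
  fixes f :: "'v config \<Rightarrow> real"
  assumes S: "finite S" and f: "\<And>\<eta> \<eta>'. (\<And>x. x \<in> S \<Longrightarrow> \<eta> x = \<eta>' x) \<Longrightarrow> f \<eta> = f \<eta>'" and t: "0 \<le> t"
  shows "(\<lambda>\<omega>. f (\<eta> t \<omega>)) \<in> borel_measurable M"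
proof -
  let ?F = "PiE_dflt S True (\<lambda>_. UNIV :: bool set)"
  have fin: "finite ?F" by (rule finite_PiE_dflt_UNIV[OF S])
  have "(\<lambda>\<omega>. f (fill S True (\<eta> t \<omega>))) \<in> borel_measurable M"
  proof (rule expectation_finite_range(2)[OF prob_space_axioms fin fill_PiE_dflt])
    fix z :: "'v config" assume z: "z \<in> ?F"
    have m: "\<eta> t \<in> M \<rightarrow>\<^sub>M config_space" by (rule state_measurable[OF t])
    have "{\<omega> \<in> space M. fill S True (\<eta> t \<omega>) = z} = \<eta> t -` {\<eta> \<in> space config_space. \<forall>x\<in>S. \<eta> x = z x} \<inter> space M"
      unfolding fill_eq_iff[OF z] by (auto simp: space_bernoulli_product)
    then show "{\<omega> \<in> space M. fill S True (\<eta> t \<omega>) = z} \<in> events"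
      using measurable_sets[OF m cylinder_measurable[OF S, of z]] by simp
  qed
  moreover have "f \<eta> = f (fill S True \<eta>)" for \<eta> by (rule f) (simp add: fill_def)
  ultimately show ?thesis by simp
qed

text \<open>
  The regions of influence fix the finite volume first; only then is the mesh chosen so fine that
  the rings in this volume are separated. Outside the volume the discrete system is frozen at one.
  This is harmless, since it cannot be noticed on \<open>S\<close> off the exceptional event.
\<close>

lemma discretisation:
  fixes s :: real and B :: nat
  assumes E: "simple_graph E" and nb: "\<And>x. finite (nbrs E x)" "\<And>x. card (nbrs E x) \<le> D" and D: "0 < D"
    and s: "0 < s" "D * s \<le> 1 / 2" and S: "finite S" and \<delta>: "0 < \<delta>"
  obtains xs m A where "xs \<noteq> []" "distinct xs" "S \<subseteq> set xs" "0 < m" "A \<in> events" "prob A \<le> \<delta>"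
    "AE \<omega> in M. \<omega> \<notin> A \<longrightarrow> (\<forall>x\<in>S. \<eta> (s * real B) \<omega> x =
       trajectory E j (sweep xs) (fill ({..<m * B} \<times> set xs) None (cell_symbol q (s / real m) (clocks \<omega>) (marks \<omega>)))
         (fill (set xs) True (\<eta> 0 \<omega>)) (length xs * (m * B)) x)"
proof -
  have \<delta>2: "0 < \<delta> / 2" using \<delta> by simp
  from influence_regions[OF nb s D S \<delta>2, of B] obtain W A1 where
    WA: "A1 \<in> events \<and> prob A1 \<le> \<delta> / 2 \<and> (\<forall>b. finite (W b)) \<and> W B = S \<and>
     (\<forall>b<B. W (Suc b) \<subseteq> W b) \<and>
     (\<forall>\<omega>\<in>space M - A1. \<forall>b<B. \<forall>x\<in>W (Suc b). \<forall>y. (ring_step E (\<lambda>x. P x \<omega>) s b)\<^sup>*\<^sup>* x y \<longrightarrow> y \<in> W b)"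
    by (elim exE)
  then have A1: "A1 \<in> events" "prob A1 \<le> \<delta> / 2" and W: "\<And>b. finite (W b)" "W B = S"
    "\<And>b. b < B \<Longrightarrow> W (Suc b) \<subseteq> W b"
    and reach: "\<And>\<omega> b x y. \<omega> \<in> space M - A1 \<Longrightarrow> b < B \<Longrightarrow> x \<in> W (Suc b) \<Longrightarrow>
        (ring_step E (\<lambda>x. P x \<omega>) s b)\<^sup>*\<^sup>* x y \<Longrightarrow> y \<in> W b"
    by simp_all
  \<comment> \<open>an arbitrary vertex keeps the list of sites nonempty when \<open>S\<close> is empty\<close>
  define V where "V = insert undefined (W 0)"
  have V: "finite V" "V \<noteq> {}" using W by (auto simp: V_def)
  obtain xs where xs: "set xs = V" "distinct xs" using finite_distinct_list[OF V(1)] by blast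
  have SW: "S \<subseteq> W 0"
  proof -
    have "b \<le> B \<Longrightarrow> W B \<subseteq> W b" for b
    proof (induction "B - b" arbitrary: b)
      case (Suc k)
      then have "W B \<subseteq> W (Suc b)" by simp
      then show ?case using W(3)[of b] Suc by fastforce
    qed auto
    from this[of 0] show ?thesis using W(2) by simp
  qed
  define c where "c = real (card V) + real (card V) * real (card V)"
  obtain m0 :: nat where m0: "real m0 \<ge> 2 * (real B * c * s\<^sup>2) / \<delta>" using real_arch_simple by blast
  define m where "m = Suc m0"
  define d where "d = s / real m"
  have m: "0 < m" and d: "0 < d" using s by (auto simp: m_def d_def)
  obtain A2 where A2: "A2 \<in> events" "prob A2 \<le> real (m * B) * (real (card V) + real (card V) * real (card V)) * d\<^sup>2"
    "\<And>\<omega>. \<omega> \<in> space M \<Longrightarrow> \<omega> \<notin> A2 \<Longrightarrow> separated V d (m * B) (\<lambda>x. P x \<omega>)"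
    by (rule prob_not_separated[OF d V(1), of "m * B"]) (rule that)
  have "real (m * B) * (real (card V) + real (card V) * real (card V)) * d\<^sup>2 = real B * c * s\<^sup>2 / real m"
    unfolding c_def[symmetric] using m by (simp add: d_def power2_eq_square field_simps)
  also have "\<dots> \<le> \<delta> / 2"
  proof -
    have "2 * (real B * c * s\<^sup>2) / \<delta> \<le> real m" using m0 by (simp add: m_def)
    then show ?thesis using m \<delta> by (simp add: field_simps)
  qed
  finally have A2': "prob A2 \<le> \<delta> / 2" using A2(2) by linarith
  have "prob (A1 \<union> A2) \<le> prob A1 + prob A2" by (rule measure_Un_le[OF A1(1) A2(1)])
  then have pA: "prob (A1 \<union> A2) \<le> \<delta>" using A1(2) A2' by linarith
  have "AE \<omega> in M. \<omega> \<notin> A1 \<union> A2 \<longrightarrow> (\<forall>x\<in>S. \<eta> (s * real B) \<omega> x =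
       trajectory E j (sweep xs) (fill ({..<m * B} \<times> set xs) None (cell_symbol q d (clocks \<omega>) (marks \<omega>)))
         (fill (set xs) True (\<eta> 0 \<omega>)) (length xs * (m * B)) x)"
    using paths_cadlag dynamics AE_space
  proof eventually_elim
    case (elim \<omega>)
    show ?case
    proof (intro impI ballI)
      fix x assume A: "\<omega> \<notin> A1 \<union> A2" and x: "x \<in> S"
      have ps: "P y \<omega> \<in> point_sets" for y by (rule clock_points[OF elim(3)])
      interpret path: driven_path E j q "\<lambda>x. P x \<omega>" "\<lambda>x t. U x t \<omega>" "\<lambda>t. \<eta> t \<omega>"
      proof
        show "P y \<omega> \<subseteq> {0..}" "finite (P y \<omega> \<inter> {..b})" for y b
          using ps[of y] by (auto simp: point_sets_def)
        show "\<eta> t \<omega> y = (if t \<in> P y \<omega> \<and> j \<le> num_ones E (left_limit (\<lambda>t. \<eta> t \<omega>) t) y then U y t \<omega> \<le> q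
             else left_limit (\<lambda>t. \<eta> t \<omega>) t y)" if "0 < t" for y t
          using elim(2) that by blast
      qed (use E nb elim(1) in auto)
      have cl: "clocks \<omega> = (\<lambda>x. P x \<omega>)" by (simp add: clocks_def)
      have mk: "marks \<omega> = (\<lambda>(x, n). U x (nth_point (P x \<omega>) n) \<omega>)" by (simp add: marks_def)
      let ?\<xi> = "fill (set xs) True (\<eta> 0 \<omega>)"
      let ?a = "cell_symbol q d (clocks \<omega>) (marks \<omega>)"
      have "\<eta> (s * real B) \<omega> x = trajectory E j (sweep xs) ?a ?\<xi> (length xs * (m * B)) x"
        unfolding cl mk d_def
      proof (rule path.cell_trajectory[where W = W and B = B and b = B])
        show "distinct xs" "0 < s" "0 < m" by (rule xs(2) s(1) m)+
        show "W (Suc b) \<subseteq> W b" if "b < B" for b by (rule W(3)[OF that])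
        show "separated (set xs) (s / real m) (m * B) (\<lambda>x. P x \<omega>)"
          using A2(3)[OF elim(3)] A unfolding xs(1) d_def by simp
        show "W 0 \<subseteq> set xs" unfolding xs(1) V_def by blast
        show "y \<in> W b" if "b < B" "x \<in> W (Suc b)" "(ring_step E (\<lambda>x. P x \<omega>) s b)\<^sup>*\<^sup>* x y" for b x y
          by (rule reach[OF _ that]) (use elim(3) A in simp)
        show "?\<xi> x = \<eta> 0 \<omega> x" if "x \<in> set xs" for x using that by (simp add: fill_def)
        show "x \<in> W B" using x W(2) by simp
      qed simp_all
      also have "trajectory E j (sweep xs) ?a ?\<xi> (length xs * (m * B)) =
          trajectory E j (sweep xs) (fill ({..<m * B} \<times> set xs) None ?a) ?\<xi> (length xs * (m * B))"
      proof (rule trajectory_cong)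
        fix k assume "k < length xs * (m * B)"
        then have "sweep xs k \<in> {..<m * B} \<times> set xs"
          using V(2) xs(1) by (intro sweep_range) auto
        then show "?a (sweep xs k) = fill ({..<m * B} \<times> set xs) None ?a (sweep xs k)"
          by (simp add: fill_def)
      qed
      finally show "\<eta> (s * real B) \<omega> x =
       trajectory E j (sweep xs) (fill ({..<m * B} \<times> set xs) None (cell_symbol q d (clocks \<omega>) (marks \<omega>)))
         (fill (set xs) True (\<eta> 0 \<omega>)) (length xs * (m * B)) x" .
    qed
  qed
  moreover have "xs \<noteq> []" using V(2) xs(1) by auto
  moreover have "S \<subseteq> set xs" using SW by (auto simp: xs(1) V_def)
  moreover have "A1 \<union> A2 \<in> events" using A1(1) A2(1) by (rule sets.Un)
  ultimately show ?thesis using xs(2) m pA unfolding d_def by (intro that[of xs m "A1 \<union> A2"])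
qed

end

text \<open>
  Here \<open>\<tau>\<close> is the duration of a block. Each block is cut into \<open>b\<close> intervals of length \<open>s\<close>, short enough
  for the regions of influence to be finite, and these into \<open>m\<close> cells of length \<open>d\<close>. The
  exceptional event of the discretisation costs at most \<open>\<gamma>\<close>, which is arbitrary.
\<close>

lemma (in FA_model) convergence_in_blocks:
  fixes f :: "'v config \<Rightarrow> real" and p e C \<tau> :: real and K :: nat
  assumes E: "simple_graph E" and nb: "\<And>x. finite (nbrs E x)" "\<And>x. card (nbrs E x) \<le> D"
    and D: "0 < D" and R: "0 < R"
    and walks: "dense_defect_walks E j R"
    and mu: "\<mu>\<^sub>0 = bernoulli_product p"
    and par: "p \<in> {0..1}" "q \<in> {0..1}"
    and e: "(1 - p) + (1 - q) \<le> e" "exp (- \<tau>) + \<tau> * (1 - q) \<le> e" and \<tau>: "0 < \<tau>"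
    and small: "(4 * (real D + 3)) ^ (2 * R) * e \<le> 1 / 4"
    and S: "finite S" "\<And>\<eta> \<eta>'. (\<And>x. x \<in> S \<Longrightarrow> \<eta> x = \<eta>' x) \<Longrightarrow> f \<eta> = f \<eta>'"
    and C: "\<And>\<eta>. \<bar>f \<eta>\<bar> \<le> C"
  shows "\<bar>expectation (\<lambda>\<omega>. f (\<eta> (\<tau> * K) \<omega>)) - (\<integral>\<xi>. f \<xi> \<partial>bernoulli_product q)\<bar>
         \<le> 2 * C * card S * (1 / 2) powr (real K / real (2 * R))"
proof (rule field_le_epsilon)
  fix \<gamma> :: real assume \<gamma>: "0 < \<gamma>"
  have C0: "0 \<le> C" using C[of undefined] by linarith
  define \<delta> where "\<delta> = \<gamma> / (2 * C + 1)"
  have \<delta>: "0 < \<delta>" using \<gamma> C0 by (simp add: \<delta>_def)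
  have C\<delta>: "2 * C * \<delta> \<le> \<gamma>"
  proof -
    have "2 * C * \<delta> \<le> (2 * C + 1) * \<delta>" using \<delta> by (simp add: algebra_simps)
    then show ?thesis using C0 by (simp add: \<delta>_def)
  qed
  obtain b0 :: nat where b0: "real D * \<tau> * 2 \<le> real b0" using real_arch_simple by blast
  define b where "b = Suc b0"
  define s where "s = \<tau> / real b"
  have s: "0 < s" using \<tau> by (simp add: s_def b_def)
  have Ds: "D * s \<le> 1 / 2" using b0 by (simp add: s_def b_def field_simps)
  obtain xs m A where xs: "xs \<noteq> []" "distinct xs" "S \<subseteq> set xs" and m: "0 < m"
    and A: "A \<in> events" "prob A \<le> \<delta>"
    and ae: "AE \<omega> in M. \<omega> \<notin> A \<longrightarrow> (\<forall>x\<in>S. \<eta> (s * real (K * b)) \<omega> x =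
       trajectory E j (sweep xs) (fill ({..<m * (K * b)} \<times> set xs) None (cell_symbol q (s / real m) (clocks \<omega>) (marks \<omega>)))
         (fill (set xs) True (\<eta> 0 \<omega>)) (length xs * (m * (K * b))) x)"
    by (rule discretisation[OF E nb D s Ds S(1) \<delta>, of "K * b"]) (rule that)
  define N where "N = m * (K * b)"
  define d where "d = s / real m"
  define L where "L = m * b"
  have NL: "N = L * K" by (simp add: N_def L_def)
  have d: "0 < d" using s m by (simp add: d_def)
  have L: "0 < L" using m by (simp add: L_def b_def)
  have b: "0 < b" by (simp add: b_def)
  have dL: "d * real L = \<tau>" using m b by (simp add: d_def L_def s_def)
  define r where "r = 1 - exp (- d)"
  have r: "r \<in> {0..1}" using d by (simp add: r_def)
  \<comment> \<open>a site is silent during a whole block with probability exactly \<open>exp (- \<tau>)\<close>, whatever the mesh\<close>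
  have e2: "(1 - r) ^ L + L * (r * (1 - q)) \<le> e"
  proof -
    have "(1 - r) ^ L = exp (- \<tau>)"
      unfolding r_def dL[symmetric] by (simp add: exp_of_nat_mult[symmetric] mult.commute)
    moreover have "r \<le> d" using exp_ge_add_one_self[of "- d"] by (simp add: r_def)
    then have "real L * (r * (1 - q)) \<le> real L * (d * (1 - q))"
      using par by (intro mult_left_mono mult_right_mono) auto
    moreover have "real L * (d * (1 - q)) = \<tau> * (1 - q)" using dL by (simp add: mult_ac)
    ultimately show ?thesis using e(2) by linarith
  qed
  define g where "g = (\<lambda>z :: 'v config \<times> (nat \<times> 'v \<Rightarrow> bool option). f (trajectory E j (sweep xs) (snd z) (fst z) (length xs * N)))"
  define Z where "Z = (\<lambda>\<omega>. (fill (set xs) True (\<eta> 0 \<omega>), fill ({..<N} \<times> set xs) None (cell_symbol q d (clocks \<omega>) (marks \<omega>))))"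
  have t: "s * real (K * b) = \<tau> * K" using b by (simp add: s_def)
  have t0: "0 \<le> \<tau> * K" using \<tau> by simp
  have fm: "(\<lambda>\<omega>. f (\<eta> (\<tau> * K) \<omega>)) \<in> borel_measurable M"
    by (rule local_measurable[OF S t0])
  have gm: "(\<lambda>\<omega>. g (Z \<omega>)) \<in> borel_measurable M"
    unfolding Z_def by (rule expectation_discrete(2)[OF mu _ d par(2)]) simp
  have fi: "integrable M (\<lambda>\<omega>. f (\<eta> (\<tau> * K) \<omega>))"
    by (rule integrable_const_bound[of _ C]) (use C fm in auto)
  have gi: "integrable M (\<lambda>\<omega>. g (Z \<omega>))"
    by (rule integrable_const_bound[of _ C]) (use C gm in \<open>auto simp: g_def\<close>)
  have Ai: "integrable M (\<lambda>\<omega>. 2 * C * indicator A \<omega>)"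
    using A(1) by (intro integrable_mult_right) (simp add: emeasure_eq_measure)
  have "\<bar>expectation (\<lambda>\<omega>. f (\<eta> (\<tau> * K) \<omega>)) - expectation (\<lambda>\<omega>. g (Z \<omega>))\<bar> =
      \<bar>expectation (\<lambda>\<omega>. f (\<eta> (\<tau> * K) \<omega>) - g (Z \<omega>))\<bar>"
    by (simp only: Bochner_Integration.integral_diff[OF fi gi])
  also have "\<dots> \<le> expectation (\<lambda>\<omega>. \<bar>f (\<eta> (\<tau> * K) \<omega>) - g (Z \<omega>)\<bar>)"
    by (rule integral_abs_bound)
  also have "\<dots> \<le> expectation (\<lambda>\<omega>. 2 * C * indicator A \<omega>)"
  proof (rule integral_mono_AE)
    show "integrable M (\<lambda>\<omega>. \<bar>f (\<eta> (\<tau> * K) \<omega>) - g (Z \<omega>)\<bar>)"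
      by (intro integrable_abs Bochner_Integration.integrable_diff fi gi)
    show "AE \<omega> in M. \<bar>f (\<eta> (\<tau> * K) \<omega>) - g (Z \<omega>)\<bar> \<le> 2 * C * indicator A \<omega>"
      using ae
    proof eventually_elim
      case (elim \<omega>)
      show ?case
      proof (cases "\<omega> \<in> A")
        case True
        then show ?thesis using C[of "\<eta> (\<tau> * K) \<omega>"]
            C[of "trajectory E j (sweep xs) (snd (Z \<omega>)) (fst (Z \<omega>)) (length xs * N)"]
          by (simp add: g_def)
      next
        case False
        have "\<eta> (\<tau> * K) \<omega> x = trajectory E j (sweep xs) (snd (Z \<omega>)) (fst (Z \<omega>)) (length xs * N) x"
          if "x \<in> S" for x
          using bspec[OF mp[OF elim False] that] unfolding t Z_def N_def d_def fst_conv snd_conv .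
        then have "f (\<eta> (\<tau> * K) \<omega>) = g (Z \<omega>)"
          unfolding g_def by (rule S(2))
        then show ?thesis using C0 by simp
      qed
    qed
  qed (rule Ai)
  also have "\<dots> = 2 * C * prob A" using A(1) by simp
  also have "\<dots> \<le> 2 * C * \<delta>" by (rule mult_left_mono[OF A(2)]) (use C0 in simp)
  finally have 1: "\<bar>expectation (\<lambda>\<omega>. f (\<eta> (\<tau> * K) \<omega>)) - expectation (\<lambda>\<omega>. g (Z \<omega>))\<bar> \<le> \<gamma>"
    using C\<delta> by linarith
  have "expectation (\<lambda>\<omega>. g (Z \<omega>)) =
      measure_pmf.expectation (pair_pmf (product_pmf (set xs) p) (field_pmf (set xs) N (1 - exp (- d)) q)) g"
    unfolding Z_def by (rule expectation_discrete(1)[OF mu _ d par(2)]) simp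
  also have "\<dots> = measure_pmf.expectation (pair_pmf (product_pmf (set xs) p) (field_pmf (set xs) (L * K) r q))
            (\<lambda>(\<xi>, a). f (trajectory E j (sweep xs) a \<xi> (length xs * L * K)))"
    unfolding g_def NL r_def by (simp only: case_prod_unfold mult.assoc)
  finally have 2: "expectation (\<lambda>\<omega>. g (Z \<omega>)) =
    measure_pmf.expectation (pair_pmf (product_pmf (set xs) p) (field_pmf (set xs) (L * K) r q))
            (\<lambda>(\<xi>, a). f (trajectory E j (sweep xs) a \<xi> (length xs * L * K)))" .
  have 3: "(\<integral>\<xi>. f \<xi> \<partial>bernoulli_product q) = measure_pmf.expectation (product_pmf (set xs) q) f"
    by (rule integral_bernoulli_product[OF _ xs(3) S(2)]) auto
  have "\<bar>expectation (\<lambda>\<omega>. g (Z \<omega>)) - (\<integral>\<xi>. f \<xi> \<partial>bernoulli_product q)\<bar>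
         \<le> 2 * C * card S * (1 / 2) powr (real K / real (2 * R))"
    unfolding 2 3
    using discrete_convergence[where f = f and C = C and S = S and K = K,
          OF E nb R walks xs(1,2) L r par e(1) e2 small S C]
    by (simp only: of_nat_mult of_nat_numeral)
  with 1 show "\<bar>expectation (\<lambda>\<omega>. f (\<eta> (\<tau> * K) \<omega>)) - (\<integral>\<xi>. f \<xi> \<partial>bernoulli_product q)\<bar>
         \<le> 2 * C * card S * (1 / 2) powr (real K / real (2 * R)) + \<gamma>" by linarith
qed

section \<open>Exponential convergence\<close>

lemma local_on_bounded:
  assumes "local_on S f"
  shows "finite S" "\<And>\<eta> \<eta>'. (\<And>x. x \<in> S \<Longrightarrow> \<eta> x = \<eta>' x) \<Longrightarrow> f \<eta> = f \<eta>'" "\<And>\<eta>. \<bar>f \<eta>\<bar> \<le> sup_norm f"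
proof -
  from assms obtain f' where S: "finite S" and f': "\<And>\<eta>. f \<eta> = f' (restrict \<eta> S)"
    by (auto simp: local_on_def)
  show "finite S" by (rule S)
  show "f \<eta> = f \<eta>'" if "\<And>x. x \<in> S \<Longrightarrow> \<eta> x = \<eta>' x" for \<eta> \<eta>'
  proof -
    have "restrict \<eta> S = restrict \<eta>' S" using that by (auto simp: restrict_def)
    then show ?thesis by (simp add: f')
  qed
  have "range f \<subseteq> f' ` PiE S (\<lambda>_. UNIV)" using f' by auto
  moreover have "finite (f' ` PiE S (\<lambda>_. UNIV :: bool set))"
    by (intro finite_imageI finite_PiE S) simp
  ultimately have "finite (range f)" by (rule finite_subset)
  then have "finite (range (\<lambda>\<eta>. \<bar>f \<eta>\<bar>))"
    using finite_imageI[of "range f" abs] by (simp add: image_image)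
  then have "bdd_above (range (\<lambda>\<eta>. \<bar>f \<eta>\<bar>))" by (rule bdd_above_finite)
  then show "\<bar>f \<eta>\<bar> \<le> sup_norm f" for \<eta> unfolding sup_norm_def by (rule cSUP_upper[rotated]) simp
qed

theorem theorem2p6:
  fixes E :: "'v set set" and j :: nat
  assumes "simple_graph E"
    and "connected_graph E"
    and "infinite (UNIV :: 'v set)"
    and "bounded_degree E"
    and "1 \<le> j" and "j \<le> min_degree E"
    and "omega_good E j"
  shows "\<exists>\<epsilon>>0. \<exists>c>0. \<forall>p\<in>{0..1}. \<forall>q\<in>{0..1}. 1 - \<epsilon> \<le> p \<longrightarrow> 1 - \<epsilon> \<le> q \<longrightarrow>
    (\<forall>(M :: 'w measure) P U \<eta>. FA_model M P U E j q (bernoulli_product p) \<eta> \<longrightarrow>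
      (\<forall>f S t. local_on S f \<longrightarrow> 0 \<le> t \<longrightarrow>
        \<bar>prob_space.expectation M (\<lambda>\<omega>. f (\<eta> t \<omega>)) - (\<integral>\<xi>. f \<xi> \<partial>bernoulli_product q)\<bar>
          \<le> (1 / c) * real (card S) * sup_norm f * exp (- c * t)))"
proof -
  have nbf: "\<And>x. finite (nbrs E x)" and bdd: "bdd_above (range (deg E))"
    using assms(4) by (auto simp: bounded_degree_def)
  obtain D where D: "\<And>x. card (nbrs E x) \<le> D"
    using bdd by (auto simp: bdd_above_def deg_def)
  have "min_degree E \<le> deg E undefined"
    unfolding min_degree_def by (rule cINF_lower) auto
  then have jD: "j \<le> D" using assms(6) D[of undefined] by (simp add: deg_def)
  then have D0: "0 < D" using assms(5) by simp
  obtain R0 where R0: "dense_defect_walks E j R0"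
    using zero_path_walk[OF assms(1,2) nbf D jD assms(7)] by blast
  define R where "R = Suc R0"
  have R: "0 < R" by (simp add: R_def)
  have walks: "dense_defect_walks E j R"
    by (rule dense_defect_walks_mono[OF R0]) (simp add: R_def)
  \<comment> \<open>the threshold for bad site-blocks demanded by the union bound\<close>
  define e where "e = 1 / (4 * (4 * (real D + 3)) ^ (2 * R))"
  have e: "0 < e" "(4 * (real D + 3)) ^ (2 * R) * e \<le> 1 / 4" by (simp_all add: e_def)
  \<comment> \<open>blocks so long that a silent clock is rare; then \<open>\<epsilon>\<close> so small that a proposed zero is rare even in a block of length \<open>2 * \<tau>\<close>\<close>
  define \<tau> where "\<tau> = max 1 (- ln (e / 2))"
  have \<tau>: "1 \<le> \<tau>" "exp (- \<tau>) \<le> e / 2"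
  proof -
    have "exp (- \<tau>) \<le> exp (ln (e / 2))" by (simp add: \<tau>_def)
    then show "exp (- \<tau>) \<le> e / 2" using e by simp
  qed (simp add: \<tau>_def)
  define \<epsilon> where "\<epsilon> = e / (4 * \<tau>)"
  have \<epsilon>: "0 < \<epsilon>" using e \<tau> by (simp add: \<epsilon>_def)
  \<comment> \<open>the rate obtained from \<open>2 ^ (- K / (2 * R))\<close> with \<open>K\<close> of order \<open>t / \<tau>\<close>; the minimum with \<open>1 / 4\<close> lets \<open>1 / c\<close> absorb the factor \<open>4\<close>\<close>
  define c0 where "c0 = ln 2 / (2 * R * \<tau>)"
  define c where "c = min c0 (1 / 4)"
  have c: "0 < c" using R \<tau> by (simp add: c_def c0_def)
  have c4: "4 \<le> 1 / c" using c by (simp add: c_def field_simps)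
  have c0\<tau>: "exp (c0 * \<tau>) \<le> 2"
  proof -
    have "c0 * \<tau> = ln 2 / (2 * R)" using \<tau> by (simp add: c0_def)
    also have "\<dots> \<le> ln 2" using R by (simp add: field_simps)
    finally show ?thesis by (metis exp_le_cancel_iff exp_ln zero_less_numeral)
  qed
  show ?thesis
  proof (rule exI[of _ \<epsilon>], rule conjI[OF \<epsilon>], rule exI[of _ c], rule conjI[OF c], intro ballI allI impI)
    fix p q :: real and M :: "'w measure" and P U \<eta> and f :: "'v config \<Rightarrow> real" and S and t :: real
    assume pq: "p \<in> {0..1}" "q \<in> {0..1}" "1 - \<epsilon> \<le> p" "1 - \<epsilon> \<le> q"
      and FA: "FA_model M P U E j q (bernoulli_product p) \<eta>" and loc: "local_on S f" and t: "0 \<le> t"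
    interpret FA_model where M = M and P = P and U = U and E = E and j = j and q = q
      and \<mu>\<^sub>0 = "bernoulli_product p" and \<eta> = \<eta> and clocks = "\<lambda>\<omega> x. P x \<omega>"
      and marks = "\<lambda>\<omega> (x, n). U x (nth_point (P x \<omega>) n) \<omega>"
      by (rule FA | rule reflexive)+
    note f = local_on_bounded[OF loc]
    define C where "C = sup_norm f"
    have C0: "0 \<le> C" using f(3)[of undefined] unfolding C_def by linarith
    let ?\<Delta> = "\<bar>expectation (\<lambda>\<omega>. f (\<eta> t \<omega>)) - (\<integral>\<xi>. f \<xi> \<partial>bernoulli_product q)\<bar>"
    have main: "?\<Delta> \<le> 4 * C * card S * exp (- c0 * t)"
    proof (cases "t < \<tau>")
      case True
      \<comment> \<open>for short times \<open>exp (- c0 * t)\<close> is at least \<open>1 / 2\<close>, and the trivial bound \<open>2 * C\<close> suffices\<close>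
      interpret B: prob_space "bernoulli_product q :: 'v config measure" by (rule prob_space_bernoulli_product)
      have avg: "\<bar>integral\<^sup>L Q h\<bar> \<le> C" if "prob_space Q" "\<And>z. \<bar>h z\<bar> \<le> C" for Q :: "'z measure" and h :: "'z \<Rightarrow> real"
      proof -
        interpret Q: prob_space Q by (rule that(1))
        show ?thesis
        proof (cases "integrable Q h")
          case True
          have "\<bar>integral\<^sup>L Q h\<bar> \<le> (\<integral>z. \<bar>h z\<bar> \<partial>Q)" by (rule integral_abs_bound)
          also have "\<dots> \<le> (\<integral>z. C \<partial>Q)" by (rule integral_mono) (use True that(2) in auto)
          finally show ?thesis by (simp add: Q.prob_space)
        qed (simp add: not_integrable_integral_eq C0)
      qed
      show ?thesis
      proof (cases "S = {}")
        case True
        define k where "k = f undefined"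
        have "f z = k" for z unfolding k_def by (rule f(2)) (simp add: True)
        then have "expectation (\<lambda>\<omega>. f (\<eta> t \<omega>)) = k" "(\<integral>\<xi>. f \<xi> \<partial>bernoulli_product q) = k"
          by (simp_all add: prob_space B.prob_space)
        then show ?thesis using C0 True by simp
      next
        case False
        have "\<bar>expectation (\<lambda>\<omega>. f (\<eta> t \<omega>))\<bar> \<le> C"
          by (rule avg[OF prob_space_axioms]) (use f(3) in \<open>simp add: C_def\<close>)
        moreover have "\<bar>\<integral>\<xi>. f \<xi> \<partial>bernoulli_product q\<bar> \<le> C"
          by (rule avg[OF B.prob_space_axioms]) (use f(3) in \<open>simp add: C_def\<close>)
        ultimately have 1: "?\<Delta> \<le> 2 * C" by linarith
        have "1 \<le> card S" using False f(1) by (simp add: Suc_le_eq card_gt_0_iff)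
        have c0: "0 \<le> c0" using R \<tau> by (simp add: c0_def)
        have "1 = exp (c0 * t) * exp (- c0 * t)" by (simp flip: exp_add)
        also have "\<dots> \<le> 2 * exp (- c0 * t)"
        proof (rule mult_right_mono)
          have "exp (c0 * t) \<le> exp (c0 * \<tau>)" using True c0 by (simp add: mult_left_mono)
          then show "exp (c0 * t) \<le> 2" using c0\<tau> by linarith
        qed simp
        finally have "1 * 1 \<le> real (card S) * (2 * exp (- c0 * t))"
          using \<open>1 \<le> card S\<close> by (intro mult_mono) auto
        then have "2 * C * 1 \<le> 2 * C * (real (card S) * (2 * exp (- c0 * t)))"
          by (intro mult_left_mono) (use C0 in auto)
        with 1 show ?thesis by (simp add: algebra_simps)
      qed
    next
      case False
      \<comment> \<open>\<open>t\<close> is divided into \<open>K\<close> equal blocks whose length lies between \<open>\<tau>\<close> and \<open>2 * \<tau>\<close>\<close>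
      define K where "K = nat \<lfloor>t / \<tau>\<rfloor>"
      have tt: "1 \<le> t / \<tau>" using False \<tau> by (simp add: field_simps)
      have K: "real K \<le> t / \<tau>" "t / \<tau> < real K + 1" "1 \<le> K"
        using tt by (simp_all add: K_def le_nat_floor)
      define \<tau>' where "\<tau>' = t / real K"
      have \<tau>': "\<tau> \<le> \<tau>'" "\<tau>' \<le> 2 * \<tau>"
      proof -
        show "\<tau> \<le> \<tau>'" using K \<tau> by (simp add: \<tau>'_def field_simps)
        have "t < (real K + 1) * \<tau>" using K(2) \<tau> by (simp add: field_simps)
        also have "\<dots> \<le> (2 * real K) * \<tau>" using K(3) \<tau> by (intro mult_right_mono) auto
        finally show "\<tau>' \<le> 2 * \<tau>" using K(3) by (simp add: \<tau>'_def field_simps)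
      qed
      have tK: "\<tau>' * real K = t" using K(3) by (simp add: \<tau>'_def)
      have e1: "(1 - p) + (1 - q) \<le> e"
      proof -
        have "\<epsilon> \<le> e / 4" unfolding \<epsilon>_def using e \<tau> by (intro divide_left_mono) auto
        then show ?thesis using pq e by linarith
      qed
      have e2: "exp (- \<tau>') + \<tau>' * (1 - q) \<le> e"
      proof -
        have "exp (- \<tau>') \<le> exp (- \<tau>)" using \<tau>' by simp
        moreover have "\<tau>' * (1 - q) \<le> 2 * \<tau> * \<epsilon>"
          using \<tau>' \<tau> pq by (intro mult_mono) auto
        moreover have "2 * \<tau> * \<epsilon> = e / 2" using \<tau> by (simp add: \<epsilon>_def)
        ultimately show ?thesis using \<tau>(2) by linarith
      qed
      have \<tau>'0: "0 < \<tau>'" using \<tau>' \<tau> by linarith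
      have "\<bar>expectation (\<lambda>\<omega>. f (\<eta> (\<tau>' * K) \<omega>)) - (\<integral>\<xi>. f \<xi> \<partial>bernoulli_product q)\<bar>
         \<le> 2 * C * card S * (1 / 2) powr (real K / real (2 * R))"
        by (rule convergence_in_blocks[OF assms(1) nbf D D0 R walks refl pq(1,2) e1 e2 \<tau>'0 e(2) f(1,2)])
          (use f(3) in \<open>simp_all add: C_def\<close>)
      then have "?\<Delta> \<le> 2 * C * card S * (1 / 2) powr (real K / real (2 * R))" by (simp only: tK)
      also have "\<dots> \<le> 2 * C * card S * (2 * exp (- c0 * t))"
      proof (rule mult_left_mono)
        have "(1 / 2 :: real) powr (real K / real (2 * R)) = exp (- (ln 2 * (K / (2 * R))))"
          by (simp add: powr_def ln_div)
        also have "\<dots> \<le> exp (c0 * \<tau> - c0 * t)"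
        proof -
          have "c0 * t = (ln 2 / (2 * R)) * (t / \<tau>)" by (simp add: c0_def)
          also have "\<dots> \<le> (ln 2 / (2 * R)) * (K + 1)" using K(2) by (intro mult_left_mono) auto
          also have "\<dots> = ln 2 * (K / (2 * R)) + c0 * \<tau>" using \<tau> R by (simp add: c0_def field_simps)
          finally show ?thesis by simp
        qed
        also have "\<dots> = exp (c0 * \<tau>) * exp (- c0 * t)" by (simp flip: exp_add)
        also have "\<dots> \<le> 2 * exp (- c0 * t)" by (rule mult_right_mono[OF c0\<tau>]) simp
        finally show "(1 / 2 :: real) powr (real K / real (2 * R)) \<le> 2 * exp (- c0 * t)" .
      qed (use C0 in simp)
      finally show ?thesis by (simp add: algebra_simps)
    qed
    also have "4 * C * card S * exp (- c0 * t) \<le> (1 / c) * C * card S * exp (- c * t)"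
    proof (intro mult_mono)
      show "exp (- c0 * t) \<le> exp (- c * t)" using t by (simp add: c_def mult_right_mono)
      show "4 \<le> 1 / c" by (rule c4)
      show "0 \<le> 1 / c" using c by simp
    qed (use C0 c in simp_all)
    finally show "?\<Delta> \<le> (1 / c) * real (card S) * sup_norm f * exp (- c * t)"
      by (simp add: C_def mult_ac)
  qed
qed

end
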